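(* For each integer $n \ge 1$ let $c_n$ be the smallest constant such that for every bounded convex domain $\Omega \subset \mathbb{R}^n$ and every convex function $f$ on $\Omega$ (defined up to the boundary) with $f|_{\partial\Omega} \ge 0$ one has $$ \frac{1}{|\Omega|} \int_{\Omega} f \, d\mathcal{H}^n \leq \frac{c_n}{|\partial \Omega|} \int_{\partial \Omega} f \, d\mathcal{H}^{n-1}.$$ Then, as $n \to \infty$, $$ c_n \leq \left(1 + \frac{1}{4n} + o(n^{-1})\right) n^{n+1}.$$
   Context: A domain is a nonempty connected open set. $\mathcal{H}^k$ is the $k$-dimensional Hausdorff measure; $|\Omega| = \mathcal{H}^n(\Omega)$ and $|\partial\Omega| = \mathcal{H}^{n-1}(\partial\Omega)$. Functions $f$ are real-valued and convex on the closure $\overline{\Omega}$. The bound means: there is a sequence $\varepsilon_n$ with $n\varepsilon_n \to 0$ such that $c_n \le (1 + \frac{1}{4n} + \varepsilon_n) n^{n+1}$ for all $n$. *)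

theory Defs
  imports "HOL-Analysis.Analysis"
begin

section \<open>Hausdorff measure on a metric space\<close>

context Metric_space
begin

definition ediam :: "'a set \<Rightarrow> ennreal" where
  "ediam U = (SUP x\<in>U. SUP y\<in>U. ennreal (d x y))"

(* The case distinction matters for k = 0 only, where ediam U ^ 0 = 1 and the result is
   to be the counting measure. *)
definition hausdorff_weight :: "nat \<Rightarrow> 'a set \<Rightarrow> ennreal" where
  "hausdorff_weight k U =
     (if U = {} then 0 else ennreal (unit_ball_vol (real k) / 2 ^ k) * ediam U ^ k)"

definition hausdorff_content :: "nat \<Rightarrow> real \<Rightarrow> 'a set \<Rightarrow> ennreal" where
  "hausdorff_content k \<delta> A =
     (INF U \<in> {U :: nat \<Rightarrow> 'a set. A \<subseteq> (\<Union>i. U i) \<and> (\<forall>i. U i \<subseteq> M \<and> ediam (U i) \<le> ennreal \<delta>)}.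
        \<Sum>i. hausdorff_weight k (U i))"

definition hausdorff_outer :: "nat \<Rightarrow> 'a set \<Rightarrow> ennreal" where
  "hausdorff_outer k A = (SUP \<delta>\<in>{0<..}. hausdorff_content k \<delta> A)"

(* The measurable sets are those in the sense of Caratheodory. *)
definition hausdorff_measure :: "nat \<Rightarrow> 'a measure" where
  "hausdorff_measure k =
     measure_of M (lambda_system M (Pow M) (hausdorff_outer k)) (hausdorff_outer k)"

lemma hausdorff_content_mono: "A \<subseteq> B \<Longrightarrow> hausdorff_content k \<delta> A \<le> hausdorff_content k \<delta> B"
  unfolding hausdorff_content_def by (rule INF_superset_mono) auto

lemma hausdorff_content_empty: "hausdorff_content k \<delta> {} = 0"
proof -
  have "hausdorff_content k \<delta> {} \<le> (\<Sum>i::nat. hausdorff_weight k {})"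
    unfolding hausdorff_content_def
    by (rule INF_lower2[of "\<lambda>_. {}"]) (auto simp: ediam_def bot_ennreal)
  then show ?thesis by (simp add: hausdorff_weight_def)
qed

lemma hausdorff_content_UN:
  "hausdorff_content k \<delta> (\<Union>i. A i) \<le> (\<Sum>i::nat. hausdorff_content k \<delta> (A i))"
proof (rule ennreal_le_epsilon)
  fix e :: real
  assume fin: "(\<Sum>i. hausdorff_content k \<delta> (A i)) < top" and "0 < e"
  let ?C = "\<lambda>B. {U :: nat \<Rightarrow> 'a set. B \<subseteq> (\<Union>i. U i) \<and>
                     (\<forall>i. U i \<subseteq> M \<and> ediam (U i) \<le> ennreal \<delta>)}"
  have "\<exists>U\<in>?C (A n). (\<Sum>i. hausdorff_weight k (U i)) \<le>
          hausdorff_content k \<delta> (A n) + ennreal (e * (1/2) ^ Suc n)" for n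
  proof -
    have "hausdorff_content k \<delta> (A n) < top"
      using fin by (metis ennreal_suminf_lessD)
    then have "hausdorff_content k \<delta> (A n) <
        hausdorff_content k \<delta> (A n) + ennreal (e * (1/2) ^ Suc n)"
      using \<open>0 < e\<close> by (simp add: ennreal_add_left_cancel_less[of _ 0, simplified])
    then show ?thesis
      unfolding hausdorff_content_def INF_less_iff by (auto intro: less_imp_le)
  qed
  then have "\<forall>n. \<exists>U. U \<in> ?C (A n) \<and> (\<Sum>i. hausdorff_weight k (U i)) \<le>
          hausdorff_content k \<delta> (A n) + ennreal (e * (1/2) ^ Suc n)"
    by (auto simp only: Bex_def)
  from choice[OF this] obtain U where U: "\<And>n. U n \<in> ?C (A n)"
    and le: "\<And>n. (\<Sum>i. hausdorff_weight k (U n i)) \<le>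
          hausdorff_content k \<delta> (A n) + ennreal (e * (1/2) ^ Suc n)"
    by blast
  define V where "V m = (case prod_decode m of (n, i) \<Rightarrow> U n i)" for m
  have "(\<Union>i. A i) \<subseteq> (\<Union>m. V m)"
  proof
    fix x assume "x \<in> (\<Union>i. A i)"
    then obtain n i where "x \<in> U n i" using U by blast
    then have "x \<in> V (prod_encode (n, i))" by (simp add: V_def)
    then show "x \<in> (\<Union>m. V m)" by blast
  qed
  moreover have "V m \<subseteq> M \<and> ediam (V m) \<le> ennreal \<delta>" for m
    using U by (auto simp: V_def split: prod.split)
  ultimately have "V \<in> ?C (\<Union>i. A i)" by blast
  then have "hausdorff_content k \<delta> (\<Union>i. A i) \<le> (\<Sum>m. hausdorff_weight k (V m))"
    unfolding hausdorff_content_def by (rule INF_lower)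
  also have "\<dots> = (\<Sum>n. \<Sum>i. hausdorff_weight k (U n i))"
    using suminf_ennreal_2dimen[of "\<lambda>n. \<Sum>i. hausdorff_weight k (U n i)"
        "\<lambda>(n, i). hausdorff_weight k (U n i)"]
    by (simp add: V_def comp_def case_prod_unfold)
  also have "\<dots> \<le> (\<Sum>n. hausdorff_content k \<delta> (A n) + ennreal (e * (1/2) ^ Suc n))"
    by (intro suminf_le le) auto
  also have "\<dots> = (\<Sum>n. hausdorff_content k \<delta> (A n)) + (\<Sum>n. ennreal (e * (1/2) ^ Suc n))"
    by (subst suminf_add) auto
  also have "(\<Sum>n. ennreal (e * (1/2) ^ Suc n)) = ennreal e"
    using \<open>0 < e\<close> sums_mult[OF power_half_series, of e]
    by (subst suminf_ennreal_eq[where x = e]) auto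
  finally show "hausdorff_content k \<delta> (\<Union>i. A i) \<le>
      (\<Sum>i. hausdorff_content k \<delta> (A i)) + ennreal e" .
qed

lemma outer_measure_space_hausdorff: "outer_measure_space (Pow M) (hausdorff_outer k)"
  unfolding outer_measure_space_def
proof (intro conjI)
  show "positive (Pow M) (hausdorff_outer k)"
    by (simp add: positive_def hausdorff_outer_def hausdorff_content_empty)
  show "increasing (Pow M) (hausdorff_outer k)"
    unfolding increasing_def hausdorff_outer_def
    by (intro ballI impI SUP_mono) (auto intro: hausdorff_content_mono)
  show "countably_subadditive (Pow M) (hausdorff_outer k)"
    unfolding countably_subadditive_def hausdorff_outer_def
  proof (intro allI impI SUP_least)
    fix A :: "nat \<Rightarrow> 'a set" and \<delta> :: real
    assume "\<delta> \<in> {0<..}"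
    then show "hausdorff_content k \<delta> (\<Union>i. A i) \<le> (\<Sum>i. SUP \<delta>\<in>{0<..}. hausdorff_content k \<delta> (A i))"
      by (intro order_trans[OF hausdorff_content_UN] suminf_le SUP_upper) auto
  qed
qed

lemma space_hausdorff_measure [simp]: "space (hausdorff_measure k) = M"
  and sets_hausdorff_measure:
    "sets (hausdorff_measure k) = lambda_system M (Pow M) (hausdorff_outer k)"
  and emeasure_hausdorff_measure:
    "A \<in> sets (hausdorff_measure k) \<Longrightarrow> emeasure (hausdorff_measure k) A = hausdorff_outer k A"
proof -
  let ?L = "lambda_system M (Pow M) (hausdorff_outer k)"
  interpret sigma_algebra M "Pow M" by (rule sigma_algebra_Pow)
  have ms: "measure_space M ?L (hausdorff_outer k)"
    by (rule caratheodory_lemma) (rule outer_measure_space_hausdorff)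
  then interpret L: sigma_algebra M ?L by (simp add: measure_space_def)
  show "space (hausdorff_measure k) = M"
    unfolding hausdorff_measure_def by (rule L.space_measure_of_eq)
  show *: "sets (hausdorff_measure k) = ?L"
    unfolding hausdorff_measure_def by (rule L.sets_measure_of_eq)
  show "emeasure (hausdorff_measure k) A = hausdorff_outer k A"
    if "A \<in> sets (hausdorff_measure k)"
    using ms that unfolding * hausdorff_measure_def measure_space_def
    by (intro emeasure_measure_of_sigma) auto
qed

end


section \<open>Euclidean space of variable dimension\<close>

(* The dimension has to range over nat inside a single formula, so R^n is taken to be
   Euclidean_space n, i.e. the functions nat => real that vanish from index n on.
   The type class metric on nat => real is not the Euclidean one; hence dist, bounded, open,
   frontier etc. of the type class are never used below. *)

definition euclid_dist :: "nat \<Rightarrow> (nat \<Rightarrow> real) \<Rightarrow> (nat \<Rightarrow> real) \<Rightarrow> real" where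
  "euclid_dist n x y = L2_set (\<lambda>i. x i - y i) {..<n}"

interpretation euclid: Metric_space "topspace (Euclidean_space n)" "euclid_dist n" for n
proof
  fix x y z :: "nat \<Rightarrow> real"
  show "0 \<le> euclid_dist n x y" by (simp add: euclid_dist_def)
  show "euclid_dist n x y = euclid_dist n y x"
    by (simp add: euclid_dist_def L2_set_def power2_commute)
  show "euclid_dist n x y = 0 \<longleftrightarrow> x = y"
    if "x \<in> topspace (Euclidean_space n)" "y \<in> topspace (Euclidean_space n)"
  proof -
    have "euclid_dist n x y = 0 \<longleftrightarrow> (\<forall>i<n. x i = y i)"
      by (auto simp: euclid_dist_def L2_set_eq_0_iff)
    then show ?thesis
      using that by (auto simp: topspace_Euclidean_space fun_eq_iff) (metis not_le)
  qed
  show "euclid_dist n x z \<le> euclid_dist n x y + euclid_dist n y z"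
    using L2_set_triangle_ineq[of "\<lambda>i. x i - y i" "\<lambda>i. y i - z i" "{..<n}"]
    by (simp add: euclid_dist_def)
qed

lemma mtopology_euclid: "euclid.mtopology n = Euclidean_space n"
proof -
  let ?E = "topspace (Euclidean_space n)"
  have top: "topspace (Euclidean_space n) = ?E" ..
  have "openin (euclid.mtopology n) U \<longleftrightarrow> openin (Euclidean_space n) U" for U
  proof
    assume U: "openin (Euclidean_space n) U"
    then have sub: "U \<subseteq> ?E" by (rule openin_subset)
    from U obtain T where T: "openin (powertop_real UNIV) T" "U = T \<inter> {x. \<forall>i\<ge>n. x i = 0}"
      unfolding Euclidean_space_def openin_subtopology by blast
    show "openin (euclid.mtopology n) U"
      unfolding euclid.openin_mtopology
    proof (intro conjI sub allI impI)
      fix x assume x: "x \<in> U"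
      then obtain X where X: "x \<in> Pi\<^sub>E UNIV X" "\<And>i. open (X i)" "Pi\<^sub>E UNIV X \<subseteq> T"
        using T product_topology_open_contains_basis[of "\<lambda>_. euclideanreal" UNIV T x] by auto
      have "\<exists>r>0. \<forall>t. \<bar>t - x i\<bar> < r \<longrightarrow> t \<in> X i" for i
        using X(1) X(2)[of i] unfolding open_dist
        by (auto simp: PiE_iff dist_real_def)
      then obtain r where r: "\<And>i. r i > 0" "\<And>i t. \<bar>t - x i\<bar> < r i \<Longrightarrow> t \<in> X i" by metis
      define e where "e = Min (insert 1 (r ` {..<n}))"
      have e: "e > 0" "\<And>i. i < n \<Longrightarrow> e \<le> r i"
        using r(1) by (auto simp: e_def)
      have "euclid.mball n x e \<subseteq> U"
      proof
        fix y assume y: "y \<in> euclid.mball n x e"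
        then have yE: "y \<in> ?E" and d: "euclid_dist n x y < e" by (auto simp: euclid.mball_def)
        have "y i \<in> X i" for i
        proof (cases "i < n")
          case True
          have "\<bar>x i - y i\<bar> \<le> euclid_dist n x y"
            using member_le_L2_set[of "{..<n}" i "\<lambda>i. \<bar>x i - y i\<bar>"] True
            by (simp add: euclid_dist_def L2_set_def)
          then show ?thesis using d e(2)[OF True] by (intro r(2)) (simp add: abs_minus_commute)
        next
          case False
          then have "y i = x i" using yE x sub by (auto simp: topspace_Euclidean_space)
          then show ?thesis using X(1) by (auto simp: PiE_iff)
        qed
        then have "y \<in> T" using X(3) by (auto simp: PiE_iff)
        then show "y \<in> U" using yE T by (auto simp: topspace_Euclidean_space)
      qed
      then show "\<exists>r>0. euclid.mball n x r \<subseteq> U" using e by blast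
    qed
  next
    assume U: "openin (euclid.mtopology n) U"
    then have sub: "U \<subseteq> ?E" using euclid.openin_mtopology by blast
    have "\<exists>T. openin (Euclidean_space n) T \<and> x \<in> T \<and> T \<subseteq> U" if x: "x \<in> U" for x
    proof -
      obtain r where r: "r > 0" "euclid.mball n x r \<subseteq> U"
        using U x euclid.openin_mtopology by blast
      define s where "s = r / (real n + 1)"
      have s: "s > 0" "real n * s < r" using r by (auto simp: s_def field_simps)
      define T where "T = {y \<in> ?E. \<forall>i<n. y i \<in> {x i - s <..< x i + s}}"
      have T_eq: "T = ?E \<inter> (\<Inter>i\<in>{..<n}. {y \<in> ?E. y i \<in> {x i - s <..< x i + s}})"
        by (auto simp: T_def)
      have "continuous_map (Euclidean_space n) euclideanreal (\<lambda>y. y i)" for i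
        unfolding Euclidean_space_def
        by (intro continuous_map_from_subtopology continuous_map_product_projection) auto
      then have "openin (Euclidean_space n) {y \<in> ?E. y i \<in> {x i - s <..< x i + s}}" for i
        by (rule openin_continuous_map_preimage) auto
      then have "openin (Euclidean_space n) T"
        unfolding T_eq
        by (cases "n = 0") (auto intro!: openin_Int openin_INT2)
      moreover have "x \<in> T" using x sub s by (auto simp: T_def)
      moreover have "T \<subseteq> euclid.mball n x r"
      proof
        fix y assume y: "y \<in> T"
        have "euclid_dist n x y \<le> (\<Sum>i<n. \<bar>x i - y i\<bar>)"
          unfolding euclid_dist_def by (rule L2_set_le_sum_abs)
        also have "\<dots> \<le> (\<Sum>i<n. s)"
          using y by (intro sum_mono) (auto simp: T_def abs_if)
        finally show "y \<in> euclid.mball n x r"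
          using s y x sub by (auto simp: euclid.mball_def T_def)
      qed
      ultimately show ?thesis using r(2) by blast
    qed
    then show "openin (Euclidean_space n) U"
      by (subst openin_subopen) blast
  qed
  then show ?thesis by (simp add: topology_eq)
qed

(* The function type is not an instance of real_vector, so the library's convex and convex_on
   do not apply. *)
definition convex_comb :: "real \<Rightarrow> (nat \<Rightarrow> real) \<Rightarrow> (nat \<Rightarrow> real) \<Rightarrow> nat \<Rightarrow> real" where
  "convex_comb t x y = (\<lambda>i. (1 - t) * x i + t * y i)"

definition convex_set :: "(nat \<Rightarrow> real) set \<Rightarrow> bool" where
  "convex_set S \<longleftrightarrow> (\<forall>x\<in>S. \<forall>y\<in>S. \<forall>t\<in>{0..1}. convex_comb t x y \<in> S)"

definition convex_fun_on :: "(nat \<Rightarrow> real) set \<Rightarrow> ((nat \<Rightarrow> real) \<Rightarrow> real) \<Rightarrow> bool" where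
  "convex_fun_on S f \<longleftrightarrow> convex_set S \<and>
     (\<forall>x\<in>S. \<forall>y\<in>S. \<forall>t\<in>{0..1}. f (convex_comb t x y) \<le> (1 - t) * f x + t * f y)"

definition bounded_convex_domain :: "nat \<Rightarrow> (nat \<Rightarrow> real) set \<Rightarrow> bool" where
  "bounded_convex_domain n \<Omega> \<longleftrightarrow>
     \<Omega> \<noteq> {} \<and> openin (Euclidean_space n) \<Omega> \<and> connectedin (Euclidean_space n) \<Omega> \<and>
     euclid.mbounded n \<Omega> \<and> convex_set \<Omega>"


section \<open>The Hermite--Hadamard constant\<close>

(* The integral over A as an extended real: positive part minus negative part.
   A convex function on the closure of a bounded convex domain is bounded below, so the second
   term is finite wherever this is used.  The first one may be infinite, because a finite convex
   function need not be bounded near the boundary; nor need its boundary values be measurable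
   (at extreme points they are arbitrary), in which case nn_integral is the lower integral. *)
definition ext_integral :: "'a measure \<Rightarrow> 'a set \<Rightarrow> ('a \<Rightarrow> real) \<Rightarrow> ereal" where
  "ext_integral M A f =
     enn2ereal (\<integral>\<^sup>+x\<in>A. ennreal (f x) \<partial>M) - enn2ereal (\<integral>\<^sup>+x\<in>A. ennreal (- f x) \<partial>M)"

definition hermite_hadamard_bound :: "nat \<Rightarrow> real \<Rightarrow> bool" where
  "hermite_hadamard_bound n c \<longleftrightarrow>
     (\<forall>\<Omega> f. bounded_convex_domain n \<Omega> \<longrightarrow>
        convex_fun_on (Euclidean_space n closure_of \<Omega>) f \<longrightarrow>
        (\<forall>x \<in> Euclidean_space n frontier_of \<Omega>. 0 \<le> f x) \<longrightarrow>
        1 / enn2ereal (emeasure (euclid.hausdorff_measure n n) \<Omega>) *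
          ext_integral (euclid.hausdorff_measure n n) \<Omega> f
        \<le> ereal c / enn2ereal (emeasure (euclid.hausdorff_measure n (n - 1))
                       (Euclidean_space n frontier_of \<Omega>)) *
          ext_integral (euclid.hausdorff_measure n (n - 1)) (Euclidean_space n frontier_of \<Omega>) f)"

definition hermite_hadamard_const :: "nat \<Rightarrow> real" where
  "hermite_hadamard_const n = (LEAST c. hermite_hadamard_bound n c)"

end

theory Submission
  imports Defs
begin

text \<open>
  The claimed bound, of order \<open>n ^ (n + 1)\<close>, leaves room for an argument that loses factors
  like \<open>C ^ n * sqrt n ^ n\<close>: the proof shows
  \<open>c\<^sub>n \<le> 32 n\<^sup>2 8\<^sup>n (sqrt n) ^ (n - 1)\<close>, which is at most \<open>n ^ (n + 1)\<close> for \<open>n \<ge> 1024\<close>. For the finitely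
  many smaller \<open>n\<close> the sequence \<open>\<epsilon>\<close> absorbs whatever \<open>c\<^sub>n\<close> is.

  Choose the coordinate axis \<open>i\<close> for which the longest chord \<open>w\<close> of the domain \<open>\<Omega>\<close> in direction \<open>i\<close> is
  shortest. By convexity \<open>f\<close> at a point is at most the larger of its values at the two ends of
  the chord through that point. Therefore each superlevel set of \<open>f\<close> in \<open>\<Omega>\<close> lies in two prisms of
  height \<open>w\<close> over the corresponding superlevel set on the boundary, and a covering argument bounds
  the \<open>n\<close>-dimensional measure of a prism by a multiple of \<open>w\<close> times the \<open>(n - 1)\<close>-dimensional measure
  of its base (\<open>hausdorff_outer_prism\<close>). Summation over the levels (\<open>nn_integral_domain_le\<close>) gives
  \<open>\<integral>\<^sub>\<Omega> f \<le> const w \<integral>\<^sub>\<partial>\<^sub>\<Omega> f\<close>.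

  It remains to see that \<open>w |\<partial>\<Omega>| \<le> const |\<Omega>|\<close> (\<open>hausdorff_outer_bd_le\<close>). At every boundary point the closure
  avoids a wide cone around some signed axis (\<open>boundary_cone\<close>), so the part of the boundary
  belonging to one signed axis is a Lipschitz graph over the orthogonal hyperplane and a column of
  a fine grid contains at most \<open>2 n\<close> cells that meet it. The number of columns in direction \<open>j\<close> is
  bounded by volume (\<open>column_count\<close>): since \<open>\<Omega>\<close> has a chord of length at least \<open>w / 2\<close> in
  every direction \<open>j\<close>, convexity puts disjoint boxes of height comparable to \<open>w\<close> over shrunken copies
  of the columns into \<open>\<Omega>\<close>.

  The averages on both sides are invariant under rescaling of the Hausdorff measures, so a
  comparison of volume with \<open>n\<close>-dimensional Hausdorff measure up to a factor is enough
  (\<open>leb_le_hausdorff_outer\<close>). Measurability of Borel sets follows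
  from Caratheodory's criterion (\<open>sublevel_in_lambda_system\<close>). The boundary values of \<open>f\<close> are arbitrary at
  extreme points and may be non-measurable; the superlevel sets on the boundary are therefore
  formed with convex minorants of \<open>f\<close> that depend on interior values only.

  Finally, the set of admissible constants is bounded below by 1 and closed, so that its least element
  exists (\<open>hermite_hadamard_const_le\<close>).
\<close>

section \<open>Borel sets are Hausdorff measurable\<close>

context Metric_space
begin

lemma dist_le_ediam:
  assumes "x \<in> U" "y \<in> U"
  shows "ennreal (d x y) \<le> ediam U"
  unfolding ediam_def by (rule SUP_upper2[OF assms(1)], rule SUP_upper[OF assms(2)])

lemma ediam_le:
  assumes "\<And>x y. x \<in> U \<Longrightarrow> y \<in> U \<Longrightarrow> d x y \<le> r"
  shows "ediam U \<le> ennreal r"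
  unfolding ediam_def by (intro SUP_least ennreal_leI assms)

lemma hausdorff_content_antimono:
  assumes "\<delta> \<le> \<delta>'"
  shows "hausdorff_content k \<delta>' A \<le> hausdorff_content k \<delta> A"
  unfolding hausdorff_content_def
  by (rule INF_superset_mono) (auto intro: order_trans ennreal_leI[OF assms])

lemma hausdorff_content_le_outer:
  assumes "\<delta> > 0"
  shows "hausdorff_content k \<delta> A \<le> hausdorff_outer k A"
  unfolding hausdorff_outer_def using assms by (intro SUP_upper) auto

lemma hausdorff_outer_mono: "A \<subseteq> B \<Longrightarrow> hausdorff_outer k A \<le> hausdorff_outer k B"
  unfolding hausdorff_outer_def by (intro SUP_mono) (auto intro: hausdorff_content_mono)

lemma hausdorff_outer_UN:
  "hausdorff_outer k (\<Union>i. A i) \<le> (\<Sum>i::nat. hausdorff_outer k (A i))"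
  unfolding hausdorff_outer_def
  by (intro SUP_least order_trans[OF hausdorff_content_UN] suminf_le SUP_upper) auto

lemma hausdorff_outer_empty [simp]: "hausdorff_outer k {} = 0"
  by (simp add: hausdorff_outer_def hausdorff_content_empty)

lemma hausdorff_outer_Un:
  "hausdorff_outer k (A \<union> B) \<le> hausdorff_outer k A + hausdorff_outer k B"
proof -
  have "hausdorff_outer k (A \<union> B) \<le> (\<Sum>i. hausdorff_outer k (binaryset A B i))"
    using hausdorff_outer_UN[of k "binaryset A B"] by (simp add: UN_binaryset_eq)
  also have "\<dots> = hausdorff_outer k A + hausdorff_outer k B"
    by (rule suminf_binaryset_eq) simp
  finally show ?thesis .
qed

text \<open>A cover by sets of diameter below \<open>s\<close> splits into the sets that meet \<open>A\<close> and the others,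
  and only the latter can contain points of \<open>B\<close>.\<close>
lemma hausdorff_outer_separated:
  assumes "s > 0" and sep: "\<And>a b. a \<in> A \<Longrightarrow> b \<in> B \<Longrightarrow> s \<le> d a b"
  shows "hausdorff_outer k A + hausdorff_outer k B \<le> hausdorff_outer k (A \<union> B)"
proof -
  have split: "hausdorff_content k \<delta> A + hausdorff_content k \<delta> B \<le> hausdorff_content k \<delta> (A \<union> B)"
    if "\<delta> < s" "0 < \<delta>" for \<delta>
    unfolding hausdorff_content_def[of k \<delta> "A \<union> B"]
  proof (rule INF_greatest)
    fix U :: "nat \<Rightarrow> 'a set"
    assume "U \<in> {U. A \<union> B \<subseteq> (\<Union>i. U i) \<and> (\<forall>i. U i \<subseteq> M \<and> ediam (U i) \<le> ennreal \<delta>)}"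
    then have cov: "A \<union> B \<subseteq> (\<Union>i. U i)" and U: "\<And>i. U i \<subseteq> M" "\<And>i. ediam (U i) \<le> ennreal \<delta>"
      by auto
    define V where "V i = (if U i \<inter> A = {} then {} else U i)" for i
    define W where "W i = (if U i \<inter> A = {} then U i else {})" for i
    have ed0: "ediam {} \<le> ennreal \<delta>" by (simp add: ediam_def bot_ennreal)
    have "hausdorff_content k \<delta> A \<le> (\<Sum>i. hausdorff_weight k (V i))"
      unfolding hausdorff_content_def
    proof (intro INF_lower CollectI conjI allI subsetI)
      fix a assume a: "a \<in> A"
      then obtain i where "a \<in> U i" using cov by blast
      then show "a \<in> (\<Union>i. V i)" using a by (auto simp: V_def)
    qed (use U ed0 in \<open>auto simp: V_def split: if_splits\<close>)
    moreover have "hausdorff_content k \<delta> B \<le> (\<Sum>i. hausdorff_weight k (W i))"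
      unfolding hausdorff_content_def
    proof (intro INF_lower CollectI conjI allI subsetI)
      fix b assume b: "b \<in> B"
      then obtain i where i: "b \<in> U i" using cov by blast
      have "U i \<inter> A = {}"
      proof (rule ccontr)
        assume "U i \<inter> A \<noteq> {}"
        then obtain a where a: "a \<in> U i" "a \<in> A" by blast
        have "ennreal (d a b) \<le> ennreal \<delta>"
          using dist_le_ediam[OF a(1) i] U(2) order_trans by blast
        then have "d a b \<le> \<delta>" using \<open>0 < \<delta>\<close> by simp
        then show False using sep[OF a(2) b] \<open>\<delta> < s\<close> by simp
      qed
      then show "b \<in> (\<Union>i. W i)" using i by (auto simp: W_def)
    qed (use U ed0 in \<open>auto simp: W_def split: if_splits\<close>)
    moreover have "(\<Sum>i. hausdorff_weight k (V i)) + (\<Sum>i. hausdorff_weight k (W i))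
        = (\<Sum>i. hausdorff_weight k (U i))"
      by (subst suminf_add) (auto simp: V_def W_def hausdorff_weight_def intro!: suminf_cong)
    ultimately show "hausdorff_content k \<delta> A + hausdorff_content k \<delta> B
        \<le> (\<Sum>i. hausdorff_weight k (U i))"
      by (metis add_mono)
  qed
  have "hausdorff_content k \<delta>1 A + hausdorff_content k \<delta>2 B \<le> hausdorff_outer k (A \<union> B)"
    if "\<delta>1 > 0" "\<delta>2 > 0" for \<delta>1 \<delta>2
  proof -
    define \<delta> where "\<delta> = min (min \<delta>1 \<delta>2) (s / 2)"
    have \<delta>: "\<delta> \<le> \<delta>1" "\<delta> \<le> \<delta>2" "\<delta> < s" "0 < \<delta>" using that \<open>s > 0\<close> by (auto simp: \<delta>_def)
    show ?thesis
      using add_mono[OF hausdorff_content_antimono[OF \<delta>(1), of k A]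
          hausdorff_content_antimono[OF \<delta>(2), of k B]]
        split[OF \<delta>(3,4)] hausdorff_content_le_outer[OF \<delta>(4), of k "A \<union> B"]
      by (meson order_trans)
  qed
  then show ?thesis
    unfolding hausdorff_outer_def[of k A] hausdorff_outer_def[of k B]
    by (simp add: ennreal_SUP_add_left[symmetric]) (auto simp: ennreal_SUP_add_right intro!: SUP_least)
qed

text \<open>Caratheodory's criterion, for sublevel sets of Lipschitz functions. The layers
  \<open>R m\<close> of points with \<open>\<phi>\<close> barely above \<open>c\<close> are, taken every second one, separated from each
  other; so their measures are summable and those close to the level \<open>c\<close> are negligible.\<close>
lemma sublevel_in_lambda_system:
  assumes lip: "\<And>x y. x \<in> M \<Longrightarrow> y \<in> M \<Longrightarrow> \<bar>\<phi> x - \<phi> y\<bar> \<le> d x y"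
  shows "{x \<in> M. \<phi> x \<le> c} \<in> lambda_system M (Pow M) (hausdorff_outer k)"
proof -
  let ?H = "hausdorff_outer k"
  let ?A = "{x \<in> M. \<phi> x \<le> c}"
  have main: "?H (?A \<inter> T) + ?H ((M - ?A) \<inter> T) \<le> ?H T" if T: "T \<subseteq> M" for T
  proof (cases "?H T = top")
    case False
    then have fin: "?H T < top" by (simp add: top.not_eq_extremum)
    define P where "P m = {x \<in> T. c + 1 / real (Suc m) \<le> \<phi> x}" for m
    define R where "R m = {x \<in> T. c + 1 / real (m + 2) \<le> \<phi> x \<and> \<phi> x < c + 1 / real (m + 1)}" for m
    have sumR: "(\<Sum>m<N. ?H (R (2 * m + b))) \<le> ?H (\<Union>m<N. R (2 * m + b))" for N b
    proof (induction N)
      case (Suc N)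
      have "?H (\<Union>m<N. R (2 * m + b)) + ?H (R (2 * N + b))
          \<le> ?H ((\<Union>m<N. R (2 * m + b)) \<union> R (2 * N + b))"
      proof (rule hausdorff_outer_separated)
        show "0 < 1 / real (2 * N + b + 1) - 1 / real (2 * N + b + 2)"
          using divide_strict_left_mono[of "real (2 * N + b + 1)" "real (2 * N + b + 2)" 1] by simp
        fix x y assume "x \<in> (\<Union>m<N. R (2 * m + b))" and y: "y \<in> R (2 * N + b)"
        then obtain m where m: "m < N" "x \<in> R (2 * m + b)" by blast
        have "\<phi> y < c + 1 / real (2 * N + b + 1)" "c + 1 / real (2 * m + b + 2) \<le> \<phi> x"
          using m y by (auto simp: R_def)
        moreover have "1 / real (2 * N + b) \<le> 1 / real (2 * m + b + 2)"
          using m(1) by (intro divide_left_mono) auto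
        moreover have "1 / real (2 * N + b + 1) - 1 / real (2 * N + b + 2)
            \<le> 1 / real (2 * N + b) - 1 / real (2 * N + b + 1)"
          using m(1) by (simp add: divide_simps)
        moreover have "\<phi> x - \<phi> y \<le> d x y"
        proof -
          have "x \<in> M" "y \<in> M" using m y T by (auto simp: R_def)
          then show ?thesis using lip[of x y] by linarith
        qed
        ultimately show "1 / real (2 * N + b + 1) - 1 / real (2 * N + b + 2) \<le> d x y"
          by linarith
      qed
      moreover have "(\<Union>m<N. R (2 * m + b)) \<union> R (2 * N + b) = (\<Union>m<Suc N. R (2 * m + b))"
        by (auto simp: lessThan_Suc)
      ultimately have "?H (\<Union>m<N. R (2 * m + b)) + ?H (R (2 * N + b))
          \<le> ?H (\<Union>m<Suc N. R (2 * m + b))" by simp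
      then have "(\<Sum>m<N. ?H (R (2 * m + b))) + ?H (R (2 * N + b))
          \<le> ?H (\<Union>m<Suc N. R (2 * m + b))"
        by (rule order_trans[OF add_right_mono[OF Suc]])
      then show ?case by (simp only: sum.lessThan_Suc)
    qed simp
    have RT: "?H (\<Union>m<N. R (2 * m + b)) \<le> ?H T" for N b
      by (rule hausdorff_outer_mono) (auto simp: R_def)
    have "(\<Sum>m<N. ?H (R m)) \<le> ?H T + ?H T" for N
    proof -
      have "(\<Sum>m<N. ?H (R m)) \<le> (\<Sum>m<2 * N. ?H (R m))"
        by (intro sum_mono2) auto
      also have "\<dots> = (\<Sum>m<N. ?H (R (2 * m + 0))) + (\<Sum>m<N. ?H (R (2 * m + 1)))"
        by (induction N) (simp_all add: ac_simps)
      also have "\<dots> \<le> ?H T + ?H T"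
        by (intro add_mono order_trans[OF sumR RT])
      finally show ?thesis .
    qed
    then have "(\<Sum>m. ?H (R m)) \<le> ?H T + ?H T" by (intro suminf_le_const) auto
    also have "\<dots> < top" using fin by (simp add: ennreal_add_eq_top less_top)
    finally have sfin: "(\<Sum>m. ?H (R m)) < top" .
    define r where "r m = enn2real (?H (R m))" for m
    have r: "?H (R m) = ennreal (r m)" "r m \<ge> 0" for m
      using ennreal_suminf_lessD[OF sfin, of m] by (auto simp: r_def)
    have sumr: "summable r"
      using sfin r by (intro summable_suminf_not_top) (auto simp: less_top)
    show ?thesis
    proof (rule ennreal_le_epsilon)
      fix e :: real assume "0 < e"
      then obtain N where N: "norm (\<Sum>i. r (i + N)) < e"
        using suminf_exist_split[OF _ sumr] by blast
      have "(M - ?A) \<inter> T \<subseteq> P N \<union> (\<Union>i. R (i + N))"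
      proof
        fix x assume x: "x \<in> (M - ?A) \<inter> T"
        show "x \<in> P N \<union> (\<Union>i. R (i + N))"
        proof (cases "x \<in> P N")
          case False
          have pos: "\<phi> x - c > 0" using x T by auto
          define m where "m = (LEAST m. 1 / real (Suc m) \<le> \<phi> x - c)"
          have ex: "\<exists>m. 1 / real (Suc m) \<le> \<phi> x - c"
            using nat_approx_posE[OF pos] by (metis less_imp_le)
          have m1: "1 / real (Suc m) \<le> \<phi> x - c" unfolding m_def by (rule LeastI_ex[OF ex])
          have lt: "\<phi> x - c < 1 / real (Suc N)" using False x by (auto simp: P_def)
          have "N < m"
          proof (rule ccontr)
            assume "\<not> N < m"
            then have "1 / real (Suc N) \<le> 1 / real (Suc m)" by (simp add: frac_le)
            then show False using m1 lt by simp
          qed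
          then obtain l where l: "m = Suc (l + N)" by (metis add.commute less_imp_Suc_add)
          have "\<not> 1 / real (Suc (l + N)) \<le> \<phi> x - c"
            using not_less_Least[of "l + N" "\<lambda>m. 1 / real (Suc m) \<le> \<phi> x - c"] l m_def by simp
          then have "x \<in> R (l + N)"
            using m1 x l by (auto simp: R_def algebra_simps)
          then show ?thesis by blast
        qed simp
      qed
      then have "?H ((M - ?A) \<inter> T) \<le> ?H (P N) + ?H (\<Union>i. R (i + N))"
        by (rule order_trans[OF hausdorff_outer_mono hausdorff_outer_Un])
      also have "?H (\<Union>i. R (i + N)) \<le> (\<Sum>i. ennreal (r (i + N)))"
        using hausdorff_outer_UN[of k "\<lambda>i. R (i + N)"] by (simp add: r)
      also have "\<dots> = ennreal (\<Sum>i. r (i + N))"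
        using r sumr by (intro suminf_ennreal2) (auto simp: summable_iff_shift)
      also have "\<dots> \<le> ennreal e" using N by (intro ennreal_leI) auto
      finally have 1: "?H ((M - ?A) \<inter> T) \<le> ?H (P N) + ennreal e"
        by (simp add: add_left_mono)
      have "?H (?A \<inter> T) + ?H (P N) \<le> ?H ((?A \<inter> T) \<union> P N)"
      proof (rule hausdorff_outer_separated)
        show "0 < 1 / real (Suc N)" by simp
        fix a b assume ab: "a \<in> ?A \<inter> T" "b \<in> P N"
        then have "a \<in> M" "b \<in> M" using T by (auto simp: P_def)
        then have "\<phi> b - \<phi> a \<le> d a b" using lip[of a b] by linarith
        then show "1 / real (Suc N) \<le> d a b" using ab by (auto simp: P_def)
      qed
      also have "\<dots> \<le> ?H T" by (rule hausdorff_outer_mono) (auto simp: P_def)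
      finally have "?H (?A \<inter> T) + ?H (P N) \<le> ?H T" .
      then have 2: "?H (?A \<inter> T) + ?H (P N) + ennreal e \<le> ?H T + ennreal e"
        by (rule add_right_mono)
      have "?H (?A \<inter> T) + ?H ((M - ?A) \<inter> T) \<le> ?H (?A \<inter> T) + (?H (P N) + ennreal e)"
        by (rule add_left_mono[OF 1])
      then show "?H (?A \<inter> T) + ?H ((M - ?A) \<inter> T) \<le> ?H T + ennreal e"
        using 2 by (simp only: add.assoc order_trans)
    qed
  qed simp
  have "?H (?A \<inter> T) + ?H ((M - ?A) \<inter> T) = ?H T" if T: "T \<subseteq> M" for T
  proof (rule antisym[OF main[OF T]])
    have "T = (?A \<inter> T) \<union> ((M - ?A) \<inter> T)" using T by auto
    then show "?H T \<le> ?H (?A \<inter> T) + ?H ((M - ?A) \<inter> T)"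
      using hausdorff_outer_Un[of k "?A \<inter> T" "(M - ?A) \<inter> T"] by simp
  qed
  then show ?thesis unfolding lambda_system_def by auto
qed

end

abbreviation Rn :: "nat \<Rightarrow> (nat \<Rightarrow> real) set" where
  "Rn n \<equiv> topspace (Euclidean_space n)"

lemma mem_Rn: "x \<in> Rn n \<longleftrightarrow> (\<forall>i\<ge>n. x i = 0)"
  by (simp add: topspace_Euclidean_space)

lemma abs_coord_le_euclid_dist:
  assumes "i < n"
  shows "\<bar>x i - y i\<bar> \<le> euclid_dist n x y"
  using member_le_L2_set[of "{..<n}" i "\<lambda>i. \<bar>x i - y i\<bar>"] assms
  by (simp add: euclid_dist_def L2_set_def)

lemma borel_sets_hausdorff_measure:
  assumes "A \<in> sets (borel :: (nat \<Rightarrow> real) measure)" "A \<subseteq> Rn n"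
  shows "A \<in> sets (euclid.hausdorff_measure n k)"
proof -
  let ?H = "euclid.hausdorff_measure n k"
  have "(\<lambda>x. x i) \<in> borel_measurable ?H" for i
    unfolding borel_measurable_iff_le
  proof
    fix c :: real
    show "{x \<in> space ?H. x i \<le> c} \<in> sets ?H"
      unfolding euclid.space_hausdorff_measure euclid.sets_hausdorff_measure
    proof (rule euclid.sublevel_in_lambda_system)
      fix x y assume "x \<in> Rn n" "y \<in> Rn n"
      then show "\<bar>x i - y i\<bar> \<le> euclid_dist n x y"
        by (cases "i < n") (auto intro: abs_coord_le_euclid_dist simp: mem_Rn)
    qed
  qed
  then have "(\<lambda>x. x) \<in> measurable ?H (borel :: (nat \<Rightarrow> real) measure)"
    by (intro measurable_coordinatewise_then_product)
  from measurable_sets[OF this assms(1)] show ?thesis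
    using assms(2) by (simp add: Int_absorb2)
qed

section \<open>Open and closed sets, tested with cubes\<close>

lemma openin_Rn_mball:
  "openin (Euclidean_space n) S \<longleftrightarrow>
     S \<subseteq> Rn n \<and> (\<forall>x. x \<in> S \<longrightarrow> (\<exists>r>0. euclid.mball n x r \<subseteq> S))"
  using euclid.openin_mtopology[of n S] by (simp only: mtopology_euclid)

lemma openin_Rn_iff:
  "openin (Euclidean_space n) S \<longleftrightarrow>
     S \<subseteq> Rn n \<and> (\<forall>x\<in>S. \<exists>r>0. \<forall>y\<in>Rn n. (\<forall>i<n. \<bar>y i - x i\<bar> < r) \<longrightarrow> y \<in> S)" (is "_ \<longleftrightarrow> ?R")
proof
  assume "openin (Euclidean_space n) S"
  then have S: "S \<subseteq> Rn n" "\<And>x. x \<in> S \<Longrightarrow> \<exists>r>0. euclid.mball n x r \<subseteq> S"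
    unfolding openin_Rn_mball by auto
  show ?R
  proof (intro conjI ballI S(1))
    fix x assume "x \<in> S"
    then obtain r where r: "r > 0" "euclid.mball n x r \<subseteq> S" using S by blast
    have "y \<in> S" if y: "y \<in> Rn n" "\<forall>i<n. \<bar>y i - x i\<bar> < r / (real n + 1)" for y
    proof -
      have "euclid_dist n x y \<le> (\<Sum>i<n. \<bar>x i - y i\<bar>)"
        unfolding euclid_dist_def by (rule L2_set_le_sum_abs)
      also have "\<dots> \<le> (\<Sum>i<n. r / (real n + 1))"
      proof (rule sum_mono)
        fix i assume "i \<in> {..<n}"
        then have "\<bar>y i - x i\<bar> < r / (real n + 1)" using y(2) by blast
        then show "\<bar>x i - y i\<bar> \<le> r / (real n + 1)" by linarith
      qed
      also have "\<dots> < r" using r by (simp add: field_simps)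
      finally have "y \<in> euclid.mball n x r"
        using y(1) S(1) \<open>x \<in> S\<close> unfolding euclid.in_mball by blast
      then show ?thesis using r(2) by blast
    qed
    then show "\<exists>r>0. \<forall>y\<in>Rn n. (\<forall>i<n. \<bar>y i - x i\<bar> < r) \<longrightarrow> y \<in> S"
      using r by (intro exI[of _ "r / (real n + 1)"]) auto
  qed
next
  assume R: ?R
  show "openin (Euclidean_space n) S"
    unfolding openin_Rn_mball
  proof (intro conjI allI impI)
    fix x assume x: "x \<in> S"
    then obtain r where r: "r > 0" "\<And>y. y \<in> Rn n \<Longrightarrow> (\<forall>i<n. \<bar>y i - x i\<bar> < r) \<Longrightarrow> y \<in> S"
      using R by blast
    have "euclid.mball n x r \<subseteq> S"
    proof
      fix y assume "y \<in> euclid.mball n x r"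
      then have y: "y \<in> Rn n" "euclid_dist n x y < r" unfolding euclid.in_mball by auto
      show "y \<in> S"
      proof (intro r(2) allI impI y(1))
        fix i assume "i < n"
        then show "\<bar>y i - x i\<bar> < r"
          using abs_coord_le_euclid_dist[of i n x y] y(2) by linarith
      qed
    qed
    then show "\<exists>r>0. euclid.mball n x r \<subseteq> S" using r by blast
  qed (use R in auto)
qed

lemma openin_Rn_cube:
  assumes "openin (Euclidean_space n) S" "x \<in> S"
  obtains r where "r > 0" "\<And>y. y \<in> Rn n \<Longrightarrow> \<forall>i<n. \<bar>y i - x i\<bar> < r \<Longrightarrow> y \<in> S"
proof -
  have "\<exists>r>0. \<forall>y\<in>Rn n. (\<forall>i<n. \<bar>y i - x i\<bar> < r) \<longrightarrow> y \<in> S"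
    using assms unfolding openin_Rn_iff by blast
  then obtain r where "r > 0" "\<forall>y\<in>Rn n. (\<forall>i<n. \<bar>y i - x i\<bar> < r) \<longrightarrow> y \<in> S"
    by blast
  then show thesis by (intro that[of r]) simp_all
qed

lemma openin_Rn_cubes:
  assumes "r > 0" "x \<in> Rn n"
  shows "openin (Euclidean_space n) {y \<in> Rn n. \<forall>i<n. \<bar>y i - x i\<bar> < r}"
  unfolding openin_Rn_iff
proof (intro conjI ballI)
  fix y assume y: "y \<in> {y \<in> Rn n. \<forall>i<n. \<bar>y i - x i\<bar> < r}"
  define s where "s = Min (insert 1 ((\<lambda>i. r - \<bar>y i - x i\<bar>) ` {..<n}))"
  have s: "s > 0" "\<And>i. i < n \<Longrightarrow> s \<le> r - \<bar>y i - x i\<bar>"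
    using y by (auto simp: s_def)
  have "w \<in> {y \<in> Rn n. \<forall>i<n. \<bar>y i - x i\<bar> < r}"
    if w: "w \<in> Rn n" "\<forall>i<n. \<bar>w i - y i\<bar> < s" for w
  proof (intro CollectI conjI allI impI w(1))
    fix i assume "i < n"
    then show "\<bar>w i - x i\<bar> < r" using s(2)[of i] w(2) by (smt (verit))
  qed
  then show "\<exists>s>0. \<forall>w\<in>Rn n. (\<forall>i<n. \<bar>w i - y i\<bar> < s) \<longrightarrow> w \<in> {y \<in> Rn n. \<forall>i<n. \<bar>y i - x i\<bar> < r}"
    using s(1) by blast
qed auto

lemma closure_of_Rn_cube:
  assumes "x \<in> Euclidean_space n closure_of S" "r > 0"
  obtains y where "y \<in> S" "\<And>i. i < n \<Longrightarrow> \<bar>y i - x i\<bar> < r"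
proof -
  have x: "x \<in> Rn n" and
    cl: "\<And>T. x \<in> T \<Longrightarrow> openin (Euclidean_space n) T \<Longrightarrow> \<exists>y. y \<in> S \<and> y \<in> T"
    using assms(1) unfolding in_closure_of by simp_all
  have "x \<in> {y \<in> Rn n. \<forall>i<n. \<bar>y i - x i\<bar> < r}" using x assms(2) by simp
  from cl[OF this openin_Rn_cubes[OF assms(2) x]] obtain y
    where "y \<in> S" "y \<in> {y \<in> Rn n. \<forall>i<n. \<bar>y i - x i\<bar> < r}" by blast
  then show thesis by (intro that[of y]) simp_all
qed

lemma in_closure_of_Rn:
  assumes "x \<in> Rn n" "\<And>r. r > 0 \<Longrightarrow> \<exists>y\<in>S. \<forall>i<n. \<bar>y i - x i\<bar> < r" "S \<subseteq> Rn n"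
  shows "x \<in> Euclidean_space n closure_of S"
  unfolding in_closure_of
proof (intro conjI allI impI assms(1))
  fix T assume T: "x \<in> T \<and> openin (Euclidean_space n) T"
  then have "\<exists>r>0. \<forall>y\<in>Rn n. (\<forall>i<n. \<bar>y i - x i\<bar> < r) \<longrightarrow> y \<in> T"
    unfolding openin_Rn_iff by blast
  then obtain r where r: "r > 0" "\<forall>y\<in>Rn n. (\<forall>i<n. \<bar>y i - x i\<bar> < r) \<longrightarrow> y \<in> T"
    by blast
  obtain y where "y \<in> S" "\<forall>i<n. \<bar>y i - x i\<bar> < r" using assms(2)[OF r(1)] by blast
  then show "\<exists>y. y \<in> S \<and> y \<in> T" using r(2) assms(3) by (intro exI[of _ y]) auto
qed

lemma borel_closedin_Rn: "closedin (Euclidean_space n) S \<Longrightarrow> S \<in> sets borel"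
  by (simp add: closedin_Euclidean_space_iff)

lemma borel_Rn: "Rn n \<in> sets borel"
  by (rule borel_closedin_Rn[of n]) simp

lemma borel_openin_Rn:
  assumes "openin (Euclidean_space n) S"
  shows "S \<in> sets borel"
proof -
  have "S = Rn n - (Rn n - S)" using openin_subset[OF assms] by auto
  moreover have "Rn n - S \<in> sets borel"
    using assms by (intro borel_closedin_Rn[of n]) blast
  ultimately show ?thesis by (metis borel_Rn sets.Diff)
qed

section \<open>Convex domains\<close>

lemma convex_setD:
  "\<lbrakk>convex_set S; x \<in> S; y \<in> S; 0 \<le> t; t \<le> 1\<rbrakk> \<Longrightarrow> convex_comb t x y \<in> S"
  by (auto simp: convex_set_def)

lemma convex_comb_Rn: "x \<in> Rn n \<Longrightarrow> y \<in> Rn n \<Longrightarrow> convex_comb t x y \<in> Rn n"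
  by (auto simp: mem_Rn convex_comb_def)

lemma fun_upd_Rn: "x \<in> Rn n \<Longrightarrow> j < n \<Longrightarrow> x(j := a) \<in> Rn n"
  by (auto simp: mem_Rn)

lemma convex_comb_fun_upd:
  "convex_comb t (x(j := a)) (x(j := b)) = x(j := (1 - t) * a + t * b)"
  by (auto simp: convex_comb_def fun_eq_iff algebra_simps)

locale convex_domain =
  fixes n :: nat and \<Omega> :: "(nat \<Rightarrow> real) set"
  assumes domain: "bounded_convex_domain n \<Omega>"
begin

abbreviation "cl \<equiv> Euclidean_space n closure_of \<Omega>"
abbreviation "bd \<equiv> Euclidean_space n frontier_of \<Omega>"

lemma nonempty: "\<Omega> \<noteq> {}" and open_domain: "openin (Euclidean_space n) \<Omega>"
  and domain_convex: "convex_set \<Omega>"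
  using domain by (auto simp: bounded_convex_domain_def)

lemma domain_Rn: "\<Omega> \<subseteq> Rn n" using openin_subset[OF open_domain] .
lemma cl_Rn: "cl \<subseteq> Rn n" by (rule closure_of_subset_topspace)
lemma domain_cl: "\<Omega> \<subseteq> cl" by (rule closure_of_subset[OF domain_Rn])
lemma bd_eq: "bd = cl - \<Omega>" using interior_of_openin[OF open_domain] by (simp add: frontier_of_def)
lemma bd_Rn: "bd \<subseteq> Rn n" using cl_Rn bd_eq by auto

lemma bounded:
  obtains B where "B > 0" "\<forall>x\<in>cl. \<forall>i. \<bar>x i\<bar> \<le> B"
proof -
  have "euclid.mbounded n cl"
    using domain euclid.mbounded_closure_of[of n \<Omega>]
    by (simp add: bounded_convex_domain_def mtopology_euclid)
  then obtain c R where R: "cl \<subseteq> euclid.mcball n c R" "R > 0"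
    unfolding euclid.mbounded_pos by blast
  define B where "B = R + (\<Sum>i<n. \<bar>c i\<bar>)"
  show thesis
  proof (rule that)
    show "B > 0" using R by (auto simp: B_def intro!: add_pos_nonneg sum_nonneg)
    have "\<bar>x i\<bar> \<le> B" if x: "x \<in> cl" for x i
    proof (cases "i < n")
      case True
      have "\<bar>c i - x i\<bar> \<le> R"
        using abs_coord_le_euclid_dist[OF True, of c x] x R by auto
      moreover have "\<bar>c i\<bar> \<le> (\<Sum>i<n. \<bar>c i\<bar>)" using True by (intro member_le_sum) auto
      ultimately show ?thesis by (simp add: B_def)
    next
      case False
      then show ?thesis using x cl_Rn \<open>B > 0\<close> by (auto simp: mem_Rn subset_iff)
    qed
    then show "\<forall>x\<in>cl. \<forall>i. \<bar>x i\<bar> \<le> B" by blast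
  qed
qed

text \<open>Writing \<open>x\<close> near \<open>p\<close> for a point of the domain, the combination equals one of \<open>x\<close> with
  a point that differs from \<open>z\<close> by a multiple of \<open>p - x\<close>.\<close>
lemma convex_comb_domain_cl:
  assumes z: "z \<in> \<Omega>" and p: "p \<in> cl" and t: "0 \<le> t" "t < 1"
  shows "convex_comb t z p \<in> \<Omega>"
proof -
  obtain r where r: "r > 0" "\<And>y. y \<in> Rn n \<Longrightarrow> \<forall>i<n. \<bar>y i - z i\<bar> < r \<Longrightarrow> y \<in> \<Omega>"
    using openin_Rn_cube[OF open_domain z] by blast
  define s where "s = t / (1 - t)"
  have s: "s \<ge> 0" using t by (simp add: s_def)
  obtain x where x: "x \<in> \<Omega>" "\<And>i. i < n \<Longrightarrow> \<bar>x i - p i\<bar> < r / (s + 1)"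
    using closure_of_Rn_cube[OF p, of "r / (s + 1)"] r s by auto
  define y where "y i = z i + s * (p i - x i)" for i
  have "z \<in> Rn n" "p \<in> Rn n" "x \<in> Rn n" using z x p domain_Rn cl_Rn by auto
  then have yR: "y \<in> Rn n" by (auto simp: mem_Rn y_def)
  have "y \<in> \<Omega>"
  proof (intro r(2) yR allI impI)
    fix i assume i: "i < n"
    have "\<bar>y i - z i\<bar> = s * \<bar>x i - p i\<bar>" using s by (simp add: y_def abs_mult abs_minus_commute)
    also have "\<dots> \<le> s * (r / (s + 1))" using x(2)[OF i] s by (intro mult_left_mono) auto
    also have "\<dots> < r" using r s by (simp add: field_simps)
    finally show "\<bar>y i - z i\<bar> < r" .
  qed
  then have "convex_comb t y x \<in> \<Omega>" using convex_setD[OF domain_convex _ x(1)] t by auto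
  moreover have "convex_comb t y x = convex_comb t z p"
    using t by (auto simp: convex_comb_def y_def s_def fun_eq_iff field_simps)
  ultimately show ?thesis by simp
qed

lemma interior_cube:
  obtains z r where "z \<in> \<Omega>" "r > 0"
    "\<forall>y\<in>Rn n. (\<forall>i<n. \<bar>y i - z i\<bar> < r) \<longrightarrow> y \<in> \<Omega>"
  using nonempty open_domain unfolding openin_Rn_iff by blast

text \<open>Leaving the domain along a coordinate line: the first exit parameter is a supremum.\<close>
lemma exit_point:
  assumes x: "x \<in> \<Omega>" and j: "j < n" and \<sigma>: "\<sigma> \<in> {1, -1}"
  obtains s where "s > 0" "x(j := x j + \<sigma> * s) \<in> bd"
    "\<And>t. 0 \<le> t \<Longrightarrow> t < s \<Longrightarrow> x(j := x j + \<sigma> * t) \<in> \<Omega>"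
proof -
  define T where "T = {t. t \<ge> 0 \<and> x(j := x j + \<sigma> * t) \<in> \<Omega>}"
  obtain B where B: "B > 0" "\<forall>x\<in>cl. \<forall>i. \<bar>x i\<bar> \<le> B" by (rule bounded)
  have bdd: "bdd_above T"
  proof (rule bdd_aboveI)
    fix t assume t: "t \<in> T"
    then have "x(j := x j + \<sigma> * t) \<in> cl" "x \<in> cl"
      using domain_cl x unfolding T_def by blast+
    then have "\<bar>x j + \<sigma> * t\<bar> \<le> B" "\<bar>x j\<bar> \<le> B"
      using bspec[OF B(2), of "x(j := x j + \<sigma> * t)", THEN spec, of j]
        bspec[OF B(2), of x, THEN spec, of j] by simp_all
    then show "t \<le> 2 * B" using \<sigma> by auto
  qed
  have xR: "x \<in> Rn n" using x domain_Rn by auto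
  have 0: "0 \<in> T" using x by (simp add: T_def)
  define s where "s = Sup T"
  have le_s: "t \<le> s" if "t \<in> T" for t using cSup_upper[OF that bdd] by (simp add: s_def)
  have below: "x(j := x j + \<sigma> * t) \<in> \<Omega>" if t: "0 \<le> t" "t < s" for t
  proof -
    obtain t' where t': "t' \<in> T" "t < t'" 
      using less_cSupE[of t T] t(2) 0 unfolding s_def by blast
    have "convex_comb (t / t') (x(j := x j)) (x(j := x j + \<sigma> * t')) \<in> \<Omega>"
      using t' t x by (intro convex_setD[OF domain_convex]) (simp_all add: T_def)
    then show ?thesis
    proof -
      have "(1 - t / t') * x j + t / t' * (x j + \<sigma> * t') = x j + \<sigma> * t"
      proof -
        have "t' \<noteq> 0" using t t' by linarith
        then show ?thesis by (simp add: algebra_simps)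
      qed
      then show ?thesis using \<open>convex_comb _ _ _ \<in> \<Omega>\<close> by (simp only: convex_comb_fun_upd)
    qed
  qed
  have open_step: "\<exists>e>0. t + e \<in> T" if t: "t \<in> T" for t
  proof -
    have in\<Omega>: "x(j := x j + \<sigma> * t) \<in> \<Omega>" using t by (simp add: T_def)
    obtain r where r: "r > 0"
      "\<And>y. y \<in> Rn n \<Longrightarrow> \<forall>i<n. \<bar>y i - (x(j := x j + \<sigma> * t)) i\<bar> < r \<Longrightarrow> y \<in> \<Omega>"
      using openin_Rn_cube[OF open_domain in\<Omega>] by blast
    have "\<sigma> * (t + r / 2) - \<sigma> * t = \<sigma> * (r / 2)" by (simp add: algebra_simps)
    then have "\<bar>\<sigma> * (t + r / 2) - \<sigma> * t\<bar> < r" using r(1) \<sigma> by auto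
    then have "x(j := x j + \<sigma> * (t + r / 2)) \<in> \<Omega>"
      using r(1) by (intro r(2) fun_upd_Rn xR j) simp
    then show ?thesis using r(1) t by (intro exI[of _ "r / 2"]) (simp add: T_def)
  qed
  have s0: "s > 0"
  proof -
    obtain e where "e > 0" "0 + e \<in> T" using open_step[OF 0] by blast
    then show ?thesis using le_s[of "0 + e"] by simp
  qed
  have "x(j := x j + \<sigma> * s) \<notin> \<Omega>"
  proof
    assume "x(j := x j + \<sigma> * s) \<in> \<Omega>"
    then have "s \<in> T" using s0 by (simp add: T_def)
    then obtain e where "e > 0" "s + e \<in> T" using open_step by blast
    then show False using le_s[of "s + e"] by simp
  qed
  moreover have "x(j := x j + \<sigma> * s) \<in> cl"
  proof (rule in_closure_of_Rn[OF fun_upd_Rn[OF xR j] _ domain_Rn])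
    fix r :: real assume "r > 0"
    define t where "t = max 0 (s - r / 2)"
    have t: "0 \<le> t" "t < s" "\<bar>t - s\<bar> < r" using s0 \<open>r > 0\<close> by (auto simp: t_def)
    show "\<exists>y\<in>\<Omega>. \<forall>i<n. \<bar>y i - (x(j := x j + \<sigma> * s)) i\<bar> < r"
      using below[OF t(1,2)] t(3) \<sigma> \<open>r > 0\<close>
      by (intro bexI[of _ "x(j := x j + \<sigma> * t)"]) auto
  qed
  ultimately have "x(j := x j + \<sigma> * s) \<in> bd" unfolding bd_eq by blast
  then show thesis using below by (intro that[OF s0])
qed

lemma convex_cl: "convex_set cl"
  unfolding convex_set_def
proof (intro ballI)
  fix x y t assume x: "x \<in> cl" and y: "y \<in> cl" and t: "t \<in> {0..1::real}"
  show "convex_comb t x y \<in> cl"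
  proof (rule in_closure_of_Rn[OF _ _ domain_Rn])
    show "convex_comb t x y \<in> Rn n" using x y cl_Rn by (intro convex_comb_Rn) auto
    fix r :: real assume r: "r > 0"
    obtain x' where x': "x' \<in> \<Omega>" "\<And>i. i < n \<Longrightarrow> \<bar>x' i - x i\<bar> < r"
      using closure_of_Rn_cube[OF x r] by metis
    obtain y' where y': "y' \<in> \<Omega>" "\<And>i. i < n \<Longrightarrow> \<bar>y' i - y i\<bar> < r"
      using closure_of_Rn_cube[OF y r] by metis
    have "\<bar>convex_comb t x' y' i - convex_comb t x y i\<bar> < r" if i: "i < n" for i
    proof -
      have "convex_comb t x' y' i - convex_comb t x y i = (1 - t) * (x' i - x i) + t * (y' i - y i)"
        by (simp add: convex_comb_def algebra_simps)
      also have "\<bar>\<dots>\<bar> \<le> (1 - t) * \<bar>x' i - x i\<bar> + t * \<bar>y' i - y i\<bar>"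
        using t by (intro order_trans[OF abs_triangle_ineq]) (simp add: abs_mult)
      also have "\<dots> < r"
        using x'(2)[OF i] y'(2)[OF i] t by (intro convex_bound_lt) auto
      finally show ?thesis .
    qed
    moreover have "convex_comb t x' y' \<in> \<Omega>"
      using x' y' t by (intro convex_setD[OF domain_convex]) auto
    ultimately show "\<exists>w\<in>\<Omega>. \<forall>i<n. \<bar>w i - convex_comb t x y i\<bar> < r" by blast
  qed
qed

text \<open>A substitute for supporting hyperplanes: near \<open>p\<close> the closure avoids one of the \<open>2n\<close>
  convex cones around the signed coordinate axes. Otherwise the tangent cone at \<open>p\<close> contains,
  for each signed axis, a vector that is \<open>\<ell>\<^sub>1\<close>-close to the unit vector of that axis; combining
  these approximates every vector with relative error \<open>1/2\<close>, and iterating this the tangent cone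
  comes arbitrarily close to \<open>p - z\<close> for \<open>z\<close> in the domain. Then \<open>p\<close> lies between a point of the
  closure and a point near \<open>z\<close>, so it is an interior point.\<close>
lemma boundary_cone:
  assumes p: "p \<in> bd"
  obtains j \<sigma> where "j < n" "\<sigma> \<in> {1, -1}"
    "\<forall>q\<in>cl. \<sigma> * (q j - p j) \<le> 2 * (\<Sum>i\<in>{..<n} - {j}. \<bar>q i - p i\<bar>)"
proof (rule ccontr)
  note found = that
  assume "\<not> thesis"
  have ex: "\<exists>q\<in>cl. \<sigma> * (q j - p j) > 2 * (\<Sum>i\<in>{..<n} - {j}. \<bar>q i - p i\<bar>)"
    if j: "j < n" "\<sigma> \<in> {1, -1}" for j \<sigma>
  proof (rule ccontr)
    assume "\<not> ?thesis"
    then have "\<forall>q\<in>cl. \<sigma> * (q j - p j) \<le> 2 * (\<Sum>i\<in>{..<n} - {j}. \<bar>q i - p i\<bar>)"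
      unfolding bex_simps not_less .
    from found[OF j this] \<open>\<not> thesis\<close> show False by simp
  qed
  have pcl: "p \<in> cl" and p\<Omega>: "p \<notin> \<Omega>" using p by (auto simp: bd_eq)
  define T where "T v \<longleftrightarrow> (\<exists>e>0. (\<lambda>i. p i + e * v i) \<in> cl)" for v :: "nat \<Rightarrow> real"
  have T_shrink: "(\<lambda>i. p i + e' * v i) \<in> cl"
    if "(\<lambda>i. p i + e * v i) \<in> cl" "0 \<le> e'" "e' \<le> e" "0 < e" for v e e'
  proof -
    have "convex_comb (e' / e) p (\<lambda>i. p i + e * v i) \<in> cl"
      using that by (intro convex_setD[OF convex_cl pcl]) simp_all
    moreover have "convex_comb (e' / e) p (\<lambda>i. p i + e * v i) = (\<lambda>i. p i + e' * v i)"
      using that by (simp add: convex_comb_def fun_eq_iff algebra_simps)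
    ultimately show ?thesis by simp
  qed
  have T_add: "T (\<lambda>i. v i + w i)" if vw: "T v" "T w" for v w
  proof -
    obtain e1 e2 where e: "e1 > 0" "(\<lambda>i. p i + e1 * v i) \<in> cl" "e2 > 0" "(\<lambda>i. p i + e2 * w i) \<in> cl"
      using vw by (auto simp: T_def)
    define e where "e = min e1 e2"
    have "(\<lambda>i. p i + e * v i) \<in> cl" "(\<lambda>i. p i + e * w i) \<in> cl"
      using T_shrink[OF e(2), of e] T_shrink[OF e(4), of e] e by (auto simp: e_def)
    then have "convex_comb (1/2) (\<lambda>i. p i + e * v i) (\<lambda>i. p i + e * w i) \<in> cl"
      by (intro convex_setD[OF convex_cl]) simp_all
    moreover have "convex_comb (1/2) (\<lambda>i. p i + e * v i) (\<lambda>i. p i + e * w i)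
        = (\<lambda>i. p i + (e / 2) * (v i + w i))"
      by (simp add: convex_comb_def fun_eq_iff algebra_simps)
    ultimately show ?thesis unfolding T_def using e by (intro exI[of _ "e / 2"]) (simp add: e_def)
  qed
  have T_scale: "T (\<lambda>i. c * v i)" if Tv: "T v" "c \<ge> 0" for c v
  proof (cases "c = 0")
    case True
    then show ?thesis using pcl by (auto simp: T_def intro: exI[of _ 1])
  next
    case False
    obtain e where "e > 0" "(\<lambda>i. p i + e * v i) \<in> cl" using Tv by (auto simp: T_def)
    then show ?thesis unfolding T_def using False Tv by (intro exI[of _ "e / c"]) simp
  qed
  have T_sum: "T (\<lambda>i. \<Sum>j<m. c j * u j i)" if "\<And>j. j < m \<Longrightarrow> T (u j)" "\<And>j. j < m \<Longrightarrow> c j \<ge> 0"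
    for m :: nat and c u
    using that
  proof (induction m)
    case 0
    then show ?case using pcl by (auto simp: T_def intro: exI[of _ 1])
  next
    case (Suc m)
    have "T (\<lambda>i. (\<Sum>j<m. c j * u j i) + c m * u m i)"
      using Suc by (intro T_add T_scale) auto
    then show ?case by simp
  qed
  have "\<exists>u. T u \<and> u j = \<sigma> \<and> (\<Sum>i\<in>{..<n} - {j}. \<bar>u i\<bar>) \<le> 1/2"
    if j: "j < n" "\<sigma> \<in> {1, -1}" for j \<sigma>
  proof -
    obtain q where q: "q \<in> cl" "\<sigma> * (q j - p j) > 2 * (\<Sum>i\<in>{..<n} - {j}. \<bar>q i - p i\<bar>)"
      using ex[OF j] by blast
    define a where "a = \<sigma> * (q j - p j)"
    have "(\<Sum>i\<in>{..<n} - {j}. \<bar>q i - p i\<bar>) \<ge> 0" by (intro sum_nonneg) simp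
    then have a: "a > 0" using q(2) unfolding a_def by linarith
    have "T (\<lambda>i. q i - p i)" using q(1) unfolding T_def by (intro exI[of _ 1]) simp
    from T_scale[OF this, of "1 / a"] have "T (\<lambda>i. (1 / a) * (q i - p i))" using a by simp
    moreover have "(1 / a) * (q j - p j) = \<sigma>" using a j(2) by (auto simp: a_def)
    moreover have "(\<Sum>i\<in>{..<n} - {j}. \<bar>(1 / a) * (q i - p i)\<bar>) \<le> 1/2"
    proof -
      have "(\<Sum>i\<in>{..<n} - {j}. \<bar>(1 / a) * (q i - p i)\<bar>) = (1 / a) * (\<Sum>i\<in>{..<n} - {j}. \<bar>q i - p i\<bar>)"
        using a by (simp add: abs_mult sum_distrib_left)
      also have "\<dots> \<le> (1 / a) * (a / 2)"
        using a q(2) by (intro mult_left_mono) (auto simp: a_def)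
      finally show ?thesis using a by simp
    qed
    ultimately show ?thesis by blast
  qed
  then obtain U where U: "\<And>j \<sigma>. j < n \<Longrightarrow> \<sigma> \<in> {1, -1} \<Longrightarrow> T (U j \<sigma>)"
    "\<And>j \<sigma>. j < n \<Longrightarrow> \<sigma> \<in> {1, -1} \<Longrightarrow> U j \<sigma> j = \<sigma>"
    "\<And>j \<sigma>. j < n \<Longrightarrow> \<sigma> \<in> {1, -1} \<Longrightarrow> (\<Sum>i\<in>{..<n} - {j}. \<bar>U j \<sigma> i\<bar>) \<le> 1/2"
    by metis
  have step: "\<exists>v. T v \<and> (\<Sum>i<n. \<bar>w i - v i\<bar>) \<le> 1/2 * (\<Sum>i<n. \<bar>w i\<bar>)" for w :: "nat \<Rightarrow> real"
  proof -
    define \<sigma> where "\<sigma> j = (if w j \<ge> 0 then 1 else -1 :: real)" for j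
    define u where "u j = U j (\<sigma> j)" for j
    have \<sigma>: "\<sigma> j \<in> {1, -1}" "\<bar>w j\<bar> * \<sigma> j = w j" for j by (auto simp: \<sigma>_def)
    have u: "T (u j)" "u j j = \<sigma> j" "(\<Sum>i\<in>{..<n} - {j}. \<bar>u j i\<bar>) \<le> 1/2" if "j < n" for j
      using U[OF that \<sigma>(1)] by (auto simp: u_def)
    define v where "v i = (\<Sum>j<n. \<bar>w j\<bar> * u j i)" for i
    have "T v" unfolding v_def by (rule T_sum) (use u in auto)
    have "\<bar>w i - v i\<bar> \<le> (\<Sum>j\<in>{..<n} - {i}. \<bar>w j\<bar> * \<bar>u j i\<bar>)" if i: "i < n" for i
    proof -
      have "v i = \<bar>w i\<bar> * u i i + (\<Sum>j\<in>{..<n} - {i}. \<bar>w j\<bar> * u j i)"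
        unfolding v_def using i by (subst sum.remove[of _ i]) auto
      then have "w i - v i = - (\<Sum>j\<in>{..<n} - {i}. \<bar>w j\<bar> * u j i)" using u(2)[OF i] \<sigma>(2) by simp
      then show ?thesis
        using sum_abs[of "\<lambda>j. \<bar>w j\<bar> * u j i" "{..<n} - {i}"] by (simp add: abs_mult)
    qed
    then have "(\<Sum>i<n. \<bar>w i - v i\<bar>) \<le> (\<Sum>i<n. \<Sum>j\<in>{..<n} - {i}. \<bar>w j\<bar> * \<bar>u j i\<bar>)"
      by (intro sum_mono) auto
    also have "\<dots> = (\<Sum>j<n. \<Sum>i\<in>{..<n} - {j}. \<bar>w j\<bar> * \<bar>u j i\<bar>)"
      by (subst sum.Sigma, simp, simp, subst sum.Sigma, simp, simp,
          rule sum.reindex_bij_witness[of _ "\<lambda>(a, b). (b, a)" "\<lambda>(a, b). (b, a)"]) auto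
    also have "\<dots> \<le> (\<Sum>j<n. \<bar>w j\<bar> * (1/2))"
      unfolding sum_distrib_left[symmetric] by (intro sum_mono mult_left_mono u) auto
    also have "\<dots> = 1/2 * (\<Sum>i<n. \<bar>w i\<bar>)" by (simp add: sum_divide_distrib)
    finally show ?thesis using \<open>T v\<close> by blast
  qed
  have iterate: "\<exists>v. T v \<and> (\<Sum>i<n. \<bar>w i - v i\<bar>) \<le> (1/2) ^ m * (\<Sum>i<n. \<bar>w i\<bar>)"
    for w :: "nat \<Rightarrow> real" and m
  proof (induction m)
    case 0
    show ?case using pcl by (intro exI[of _ "\<lambda>_. 0"]) (auto simp: T_def intro: exI[of _ 1])
  next
    case (Suc m)
    then obtain v where v: "T v" "(\<Sum>i<n. \<bar>w i - v i\<bar>) \<le> (1/2) ^ m * (\<Sum>i<n. \<bar>w i\<bar>)" by blast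
    obtain v' where v': "T v'" "(\<Sum>i<n. \<bar>w i - v i - v' i\<bar>) \<le> 1/2 * (\<Sum>i<n. \<bar>w i - v i\<bar>)"
      using step[of "\<lambda>i. w i - v i"] by blast
    show ?case
    proof (intro exI conjI)
      show "T (\<lambda>i. v i + v' i)" by (rule T_add[OF v(1) v'(1)])
      show "(\<Sum>i<n. \<bar>w i - (v i + v' i)\<bar>) \<le> (1/2) ^ Suc m * (\<Sum>i<n. \<bar>w i\<bar>)"
        using v(2) v'(2) by (simp add: algebra_simps)
    qed
  qed
  obtain z r where z: "z \<in> \<Omega>" "r > 0"
    "\<forall>y\<in>Rn n. (\<forall>i<n. \<bar>y i - z i\<bar> < r) \<longrightarrow> y \<in> \<Omega>"
    by (rule interior_cube)
  define N where "N = (\<Sum>i<n. \<bar>p i - z i\<bar>)"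
  have "N \<ge> 0" by (auto simp: N_def intro: sum_nonneg)
  obtain m where "(1/2::real) ^ m < r / (N + 1)"
    using real_arch_pow_inv[of "r / (N + 1)" "1/2"] z \<open>N \<ge> 0\<close> by auto
  then have "(1/2) ^ m * (N + 1) < r" using \<open>N \<ge> 0\<close> by (subst (asm) pos_less_divide_eq) auto
  moreover have "(1/2) ^ m * N \<le> (1/2) ^ m * (N + 1)" by (intro mult_left_mono) simp_all
  ultimately have m: "(1/2) ^ m * N < r" by linarith
  obtain v where v: "T v" "(\<Sum>i<n. \<bar>p i - z i - v i\<bar>) \<le> (1/2) ^ m * N"
    using iterate[of "\<lambda>i. p i - z i" m] unfolding N_def by blast
  obtain e where e: "e > 0" "(\<lambda>i. p i + e * v i) \<in> cl" using v(1) by (auto simp: T_def)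
  have pR: "p \<in> Rn n" "z \<in> Rn n" using pcl z cl_Rn domain_Rn by auto
  have "(\<lambda>i. p i + e * v i) \<in> Rn n" using e(2) cl_Rn by blast
  then have vR: "v i = 0" if "i \<ge> n" for i
    using e(1) pR(1) that by (simp add: mem_Rn)
  have "(\<lambda>i. p i - v i) \<in> \<Omega>"
  proof (intro z(3)[rule_format] allI impI)
    show "(\<lambda>i. p i - v i) \<in> Rn n" using pR vR by (simp add: mem_Rn)
    fix i assume "i < n"
    then have "\<bar>p i - z i - v i\<bar> \<le> (\<Sum>i<n. \<bar>p i - z i - v i\<bar>)"
      by (intro member_le_sum) auto
    then show "\<bar>p i - v i - z i\<bar> < r" using v(2) m by (simp add: algebra_simps)
  qed
  from convex_comb_domain_cl[OF this e(2), of "1 / (1 + e)"] e(1)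
  have "convex_comb (1 / (1 + e)) (\<lambda>i. p i - v i) (\<lambda>i. p i + e * v i) \<in> \<Omega>" by simp
  moreover have "convex_comb (1 / (1 + e)) (\<lambda>i. p i - v i) (\<lambda>i. p i + e * v i) = p"
    using e(1) by (simp add: convex_comb_def fun_eq_iff divide_simps) (simp add: algebra_simps)
  ultimately show False using p\<Omega> by simp
qed

end

section \<open>Hausdorff measures of different dimensions, and volume\<close>

text \<open>The weight of a nonempty set of diameter \<open>d\<close> is \<open>kappa k * d ^ k\<close>.\<close>
definition kappa :: "nat \<Rightarrow> real" where
  "kappa k = unit_ball_vol (real k) / 2 ^ k"

lemma kappa_pos: "kappa k > 0"
  by (simp add: kappa_def)

context Metric_space
begin

lemma hausdorff_weight_le:
  assumes "ediam U \<le> ennreal r" "r \<ge> 0"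
  shows "hausdorff_weight k U \<le> ennreal (kappa k * r ^ k)"
proof -
  have "ennreal (kappa k) * ediam U ^ k \<le> ennreal (kappa k) * ennreal r ^ k"
    by (intro mult_left_mono power_mono assms) auto
  also have "\<dots> = ennreal (kappa k * r ^ k)"
    using assms kappa_pos[of k] by (simp add: ennreal_power ennreal_mult)
  finally show ?thesis by (simp add: hausdorff_weight_def kappa_def)
qed

lemma hausdorff_content_finite_cover:
  assumes "A \<subseteq> (\<Union>m<N. P m)" "\<And>m. m < N \<Longrightarrow> P m \<subseteq> M" "\<And>m. m < N \<Longrightarrow> ediam (P m) \<le> ennreal r"
    and "0 \<le> r" "r \<le> \<delta>"
  shows "hausdorff_content k \<delta> A \<le> ennreal (real N * (kappa k * r ^ k))"
proof -
  define U where "U m = (if m < N then P m else {})" for m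
  have "hausdorff_content k \<delta> A \<le> (\<Sum>m. hausdorff_weight k (U m))"
    unfolding hausdorff_content_def
  proof (intro INF_lower CollectI conjI allI)
    show "A \<subseteq> (\<Union>m. U m)" using assms(1) by (fastforce simp: U_def)
    show "U m \<subseteq> M" for m using assms(2) by (simp add: U_def)
    show "ediam (U m) \<le> ennreal \<delta>" for m
      using order_trans[OF assms(3) ennreal_leI[OF assms(5)], of m]
      by (simp add: U_def) (simp add: ediam_def bot_ennreal)
  qed
  also have "\<dots> = (\<Sum>m<N. hausdorff_weight k (U m))"
    by (rule suminf_finite) (auto simp: U_def hausdorff_weight_def)
  also have "\<dots> \<le> (\<Sum>m<N. ennreal (kappa k * r ^ k))"
    using assms by (intro sum_mono hausdorff_weight_le) (auto simp: U_def)
  also have "\<dots> = ennreal (real N * (kappa k * r ^ k))"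
    using assms(4) kappa_pos[of k] by (simp add: ennreal_mult ennreal_of_nat_eq_real_of_nat)
  finally show ?thesis .
qed

end

definition prism :: "nat \<Rightarrow> real \<Rightarrow> real \<Rightarrow> (nat \<Rightarrow> real) set \<Rightarrow> (nat \<Rightarrow> real) set" where
  "prism j a w A = {x(j := x j + s) | x s. x \<in> A \<and> s \<in> {a..a + w}}"

lemma prism_UN: "prism j a w (\<Union>i\<in>I. A i) = (\<Union>i\<in>I. prism j a w (A i))"
  unfolding prism_def by blast

lemma euclid_dist_shift:
  assumes "j < n"
  shows "euclid_dist n (x(j := x j + s)) (y(j := y j + t)) \<le> euclid_dist n x y + \<bar>s - t\<bar>"
proof -
  have "euclid_dist n (x(j := x j + s)) (y(j := y j + t))
      = L2_set (\<lambda>i. (x i - y i) + (if i = j then s - t else 0)) {..<n}"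
    unfolding euclid_dist_def by (intro L2_set_cong) auto
  also have "\<dots> \<le> L2_set (\<lambda>i. x i - y i) {..<n} + L2_set (\<lambda>i. if i = j then s - t else 0) {..<n}"
    by (rule L2_set_triangle_ineq)
  also have "L2_set (\<lambda>i. if i = j then s - t else 0) {..<n} = \<bar>s - t\<bar>"
    using assms by (simp add: L2_set_def if_distrib[where f = "\<lambda>x. x\<^sup>2"] sum.delta cong: if_cong)
  finally show ?thesis by (simp add: euclid_dist_def)
qed

text \<open>Cutting the prism over a set of diameter at most \<open>r\<close> into slices of height \<open>r\<close>.\<close>
lemma hausdorff_content_prism_le:
  assumes j: "j < n" and U: "U \<subseteq> Rn n" and r: "euclid.ediam n U \<le> ennreal r" "0 < r"
    and \<delta>: "2 * r \<le> \<delta>" and w: "w \<ge> 0"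
  shows "euclid.hausdorff_content n (Suc k) \<delta> (prism j a w U)
    \<le> ennreal (2 ^ Suc k * kappa (Suc k) * (w + r) * r ^ k)"
proof -
  define N where "N = nat \<lfloor>w / r\<rfloor> + 1"
  have "euclid.hausdorff_content n (Suc k) \<delta> (prism j a w U)
      \<le> ennreal (real N * (kappa (Suc k) * (2 * r) ^ Suc k))"
  proof (rule euclid.hausdorff_content_finite_cover[where P = "\<lambda>m. prism j (a + real m * r) r U"])
    show "prism j a w U \<subseteq> (\<Union>m<N. prism j (a + real m * r) r U)"
    proof
      fix y assume "y \<in> prism j a w U"
      then obtain x s where x: "x \<in> U" and s: "a \<le> s" "s \<le> a + w" and y: "y = x(j := x j + s)"
        by (auto simp: prism_def)
      define m where "m = nat \<lfloor>(s - a) / r\<rfloor>"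
      have fl: "real m = of_int \<lfloor>(s - a) / r\<rfloor>" using s r(2) by (simp add: m_def)
      have "(s - a) / r \<le> w / r" using s r(2) by (intro divide_right_mono) auto
      then have "m < N" unfolding m_def N_def by (simp add: floor_mono nat_mono le_imp_less_Suc)
      moreover have "real m \<le> (s - a) / r" "(s - a) / r \<le> real m + 1"
        unfolding fl by linarith+
      then have "real m * r \<le> s - a" "s - a \<le> (real m + 1) * r"
        using r(2) by (simp_all add: pos_le_divide_eq pos_divide_le_eq)
      then have "y \<in> prism j (a + real m * r) r U"
        unfolding prism_def y using x
        by (intro CollectI exI[of _ x] exI[of _ s]) (auto simp: algebra_simps)
      ultimately show "y \<in> (\<Union>m<N. prism j (a + real m * r) r U)" by blast
    qed
    show "prism j (a + real m * r) r U \<subseteq> Rn n" for m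
      using U fun_upd_Rn[OF _ j] unfolding prism_def by blast
    show "euclid.ediam n (prism j (a + real m * r) r U) \<le> ennreal (2 * r)" for m
    proof (rule euclid.ediam_le)
      fix x y assume "x \<in> prism j (a + real m * r) r U" "y \<in> prism j (a + real m * r) r U"
      then obtain x' s y' t where x': "x' \<in> U" "y' \<in> U"
        and s: "s \<in> {a + real m * r..a + real m * r + r}" and t: "t \<in> {a + real m * r..a + real m * r + r}"
        and xy: "x = x'(j := x' j + s)" "y = y'(j := y' j + t)"
        unfolding prism_def by blast
      have st: "\<bar>s - t\<bar> \<le> r" using s t by auto
      have "ennreal (euclid_dist n x' y') \<le> ennreal r"
        using euclid.dist_le_ediam[OF x'] r(1) by (rule order_trans)
      then have "euclid_dist n x' y' \<le> r" using r(2) by simp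
      then show "euclid_dist n x y \<le> 2 * r"
        using euclid_dist_shift[OF j, of x' s y' t] st xy by simp
    qed
  qed (use r \<delta> in simp_all)
  also have "real N * (kappa (Suc k) * (2 * r) ^ Suc k)
      \<le> ((w + r) / r) * (kappa (Suc k) * (2 * r) ^ Suc k)"
  proof (rule mult_right_mono)
    have "real N = of_int \<lfloor>w / r\<rfloor> + 1" using w r(2) by (simp add: N_def)
    also have "\<dots> \<le> w / r + 1" by simp
    finally show "real N \<le> (w + r) / r" using r(2) by (simp add: add_divide_distrib)
    show "0 \<le> kappa (Suc k) * (2 * r) ^ Suc k" using r(2) kappa_pos[of "Suc k"] by simp
  qed
  also have "\<dots> = 2 ^ Suc k * kappa (Suc k) * (w + r) * r ^ k"
    using r(2) by (simp add: power_mult_distrib)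
  finally show ?thesis by (simp add: ennreal_leI)
qed

text \<open>The product estimate: a good cover of \<open>A\<close> yields a cover of the prism.
  The diameters have to be enlarged a little first, since they may vanish.\<close>
lemma hausdorff_outer_prism:
  assumes j: "j < n" and A: "A \<subseteq> Rn n" and w: "w > 0"
  shows "euclid.hausdorff_outer n (Suc k) (prism j a w A)
    \<le> ennreal (2 ^ Suc k * kappa (Suc k) / kappa k * w) * euclid.hausdorff_outer n k A"
proof (cases "euclid.hausdorff_outer n k A = top")
  case True
  have "2 ^ Suc k * kappa (Suc k) / kappa k * w > 0"
    using w kappa_pos[of k] kappa_pos[of "Suc k"] by simp
  then have "ennreal (2 ^ Suc k * kappa (Suc k) / kappa k * w) \<noteq> 0"
    by (simp only: ennreal_eq_0_iff not_le)
  then show ?thesis unfolding True by (simp only: ennreal_mult_top top_greatest if_False)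
next
  case False
  define h where "h = enn2real (euclid.hausdorff_outer n k A)"
  have h: "euclid.hausdorff_outer n k A = ennreal h" "h \<ge> 0"
    using False by (simp_all add: h_def less_top)
  define C where "C = 2 ^ Suc k * kappa (Suc k) / kappa k"
  have C: "C > 0" using kappa_pos[of k] kappa_pos[of "Suc k"] by (simp add: C_def)
  have "euclid.hausdorff_content n (Suc k) \<delta>' (prism j a w A) \<le> ennreal (C * w) * ennreal h"
    if \<delta>': "\<delta>' > 0" for \<delta>'
  proof -
    have approx: "euclid.hausdorff_content n (Suc k) \<delta>' (prism j a w A)
        \<le> ennreal (C * (w + \<eta>) * (h + 2 * \<eta>))" if \<eta>: "\<eta> > 0" for \<eta>
    proof -
      define \<delta> where "\<delta> = min (\<delta>' / 2) \<eta>"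
      have \<delta>: "\<delta> > 0" "2 * \<delta> \<le> \<delta>'" "\<delta> \<le> \<eta>" using \<delta>' \<eta> by (auto simp: \<delta>_def)
      have "euclid.hausdorff_content n k (\<delta> / 2) A \<le> ennreal h"
        using euclid.hausdorff_content_le_outer[of "\<delta> / 2" n k A] h \<delta> by simp
      also have "\<dots> < ennreal (h + \<eta>)" using h \<eta> by (simp add: ennreal_lessI)
      finally obtain U where U: "A \<subseteq> (\<Union>i. U i)" "\<And>i. U i \<subseteq> Rn n"
          "\<And>i. euclid.ediam n (U i) \<le> ennreal (\<delta> / 2)"
        and le: "(\<Sum>i. euclid.hausdorff_weight n k (U i)) < ennreal (h + \<eta>)"
        unfolding euclid.hausdorff_content_def INF_less_iff by auto
      have piece: "euclid.hausdorff_content n (Suc k) \<delta>' (prism j a w (U i))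
          \<le> ennreal (C * (w + \<eta>)) * (euclid.hausdorff_weight n k (U i) + ennreal (\<eta> * (1/2) ^ Suc i))"
        for i
      proof (cases "U i = {}")
        case True
        then show ?thesis by (simp add: prism_def euclid.hausdorff_content_empty)
      next
        case ne: False
        define d where "d = enn2real (euclid.ediam n (U i))"
        have d: "euclid.ediam n (U i) = ennreal d" "d \<ge> 0"
          using le_less_trans[OF U(3)[of i]] by (simp_all add: d_def)
        have "ennreal d \<le> ennreal (\<delta> / 2)" using U(3)[of i] d by simp
        then have d\<delta>: "d < \<delta>" using \<delta> by (simp add: ennreal_le_iff)
        define \<zeta> where "\<zeta> = \<eta> * (1/2) ^ Suc i / kappa k"
        have \<zeta>: "\<zeta> > 0" using \<eta> kappa_pos[of k] by (simp add: \<zeta>_def)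
        have "((\<lambda>e. e ^ k) \<longlongrightarrow> d ^ k) (at_right d)" by (intro tendsto_intros)
        then have "\<forall>\<^sub>F e in at_right d. e ^ k < d ^ k + \<zeta>"
          using \<zeta> by (intro order_tendstoD) auto
        moreover have "\<forall>\<^sub>F e in at_right d. e \<in> {d<..<\<delta>}"
          using eventually_at_right_real[OF d\<delta>] .
        ultimately have "\<forall>\<^sub>F e in at_right d. e ^ k < d ^ k + \<zeta> \<and> e \<in> {d<..<\<delta>}"
          by eventually_elim simp
        then obtain e where e: "e ^ k < d ^ k + \<zeta>" "d < e" "e < \<delta>"
          using eventually_happens' trivial_limit_at_right_real
          by (metis (no_types, lifting) greaterThanLessThan_iff)
        have e0: "e > 0" using e d by simp
        have "euclid.hausdorff_content n (Suc k) \<delta>' (prism j a w (U i))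
            \<le> ennreal (2 ^ Suc k * kappa (Suc k) * (w + e) * e ^ k)"
          using d e e0 \<delta> w by (intro hausdorff_content_prism_le[OF j U(2)]) (simp_all add: ennreal_leI)
        also have "2 ^ Suc k * kappa (Suc k) * (w + e) * e ^ k
            \<le> 2 ^ Suc k * kappa (Suc k) * (w + \<eta>) * (d ^ k + \<zeta>)"
          using e e0 w \<delta> kappa_pos[of "Suc k"] by (intro mult_mono) auto
        also have "\<dots> = C * (w + \<eta>) * (kappa k * d ^ k + \<eta> * (1/2) ^ Suc i)"
          using kappa_pos[of k] by (simp add: C_def \<zeta>_def field_simps)
        finally have "euclid.hausdorff_content n (Suc k) \<delta>' (prism j a w (U i))
            \<le> ennreal (C * (w + \<eta>) * (kappa k * d ^ k + \<eta> * (1/2) ^ Suc i))"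
          by (simp add: ennreal_leI)
        also have "\<dots> = ennreal (C * (w + \<eta>)) * (ennreal (kappa k * d ^ k) + ennreal (\<eta> * (1/2) ^ Suc i))"
          using C w \<eta> d kappa_pos[of k] by (subst ennreal_mult) (simp_all add: ennreal_plus)
        also have "ennreal (kappa k * d ^ k) = euclid.hausdorff_weight n k (U i)"
          using ne d kappa_pos[of k]
          by (simp add: euclid.hausdorff_weight_def kappa_def[symmetric] ennreal_mult ennreal_power)
        finally show ?thesis .
      qed
      have "euclid.hausdorff_content n (Suc k) \<delta>' (prism j a w A)
          \<le> euclid.hausdorff_content n (Suc k) \<delta>' (\<Union>i. prism j a w (U i))"
        unfolding prism_UN[symmetric]
        by (rule euclid.hausdorff_content_mono) (use U(1) in \<open>unfold prism_def, blast\<close>)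
      also have "\<dots> \<le> (\<Sum>i. euclid.hausdorff_content n (Suc k) \<delta>' (prism j a w (U i)))"
        by (rule euclid.hausdorff_content_UN)
      also have "\<dots> \<le> (\<Sum>i. ennreal (C * (w + \<eta>)) *
          (euclid.hausdorff_weight n k (U i) + ennreal (\<eta> * (1/2) ^ Suc i)))"
        by (intro suminf_le piece) auto
      also have "\<dots> = ennreal (C * (w + \<eta>)) *
          ((\<Sum>i. euclid.hausdorff_weight n k (U i)) + (\<Sum>i. ennreal (\<eta> * (1/2) ^ Suc i)))"
        by (subst ennreal_suminf_cmult, subst suminf_add) auto
      also have "(\<Sum>i. ennreal (\<eta> * (1/2) ^ Suc i)) = ennreal \<eta>"
        using \<eta> sums_mult[OF power_half_series, of \<eta>]
        by (subst suminf_ennreal_eq[where x = \<eta>]) auto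
      also have "ennreal (C * (w + \<eta>)) * ((\<Sum>i. euclid.hausdorff_weight n k (U i)) + ennreal \<eta>)
          \<le> ennreal (C * (w + \<eta>)) * (ennreal (h + \<eta>) + ennreal \<eta>)"
        using le by (intro mult_left_mono add_right_mono) (auto intro: less_imp_le)
      also have "\<dots> = ennreal (C * (w + \<eta>) * (h + 2 * \<eta>))"
        using C w \<eta> h by (simp add: ennreal_plus[symmetric] ennreal_mult[symmetric] del: ennreal_plus)
      finally show ?thesis .
    qed
    have "((\<lambda>\<eta>. ennreal (C * (w + \<eta>) * (h + 2 * \<eta>))) \<longlongrightarrow> ennreal (C * (w + 0) * (h + 2 * 0))) (at_right 0)"
      by (intro tendsto_ennrealI tendsto_intros)
    moreover have "\<forall>\<^sub>F \<eta> in at_right 0. euclid.hausdorff_content n (Suc k) \<delta>' (prism j a w A)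
        \<le> ennreal (C * (w + \<eta>) * (h + 2 * \<eta>))"
      using eventually_at_right_less[of "0::real"] by eventually_elim (rule approx)
    ultimately have "euclid.hausdorff_content n (Suc k) \<delta>' (prism j a w A)
        \<le> ennreal (C * (w + 0) * (h + 2 * 0))"
      by (rule tendsto_lowerbound) simp
    then show ?thesis using C w h by (simp add: ennreal_mult)
  qed
  then show ?thesis
    unfolding euclid.hausdorff_outer_def[of n "Suc k"] h C_def by (intro SUP_least) simp
qed

text \<open>Lebesgue measure of \<open>Rn n\<close>, as a Borel measure on all functions that is concentrated on
  \<open>Rn n\<close>; in this form boxes are sets of functions restricted only in their first \<open>n\<close> coordinates.\<close>
definition leb :: "nat \<Rightarrow> (nat \<Rightarrow> real) measure" where
  "leb n = distr (Pi\<^sub>M {..<n} (\<lambda>_. lborel)) borel (\<lambda>y i. if i < n then y i else 0)"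

lemma sets_leb [simp]: "sets (leb n) = sets borel"
  by (simp add: leb_def)

lemma borel_coordinate_set:
  assumes "\<And>i. i < n \<Longrightarrow> S i \<in> sets (borel :: real measure)"
  shows "{x :: nat \<Rightarrow> real. \<forall>i<n. x i \<in> S i} \<in> sets borel"
proof -
  have "(\<lambda>x :: nat \<Rightarrow> real. x i) \<in> borel_measurable borel" for i
    by (intro borel_measurable_continuous_onI continuous_on_product_coordinates)
  from measurable_sets[OF this assms]
  have "(\<Inter>i\<in>{..<n}. {x :: nat \<Rightarrow> real. x i \<in> S i}) \<in> sets borel"
    by (cases "n = 0") (auto simp: vimage_def intro!: sets.finite_INT)
  also have "(\<Inter>i\<in>{..<n}. {x :: nat \<Rightarrow> real. x i \<in> S i}) = {x. \<forall>i<n. x i \<in> S i}" by auto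
  finally show ?thesis .
qed

lemma leb_product:
  assumes S: "\<And>i. i < n \<Longrightarrow> S i \<in> sets (borel :: real measure)"
  shows "emeasure (leb n) {x. \<forall>i<n. x i \<in> S i} = (\<Prod>i<n. emeasure lborel (S i))"
proof -
  interpret product_sigma_finite "\<lambda>_::nat. lborel :: real measure" ..
  have meas: "(\<lambda>y i. if i < n then y i else (0::real)) \<in> measurable (Pi\<^sub>M {..<n} (\<lambda>_. lborel)) borel"
  proof (rule measurable_coordinatewise_then_product)
    fix i show "(\<lambda>y. if i < n then y i else (0::real)) \<in> borel_measurable (Pi\<^sub>M {..<n} (\<lambda>_. lborel))"
      by (cases "i < n") auto
  qed
  have "emeasure (leb n) {x. \<forall>i<n. x i \<in> S i}
      = emeasure (Pi\<^sub>M {..<n} (\<lambda>_. lborel)) (Pi\<^sub>E {..<n} S)"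
    unfolding leb_def
    by (subst emeasure_distr[OF meas borel_coordinate_set[OF S]])
       (auto intro!: arg_cong2[where f = emeasure] simp: space_PiM PiE_def Pi_def)
  also have "\<dots> = (\<Prod>i<n. emeasure lborel (S i))"
    using S by (intro emeasure_PiM) auto
  finally show ?thesis .
qed

text \<open>A set of diameter \<open>d\<close> lies in a cube of side \<open>2 * d\<close>.\<close>
lemma leb_le_hausdorff_outer:
  assumes "A \<in> sets borel" "A \<subseteq> Rn n"
  shows "ennreal (kappa n) * emeasure (leb n) A \<le> 2 ^ n * euclid.hausdorff_outer n n A"
proof -
  have "ennreal (kappa n) * emeasure (leb n) A \<le> 2 ^ n * (\<Sum>i. euclid.hausdorff_weight n n (U i))"
    if U: "A \<subseteq> (\<Union>i. U i)" "\<And>i. U i \<subseteq> Rn n" "\<And>i. euclid.ediam n (U i) \<le> ennreal 1"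
    for U :: "nat \<Rightarrow> (nat \<Rightarrow> real) set"
  proof -
    have "\<exists>Q\<in>sets borel. U i \<subseteq> Q \<and>
        ennreal (kappa n) * emeasure (leb n) Q \<le> 2 ^ n * euclid.hausdorff_weight n n (U i)" for i
    proof (cases "U i = {}")
      case False
      then obtain x where x: "x \<in> U i" by blast
      define d where "d = enn2real (euclid.ediam n (U i))"
      have d: "euclid.ediam n (U i) = ennreal d" "d \<ge> 0"
        using le_less_trans[OF U(3)[of i]] by (simp_all add: d_def)
      define Q where "Q = {y :: nat \<Rightarrow> real. \<forall>l<n. y l \<in> {x l - d..x l + d}}"
      have "emeasure (leb n) Q = (\<Prod>l<n. emeasure lborel {x l - d..x l + d})"
        unfolding Q_def by (rule leb_product) auto
      also have "\<dots> = ennreal ((2 * d) ^ n)" using d by (simp add: ennreal_power)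
      finally have "ennreal (kappa n) * emeasure (leb n) Q = ennreal (2 ^ n * (kappa n * d ^ n))"
        using d kappa_pos[of n] by (simp add: ennreal_mult[symmetric] power_mult_distrib mult_ac)
      also have "\<dots> = 2 ^ n * euclid.hausdorff_weight n n (U i)"
        using False d kappa_pos[of n]
        by (simp add: euclid.hausdorff_weight_def kappa_def[symmetric] ennreal_mult ennreal_power
            flip: ennreal_numeral)
      finally have "ennreal (kappa n) * emeasure (leb n) Q \<le> 2 ^ n * euclid.hausdorff_weight n n (U i)"
        by simp
      moreover have "U i \<subseteq> Q"
      proof
        fix y assume y: "y \<in> U i"
        have "ennreal (euclid_dist n x y) \<le> ennreal d"
          unfolding d(1)[symmetric] by (rule euclid.dist_le_ediam[OF x y])
        then have "euclid_dist n x y \<le> d" using d by simp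
        have "y l \<in> {x l - d..x l + d}" if "l < n" for l
          using abs_coord_le_euclid_dist[OF that, of x y] \<open>euclid_dist n x y \<le> d\<close> by auto
        then show "y \<in> Q" by (simp add: Q_def)
      qed
      moreover have "Q \<in> sets borel" unfolding Q_def by (rule borel_coordinate_set) auto
      ultimately show ?thesis by blast
    qed (auto intro: bexI[of _ "{}"])
    then obtain Q where Q: "\<And>i. Q i \<in> sets borel" "\<And>i. U i \<subseteq> Q i"
      "\<And>i. ennreal (kappa n) * emeasure (leb n) (Q i) \<le> 2 ^ n * euclid.hausdorff_weight n n (U i)"
      by metis
    have "emeasure (leb n) A \<le> emeasure (leb n) (\<Union>i. Q i)"
    proof (rule emeasure_mono)
      show "A \<subseteq> (\<Union>i. Q i)" using U(1) Q(2) by blast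
      show "(\<Union>i. Q i) \<in> sets (leb n)" using Q(1) by auto
    qed
    also have "\<dots> \<le> (\<Sum>i. emeasure (leb n) (Q i))"
      using Q(1) by (intro emeasure_subadditive_countably) auto
    finally have "ennreal (kappa n) * emeasure (leb n) A \<le> ennreal (kappa n) * (\<Sum>i. emeasure (leb n) (Q i))"
      by (rule mult_left_mono) simp
    also have "\<dots> = (\<Sum>i. ennreal (kappa n) * emeasure (leb n) (Q i))" by simp
    also have "\<dots> \<le> (\<Sum>i. 2 ^ n * euclid.hausdorff_weight n n (U i))"
      by (intro suminf_le Q(3)) auto
    finally show ?thesis by simp
  qed
  note cover = this
  have two: "(2::ennreal) ^ n = ennreal (2 ^ n)"
    by (simp add: ennreal_power[symmetric])
  have two_pos: "(2::ennreal) ^ n > 0" and two_fin: "(2::ennreal) ^ n \<noteq> 0" "(2::ennreal) ^ n \<noteq> top"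
    unfolding two by simp_all
  have "ennreal (kappa n) * emeasure (leb n) A / 2 ^ n \<le> (\<Sum>i. euclid.hausdorff_weight n n (U i))"
    if "U \<in> {U. A \<subseteq> (\<Union>i. U i) \<and> (\<forall>i. U i \<subseteq> Rn n \<and> euclid.ediam n (U i) \<le> ennreal 1)}" for U
    using that cover[of U] by (intro divide_le_posI_ennreal two_pos) auto
  then have "ennreal (kappa n) * emeasure (leb n) A / 2 ^ n \<le> euclid.hausdorff_content n n 1 A"
    unfolding euclid.hausdorff_content_def by (intro INF_greatest)
  also have "\<dots> \<le> euclid.hausdorff_outer n n A"
    by (rule euclid.hausdorff_content_le_outer) simp
  finally have "2 ^ n * (ennreal (kappa n) * emeasure (leb n) A / 2 ^ n)
      \<le> 2 ^ n * euclid.hausdorff_outer n n A"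
    by (rule mult_left_mono) simp
  moreover have "2 ^ n * (X / 2 ^ n) = X" for X :: ennreal
    unfolding ennreal_times_divide mult.commute[of _ X] by (rule mult_divide_eq_ennreal[OF two_fin])
  ultimately show ?thesis by simp
qed

section \<open>The surface measure of the boundary\<close>

lemma leb_Int_Rn:
  assumes "A \<in> sets borel"
  shows "emeasure (leb n) (A \<inter> Rn n) = emeasure (leb n) A"
proof -
  let ?f = "\<lambda>y i. if i < n then y i else (0::real)"
  have meas: "?f \<in> measurable (Pi\<^sub>M {..<n} (\<lambda>_. lborel)) borel"
  proof (rule measurable_coordinatewise_then_product)
    fix i show "(\<lambda>y. ?f y i) \<in> borel_measurable (Pi\<^sub>M {..<n} (\<lambda>_. lborel))"
      by (cases "i < n") auto
  qed
  have "?f -` (A \<inter> Rn n) = ?f -` A" by (auto simp: mem_Rn)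
  then show ?thesis
    unfolding leb_def using assms borel_Rn[of n]
    by (simp add: emeasure_distr[OF meas] sets.Int)
qed

context convex_domain
begin

lemma borel_domain: "\<Omega> \<in> sets borel"
  by (rule borel_openin_Rn[OF open_domain])

lemma borel_cl: "cl \<in> sets borel"
  by (rule borel_closedin_Rn[of n]) simp

lemma borel_bd: "bd \<in> sets borel"
  unfolding bd_eq using borel_domain borel_cl by (rule sets.Diff[rotated])

lemma leb_domain_finite: "emeasure (leb n) \<Omega> < top"
proof -
  obtain B where B: "B > 0" "\<forall>x\<in>cl. \<forall>i. \<bar>x i\<bar> \<le> B" by (rule bounded)
  have "emeasure (leb n) \<Omega> \<le> emeasure (leb n) {x. \<forall>i<n. x i \<in> {- B..B}}"
  proof (rule emeasure_mono)
    show "\<Omega> \<subseteq> {x. \<forall>i<n. x i \<in> {- B..B}}"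
      using B(2) domain_cl by (auto simp: abs_le_iff minus_le_iff subset_iff)
    show "{x. \<forall>i<n. x i \<in> {- B..B}} \<in> sets (leb n)"
      unfolding sets_leb by (rule borel_coordinate_set) auto
  qed
  also have "\<dots> = (\<Prod>i<n. emeasure lborel {- B..B})" by (rule leb_product) auto
  also have "\<dots> = ennreal ((2 * B) ^ n)" using B(1) by (simp add: ennreal_power)
  finally show ?thesis by (rule le_less_trans) simp
qed

lemma leb_domain_pos: "emeasure (leb n) \<Omega> > 0"
proof -
  obtain z r where z: "z \<in> \<Omega>" "r > 0"
    "\<forall>y\<in>Rn n. (\<forall>i<n. \<bar>y i - z i\<bar> < r) \<longrightarrow> y \<in> \<Omega>"
    by (rule interior_cube)
  let ?Q = "{x. \<forall>i<n. x i \<in> {z i - r<..<z i + r}}"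
  have Q: "?Q \<in> sets borel" by (rule borel_coordinate_set) auto
  have "emeasure (leb n) ?Q = (\<Prod>i<n. emeasure lborel {z i - r<..<z i + r})"
    by (rule leb_product) auto
  also have "\<dots> = ennreal ((2 * r) ^ n)" using z(2) by (simp add: ennreal_power)
  finally have "emeasure (leb n) (?Q \<inter> Rn n) = ennreal ((2 * r) ^ n)"
    unfolding leb_Int_Rn[OF Q] .
  then have "0 < emeasure (leb n) (?Q \<inter> Rn n)" using z(2) by simp
  also have "\<dots> \<le> emeasure (leb n) \<Omega>"
  proof (rule emeasure_mono)
    show "?Q \<inter> Rn n \<subseteq> \<Omega>"
    proof
      fix y assume y: "y \<in> ?Q \<inter> Rn n"
      have "\<forall>i<n. \<bar>y i - z i\<bar> < r" using y by (auto simp: abs_less_iff algebra_simps)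
      then show "y \<in> \<Omega>" using z(3) y by blast
    qed
  qed (simp add: borel_domain)
  finally show ?thesis .
qed

definition vol :: real where "vol = measure (leb n) \<Omega>"

lemma emeasure_leb_domain: "emeasure (leb n) \<Omega> = ennreal vol"
  unfolding vol_def using leb_domain_finite by (intro emeasure_eq_ennreal_measure) auto

lemma vol_pos: "vol > 0"
  using leb_domain_pos unfolding emeasure_leb_domain by simp

text \<open>The same \<open>w\<close> controls the chords of direction \<open>i\<close> from above and has to be attained, up to a
  constant, in all directions. The supremum of the lengths of the chords need not be attained in
  the open domain, hence the factor \<open>1/2\<close>.\<close>
lemma minimal_direction:
  assumes "n > 0"
  obtains i w where "i < n" "w > 0" "\<forall>x\<in>\<Omega>. \<forall>s. x(i := x i + s) \<in> \<Omega> \<longrightarrow> s \<le> w"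
    "\<forall>j<n. \<exists>x\<in>\<Omega>. x(j := x j + w / 2) \<in> \<Omega>"
proof -
  define W where "W j = {s. \<exists>x\<in>\<Omega>. x(j := x j + s) \<in> \<Omega>}" for j
  obtain B where B: "B > 0" "\<forall>x\<in>cl. \<forall>i. \<bar>x i\<bar> \<le> B" by (rule bounded)
  have W_le: "s \<le> 2 * B" if sW: "s \<in> W j" for s j
  proof -
    obtain x where x: "x \<in> \<Omega>" "x(j := x j + s) \<in> \<Omega>" using sW by (auto simp: W_def)
    have "\<bar>x j\<bar> \<le> B" "\<bar>(x(j := x j + s)) j\<bar> \<le> B" using x domain_cl B(2) by blast+
    then show ?thesis by simp
  qed
  have bdd: "bdd_above (W j)" for j by (rule bdd_aboveI[OF W_le])
  have W_pos: "\<exists>s>0. s \<in> W j" if j: "j < n" for j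
  proof -
    obtain x where x: "x \<in> \<Omega>" using nonempty by blast
    obtain s where s: "s > 0" "\<And>t. 0 \<le> t \<Longrightarrow> t < s \<Longrightarrow> x(j := x j + 1 * t) \<in> \<Omega>"
      by (rule exit_point[OF x j, of 1]) auto
    have "x(j := x j + s / 2) \<in> \<Omega>" using s(2)[of "s / 2"] s(1) by simp
    then have "s / 2 \<in> W j" using x unfolding W_def by blast
    then show ?thesis using \<open>s > 0\<close> by (intro exI[of _ "s / 2"]) auto
  qed
  define w where "w j = Sup (W j)" for j
  have w_upper: "s \<le> w j" if "s \<in> W j" for s j
    unfolding w_def using that bdd by (rule cSup_upper)
  obtain i where i: "i < n" "\<And>j. j < n \<Longrightarrow> w i \<le> w j"
  proof -
    have "Min (w ` {..<n}) \<in> w ` {..<n}" using assms by (intro Min_in) auto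
    then obtain i where "i < n" "w i = Min (w ` {..<n})" by auto
    then show thesis by (intro that[of i]) auto
  qed
  have wi: "w i > 0" using W_pos[OF i(1)] w_upper[of _ i] by fastforce
  show thesis
  proof (rule that[OF i(1) wi])
    show "\<forall>x\<in>\<Omega>. \<forall>s. x(i := x i + s) \<in> \<Omega> \<longrightarrow> s \<le> w i"
      using w_upper[of _ i] by (auto simp: W_def)
    show "\<forall>j<n. \<exists>x\<in>\<Omega>. x(j := x j + w i / 2) \<in> \<Omega>"
    proof (intro allI impI)
      fix j assume j: "j < n"
      have "w i / 2 < Sup (W j)" using i(2)[OF j] wi unfolding w_def by linarith
      then obtain s where s: "s \<in> W j" "w i / 2 < s"
        using W_pos[OF j] by (metis empty_iff less_cSupE)
      then obtain x where x: "x \<in> \<Omega>" "x(j := x j + s) \<in> \<Omega>" by (auto simp: W_def)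
      have "convex_comb (w i / 2 / s) (x(j := x j)) (x(j := x j + s)) \<in> \<Omega>"
        using x s wi by (intro convex_setD[OF domain_convex]) simp_all
      moreover have "(1 - w i / 2 / s) * x j + w i / 2 / s * (x j + s) = x j + w i / 2"
      proof -
        have "s \<noteq> 0" using s wi by linarith
        then show ?thesis by (simp add: divide_simps) (simp add: algebra_simps)
      qed
      ultimately have "x(j := x j + w i / 2) \<in> \<Omega>" by (simp only: convex_comb_fun_upd)
      then show "\<exists>x\<in>\<Omega>. x(j := x j + w i / 2) \<in> \<Omega>" using x(1) by blast
    qed
  qed
qed

text \<open>Averaging a point of the closure over a column of the grid (weight \<open>1/2\<close>), a chord in
  direction \<open>j\<close> and a cube (weight \<open>1/4\<close> each) puts a box over every grid column that meets the
  closure; these boxes are disjoint, so there cannot be too many columns.\<close>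
lemma column_count:
  assumes j: "j < n" and \<delta>: "\<delta> > 0" "2 * \<delta> \<le> r"
    and z: "z \<in> \<Omega>" "\<forall>y\<in>Rn n. (\<forall>i<n. \<bar>y i - z i\<bar> < r) \<longrightarrow> y \<in> \<Omega>"
    and a: "a \<in> \<Omega>" "a(j := a j + l) \<in> \<Omega>" and l: "l > 0"
    and U: "finite U" "\<And>u i. u \<in> U \<Longrightarrow> i \<ge> n \<or> i = j \<Longrightarrow> u i = 0"
      "\<And>u. u \<in> U \<Longrightarrow> \<exists>x\<in>cl. \<forall>i<n. i \<noteq> j \<longrightarrow> u i = \<lfloor>x i / \<delta>\<rfloor>"
  shows "real (card U) * ((\<delta> / 2) ^ (n - 1) * (l / 4)) \<le> vol"
proof -
  obtain X where X: "\<And>u. u \<in> U \<Longrightarrow> X u \<in> cl"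
    "\<And>u i. u \<in> U \<Longrightarrow> i < n \<Longrightarrow> i \<noteq> j \<Longrightarrow> u i = \<lfloor>X u i / \<delta>\<rfloor>"
    using U(3) by metis
  have X_bounds: "of_int (u i) * \<delta> \<le> X u i" "X u i < (of_int (u i) + 1) * \<delta>"
    if "u \<in> U" "i < n" "i \<noteq> j" for u i
  proof -
    have "of_int (u i) \<le> X u i / \<delta>" "X u i / \<delta> < of_int (u i) + 1"
      unfolding X(2)[OF that] by linarith+
    then show "of_int (u i) * \<delta> \<le> X u i" "X u i < (of_int (u i) + 1) * \<delta>"
      using \<delta>(1) by (simp_all add: pos_le_divide_eq pos_divide_less_eq)
  qed
  define c where "c i = a i / 4 + z i / 4" for i
  define S where "S u i = (if i = j then {X u j / 2 + c j..X u j / 2 + c j + l / 4}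
    else {c i + of_int (u i) * (\<delta> / 2)..<c i + (of_int (u i) + 1) * (\<delta> / 2)})" for u i
  define R where "R u = {y. \<forall>i<n. y i \<in> S u i}" for u
  have R_borel: "R u \<in> sets borel" for u
    unfolding R_def by (rule borel_coordinate_set) (auto simp: S_def)
  have R_vol: "emeasure (leb n) (R u) = ennreal ((\<delta> / 2) ^ (n - 1) * (l / 4))" for u
  proof -
    have "emeasure (leb n) (R u) = (\<Prod>i<n. emeasure lborel (S u i))"
      unfolding R_def by (rule leb_product) (auto simp: S_def)
    also have "\<dots> = emeasure lborel (S u j) * (\<Prod>i\<in>{..<n} - {j}. emeasure lborel (S u i))"
      using j by (intro prod.remove) auto
    also have "(\<Prod>i\<in>{..<n} - {j}. emeasure lborel (S u i)) = (\<Prod>i\<in>{..<n} - {j}. ennreal (\<delta> / 2))"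
    proof (rule prod.cong[OF refl])
      fix i assume "i \<in> {..<n} - {j}"
      moreover have "c i + (of_int (u i) + 1) * (\<delta> / 2) - (c i + of_int (u i) * (\<delta> / 2)) = \<delta> / 2"
        by (simp add: algebra_simps)
      ultimately show "emeasure lborel (S u i) = ennreal (\<delta> / 2)"
        using \<delta>(1) by (simp add: S_def mult_right_mono)
    qed
    also have "\<dots> = ennreal ((\<delta> / 2) ^ (n - 1))" using j \<delta>(1) by (simp add: ennreal_power)
    also have "emeasure lborel (S u j) = ennreal (l / 4)" using l by (simp add: S_def)
    finally show ?thesis using \<delta>(1) l by (simp add: ennreal_mult[symmetric] mult.commute)
  qed
  have R_disj: "disjoint_family_on R U"
    unfolding disjoint_family_on_def
  proof (intro ballI impI)
    fix u v assume uv: "u \<in> U" "v \<in> U" "u \<noteq> v"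
    then obtain i where i: "u i \<noteq> v i" by blast
    then have ij: "i < n" "i \<noteq> j" using U(2)[OF uv(1), of i] U(2)[OF uv(2), of i] by (metis not_le)+
    have False if y: "y \<in> R u" "y \<in> R v" for y
    proof -
      have "y i \<in> S u i" "y i \<in> S v i" using y ij(1) by (auto simp: R_def)
      then have *: "of_int (u i) * (\<delta> / 2) < (of_int (v i) + 1) * (\<delta> / 2)"
        "of_int (v i) * (\<delta> / 2) < (of_int (u i) + 1) * (\<delta> / 2)"
        using ij(2) by (auto simp: S_def)
      have "real_of_int (u i) < of_int (v i) + 1" "real_of_int (v i) < of_int (u i) + 1"
        using *[THEN mult_right_less_imp_less] \<delta>(1) by auto
      then show False using i by linarith
    qed
    then show "R u \<inter> R v = {}" by blast
  qed
  have R_sub: "R u \<inter> Rn n \<subseteq> \<Omega>" if u: "u \<in> U" for u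
  proof
    fix y assume y: "y \<in> R u \<inter> Rn n"
    have XR: "X u \<in> Rn n" "a \<in> Rn n" "z \<in> Rn n" using X(1)[OF u] cl_Rn a z domain_Rn by auto
    have yj: "y j \<in> {X u j / 2 + c j..X u j / 2 + c j + l / 4}"
      using y j by (auto simp: R_def S_def)
    define \<tau> where "\<tau> = 4 * (y j - X u j / 2 - c j)"
    have \<tau>: "0 \<le> \<tau>" "\<tau> \<le> l" using yj by (auto simp: \<tau>_def)
    have "convex_comb (\<tau> / l) (a(j := a j)) (a(j := a j + l)) \<in> \<Omega>"
      using a \<tau> l by (intro convex_setD[OF domain_convex]) simp_all
    moreover have "(1 - \<tau> / l) * a j + \<tau> / l * (a j + l) = a j + \<tau>"
      using l by (simp add: algebra_simps)
    ultimately have a': "a(j := a j + \<tau>) \<in> \<Omega>" by (simp only: convex_comb_fun_upd)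
    define Z where "Z i = (if i = j then z j else 4 * (y i - X u i / 2 - a i / 4))" for i
    have "Z \<in> \<Omega>"
    proof (rule z(2)[rule_format])
      show "Z \<in> Rn n" using XR y j by (auto simp: mem_Rn Z_def)
      fix i assume i: "i < n"
      show "\<bar>Z i - z i\<bar> < r"
      proof (cases "i = j")
        case True
        then show ?thesis using \<delta> by (simp add: Z_def)
      next
        case False
        have "y i \<in> S u i" using y i by (auto simp: R_def)
        then have "c i + of_int (u i) * (\<delta> / 2) \<le> y i" "y i < c i + (of_int (u i) + 1) * (\<delta> / 2)"
          using False by (auto simp: S_def)
        moreover have "(of_int (u i) + 1) * (\<delta> / 2) = of_int (u i) * (\<delta> / 2) + \<delta> / 2"
          "(of_int (u i) + 1) * \<delta> = 2 * (of_int (u i) * (\<delta> / 2)) + \<delta>"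
          "of_int (u i) * \<delta> = 2 * (of_int (u i) * (\<delta> / 2))"
          by (simp_all add: algebra_simps)
        ultimately have "\<bar>y i - c i - X u i / 2\<bar> < \<delta> / 2"
          using X_bounds[OF u i False] unfolding abs_less_iff by linarith
        moreover have "Z i - z i = 4 * (y i - c i - X u i / 2)"
          using False by (simp add: Z_def c_def algebra_simps)
        ultimately have "\<bar>Z i - z i\<bar> < 4 * (\<delta> / 2)"
          by (simp only: abs_mult abs_numeral mult_less_cancel_left_pos zero_less_numeral)
        then show ?thesis using \<delta>(2) by linarith
      qed
    qed
    with a' have "convex_comb (1/2) (a(j := a j + \<tau>)) Z \<in> \<Omega>"
      by (intro convex_setD[OF domain_convex]) simp_all
    from convex_comb_domain_cl[OF this X(1)[OF u], of "1/2"]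
    have "convex_comb (1/2) (convex_comb (1/2) (a(j := a j + \<tau>)) Z) (X u) \<in> \<Omega>" by simp
    moreover have "convex_comb (1/2) (convex_comb (1/2) (a(j := a j + \<tau>)) Z) (X u) = y"
      by (auto simp: convex_comb_def fun_eq_iff Z_def \<tau>_def c_def field_simps)
    ultimately show "y \<in> \<Omega>" by simp
  qed
  have "ennreal (real (card U) * ((\<delta> / 2) ^ (n - 1) * (l / 4))) = (\<Sum>u\<in>U. emeasure (leb n) (R u))"
    unfolding R_vol sum_constant ennreal_of_nat_eq_real_of_nat
    using \<delta>(1) l by (intro ennreal_mult) auto
  also have "\<dots> = emeasure (leb n) (\<Union>u\<in>U. R u)"
    using U(1) R_disj R_borel by (intro sum_emeasure) auto
  also have "\<dots> = emeasure (leb n) ((\<Union>u\<in>U. R u) \<inter> Rn n)"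
    using U(1) R_borel by (intro leb_Int_Rn[symmetric]) auto
  also have "\<dots> \<le> emeasure (leb n) \<Omega>"
    using R_sub borel_domain by (intro emeasure_mono) auto
  finally show ?thesis using vol_pos unfolding emeasure_leb_domain by (simp add: ennreal_le_iff)
qed

end

text \<open>The column of a cell and its height modulo \<open>m\<close> determine the cell.\<close>
lemma card_le_column_card:
  fixes F :: "(nat \<Rightarrow> int) set"
  assumes "finite F" "m > 0"
    and close: "\<And>u v. u \<in> F \<Longrightarrow> v \<in> F \<Longrightarrow> u(j := 0) = v(j := 0) \<Longrightarrow> \<bar>u j - v j\<bar> < int m"
  shows "card F \<le> m * card ((\<lambda>u. u(j := 0)) ` F)"
proof -
  let ?g = "\<lambda>u. (u j mod int m, u(j := 0))"
  have inj: "inj_on ?g F"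
  proof (rule inj_onI)
    fix u v assume uv: "u \<in> F" "v \<in> F" "?g u = ?g v"
    then have "int m dvd u j - v j" by (auto simp: mod_eq_dvd_iff)
    moreover have "\<bar>u j - v j\<bar> < int m" using close uv by auto
    ultimately have "u j = v j" using zdvd_imp_le[of "int m" "\<bar>u j - v j\<bar>"] by auto
    then show "u = v" using uv(3) by (metis Pair_inject fun_upd_triv fun_upd_upd)
  qed
  have "card F = card (?g ` F)" by (rule card_image[OF inj, symmetric])
  also have "\<dots> \<le> card ({0..<int m} \<times> (\<lambda>u. u(j := 0)) ` F)"
    using assms(1,2) by (intro card_mono) auto
  finally show ?thesis by (simp add: card_cartesian_product)
qed

context convex_domain
begin

text \<open>On the part of the boundary that belongs to the axis \<open>j\<close> and the sign \<open>\<sigma>\<close> in \<open>boundary_cone\<close>, two points of the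
  same grid column differ by at most \<open>2 * (n - 1) * \<delta>\<close> in coordinate \<open>j\<close>, so that a column contains at
  most \<open>2 * n\<close> cells that meet this part. The \<open>2 * n\<close> parts are counted separately.\<close>
lemma grid_count:
  assumes \<delta>: "\<delta> > 0" "2 * \<delta> \<le> r" and w: "w > 0"
    and z: "z \<in> \<Omega>" "\<forall>y\<in>Rn n. (\<forall>i<n. \<bar>y i - z i\<bar> < r) \<longrightarrow> y \<in> \<Omega>"
    and chord: "\<forall>j<n. \<exists>x\<in>\<Omega>. x(j := x j + w / 2) \<in> \<Omega>"
    and cell: "cell = (\<lambda>x i. if i < n then \<lfloor>x i / \<delta>\<rfloor> else 0)"
  shows "finite (cell ` bd)" (is ?fin)
    and "real (card (cell ` bd)) * (\<delta> ^ (n - 1) * w) \<le> 16 * (real n)\<^sup>2 * 2 ^ n * vol" (is ?count)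
proof -
  show fin: ?fin
  proof -
    obtain B where B: "B > 0" "\<forall>x\<in>cl. \<forall>i. \<bar>x i\<bar> \<le> B" by (rule bounded)
    define K where "K = \<lfloor>B / \<delta>\<rfloor> + 1"
    have "cell ` bd \<subseteq> {u. \<forall>i. (i \<in> {..<n} \<longrightarrow> u i \<in> {- K..K}) \<and> (i \<notin> {..<n} \<longrightarrow> u i = 0)}"
    proof
      fix u assume "u \<in> cell ` bd"
      then obtain x where x: "x \<in> bd" "u = cell x" by blast
      have "u i \<in> {- K..K}" if "i < n" for i
      proof -
        have "\<bar>x i\<bar> \<le> B" using x B(2) by (auto simp: bd_eq)
        then have "- (B / \<delta>) \<le> x i / \<delta>" "x i / \<delta> \<le> B / \<delta>"
          using \<delta>(1) by (simp_all add: abs_le_iff divide_simps)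
        then have "- K \<le> \<lfloor>x i / \<delta>\<rfloor>" "\<lfloor>x i / \<delta>\<rfloor> \<le> K" unfolding K_def by linarith+
        then show ?thesis using that x(2) by (simp add: cell)
      qed
      then show "u \<in> {u. \<forall>i. (i \<in> {..<n} \<longrightarrow> u i \<in> {- K..K}) \<and> (i \<notin> {..<n} \<longrightarrow> u i = 0)}"
        using x(2) by (auto simp: cell)
    qed
    then show ?thesis by (rule finite_subset) (rule finite_set_of_finite_funs; simp)
  qed
  define C where "C j \<sigma> = {p \<in> bd. \<forall>q\<in>cl. \<sigma> * (q j - p j) \<le> 2 * (\<Sum>i\<in>{..<n} - {j}. \<bar>q i - p i\<bar>)}"
    for j and \<sigma> :: real
  have bd_cover: "bd = (\<Union>j<n. \<Union>\<sigma>\<in>{1, -1}. C j \<sigma>)"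
  proof
    show "bd \<subseteq> (\<Union>j<n. \<Union>\<sigma>\<in>{1, -1}. C j \<sigma>)"
    proof
      fix p assume p: "p \<in> bd"
      obtain j \<sigma> where "j < n" "\<sigma> \<in> {1, -1}"
        "\<forall>q\<in>cl. \<sigma> * (q j - p j) \<le> 2 * (\<Sum>i\<in>{..<n} - {j}. \<bar>q i - p i\<bar>)"
        by (rule boundary_cone[OF p])
      then show "p \<in> (\<Union>j<n. \<Union>\<sigma>\<in>{1, -1}. C j \<sigma>)" using p unfolding C_def by blast
    qed
  qed (auto simp: C_def)
  have count: "real (card (cell ` C j \<sigma>)) * (\<delta> ^ (n - 1) * w) \<le> 8 * real n * 2 ^ n * vol"
    if j: "j < n" and \<sigma>: "\<sigma> \<in> {1, -1}" for j \<sigma>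
  proof -
    let ?F = "cell ` C j \<sigma>"
    have finF: "finite ?F" using fin by (rule finite_subset[rotated]) (auto simp: C_def)
    have "card ?F \<le> (2 * n) * card ((\<lambda>u. u(j := 0)) ` ?F)"
    proof (rule card_le_column_card[OF finF])
      show "2 * n > 0" using j by simp
      fix u v assume "u \<in> ?F" "v \<in> ?F" and eq: "u(j := 0) = v(j := 0)"
      then obtain p q where p: "p \<in> C j \<sigma>" "u = cell p" and q: "q \<in> C j \<sigma>" "v = cell q" by blast
      have *: "\<bar>q i - p i\<bar> \<le> \<delta>" if i: "i \<in> {..<n} - {j}" for i
      proof -
        have "u i = v i" using fun_cong[OF eq, of i] i by simp
        then have fl: "\<lfloor>p i / \<delta>\<rfloor> = \<lfloor>q i / \<delta>\<rfloor>" using i p q by (simp add: cell)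
        have "\<bar>q i / \<delta> - p i / \<delta>\<bar> \<le> 1" using fl unfolding abs_le_iff by linarith
        then have "\<bar>q i - p i\<bar> / \<delta> \<le> 1" using \<delta>(1) by (simp add: diff_divide_distrib[symmetric])
        then show ?thesis using \<delta>(1) by (simp add: pos_divide_le_eq)
      qed
      have "(\<Sum>i\<in>{..<n} - {j}. \<bar>q i - p i\<bar>) \<le> (\<Sum>i\<in>{..<n} - {j}. \<delta>)" by (intro sum_mono *)
      also have "\<dots> = (real n - 1) * \<delta>" using j by (simp add: of_nat_diff)
      finally have sum: "(\<Sum>i\<in>{..<n} - {j}. \<bar>q i - p i\<bar>) \<le> (real n - 1) * \<delta>" .
      moreover have "(\<Sum>i\<in>{..<n} - {j}. \<bar>p i - q i\<bar>) = (\<Sum>i\<in>{..<n} - {j}. \<bar>q i - p i\<bar>)"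
        by (simp add: abs_minus_commute)
      moreover have "\<sigma> * (q j - p j) \<le> 2 * (\<Sum>i\<in>{..<n} - {j}. \<bar>q i - p i\<bar>)"
        "\<sigma> * (p j - q j) \<le> 2 * (\<Sum>i\<in>{..<n} - {j}. \<bar>p i - q i\<bar>)"
        using p(1) q(1) by (auto simp: C_def bd_eq)
      ultimately have "\<bar>p j - q j\<bar> \<le> 2 * ((real n - 1) * \<delta>)" using \<sigma> by (auto simp: abs_le_iff)
      then have "\<bar>p j - q j\<bar> / \<delta> \<le> 2 * (real n - 1)"
        using \<delta>(1) by (simp only: pos_divide_le_eq mult.assoc)
      then have "\<bar>p j / \<delta> - q j / \<delta>\<bar> \<le> 2 * real n - 2"
        using \<delta>(1) by (simp add: diff_divide_distrib[symmetric])
      then show "\<bar>u j - v j\<bar> < int (2 * n)"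
        using j p(2) q(2) unfolding abs_le_iff abs_less_iff by (simp add: cell) linarith
    qed
    then have 1: "real (card ?F) \<le> real (2 * n) * real (card ((\<lambda>u. u(j := 0)) ` ?F))"
      by (simp only: of_nat_mult[symmetric] of_nat_le_iff)
    have 2: "real (card ((\<lambda>u. u(j := 0)) ` ?F)) * ((\<delta> / 2) ^ (n - 1) * (w / 2 / 4)) \<le> vol"
    proof -
      obtain a where a: "a \<in> \<Omega>" "a(j := a j + w / 2) \<in> \<Omega>" using chord j by blast
      show ?thesis
      proof (rule column_count[OF j \<delta> z a])
        show "\<exists>x\<in>cl. \<forall>i<n. i \<noteq> j \<longrightarrow> u i = \<lfloor>x i / \<delta>\<rfloor>" if "u \<in> (\<lambda>u. u(j := 0)) ` ?F" for u
          using that by (auto simp: cell C_def bd_eq)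
      qed (use w finF in \<open>auto simp: cell\<close>)
    qed
    have "(2::real) ^ n = 2 * 2 ^ (n - 1)" using j by (cases n) auto
    then have "\<delta> ^ (n - 1) * w = 4 * 2 ^ n * ((\<delta> / 2) ^ (n - 1) * (w / 2 / 4))"
      by (simp add: power_divide)
    then have "real (card ?F) * (\<delta> ^ (n - 1) * w)
        = 4 * 2 ^ n * (real (card ?F) * ((\<delta> / 2) ^ (n - 1) * (w / 2 / 4)))"
      by (simp only: mult_ac)
    also have "\<dots> \<le> 4 * 2 ^ n * (real (2 * n) * real (card ((\<lambda>u. u(j := 0)) ` ?F))
        * ((\<delta> / 2) ^ (n - 1) * (w / 2 / 4)))"
      using \<delta>(1) w by (intro mult_left_mono mult_right_mono[OF 1]) simp_all
    also have "\<dots> \<le> 4 * 2 ^ n * (real (2 * n) * vol)"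
      unfolding mult.assoc[of "real (2 * n)"] by (intro mult_left_mono 2) simp_all
    also have "\<dots> = 8 * real n * 2 ^ n * vol" by simp
    finally show ?thesis .
  qed
  have "card (cell ` bd) \<le> (\<Sum>j<n. \<Sum>\<sigma>\<in>{1, -1}. card (cell ` C j \<sigma>))"
    unfolding bd_cover image_UN
    by (intro order_trans[OF card_UN_le] sum_mono) auto
  then have "real (card (cell ` bd)) \<le> (\<Sum>j<n. \<Sum>\<sigma>\<in>{1, -1}. real (card (cell ` C j \<sigma>)))"
    by (simp only: of_nat_sum[symmetric] of_nat_le_iff)
  then have "real (card (cell ` bd)) * (\<delta> ^ (n - 1) * w)
      \<le> (\<Sum>j<n. \<Sum>\<sigma>\<in>{1, -1}. real (card (cell ` C j \<sigma>))) * (\<delta> ^ (n - 1) * w)"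
    using \<delta>(1) w by (intro mult_right_mono) auto
  also have "\<dots> = (\<Sum>j<n. \<Sum>\<sigma>\<in>{1, -1}. real (card (cell ` C j \<sigma>)) * (\<delta> ^ (n - 1) * w))"
    by (simp only: sum_distrib_right)
  also have "\<dots> \<le> (\<Sum>j<n. \<Sum>\<sigma>\<in>{1, -1::real}. 8 * real n * 2 ^ n * vol)"
    by (intro sum_mono count) auto
  also have "\<dots> = 16 * (real n)\<^sup>2 * 2 ^ n * vol" by (simp add: power2_eq_square)
  finally show ?count .
qed

text \<open>The cover by the grid cells that meet the boundary. Their diameter \<open>sqrt n * \<delta>\<close> is the source
  of the factor \<open>sqrt n ^ (n - 1)\<close>, the largest loss in the whole argument.\<close>
lemma hausdorff_outer_bd_le:
  assumes n: "n > 0" and w: "w > 0" and chord: "\<forall>j<n. \<exists>x\<in>\<Omega>. x(j := x j + w / 2) \<in> \<Omega>"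
  shows "euclid.hausdorff_outer n (n - 1) bd
    \<le> ennreal (kappa (n - 1) * sqrt n ^ (n - 1) * (16 * (real n)\<^sup>2 * 2 ^ n * vol) / w)"
  unfolding euclid.hausdorff_outer_def
proof (rule SUP_least)
  fix \<delta>' :: real assume "\<delta>' \<in> {0<..}"
  obtain z r where z: "z \<in> \<Omega>" "r > 0"
    "\<forall>y\<in>Rn n. (\<forall>i<n. \<bar>y i - z i\<bar> < r) \<longrightarrow> y \<in> \<Omega>"
    by (rule interior_cube)
  have sq: "sqrt n > 0" using n by simp
  define \<delta> where "\<delta> = min (r / 2) (\<delta>' / sqrt n)"
  have \<delta>: "\<delta> > 0" "2 * \<delta> \<le> r" using z(2) \<open>\<delta>' \<in> {0<..}\<close> sq by (auto simp: \<delta>_def)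
  have "\<delta> * sqrt n \<le> \<delta>' / sqrt n * sqrt n" unfolding \<delta>_def using sq by (intro mult_right_mono) auto
  then have \<delta>\<delta>': "sqrt n * \<delta> \<le> \<delta>'" using sq by (simp add: mult.commute)
  define cell where "cell = (\<lambda>(x::nat \<Rightarrow> real) i. if i < n then \<lfloor>x i / \<delta>\<rfloor> else 0)"
  have fin: "finite (cell ` bd)"
    and count: "real (card (cell ` bd)) * (\<delta> ^ (n - 1) * w) \<le> 16 * (real n)\<^sup>2 * 2 ^ n * vol"
    using grid_count[OF \<delta> w z(1,3) chord cell_def] by auto
  obtain g where g: "bij_betw g {..<card (cell ` bd)} (cell ` bd)"
    using ex_bij_betw_nat_finite[OF fin] by (auto simp: lessThan_atLeast0)
  have "euclid.hausdorff_content n (n - 1) \<delta>' bd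
      \<le> ennreal (real (card (cell ` bd)) * (kappa (n - 1) * (sqrt n * \<delta>) ^ (n - 1)))"
  proof (rule euclid.hausdorff_content_finite_cover[where P = "\<lambda>m. {x \<in> Rn n. cell x = g m}"])
    show "bd \<subseteq> (\<Union>m<card (cell ` bd). {x \<in> Rn n. cell x = g m})"
    proof
      fix x assume x: "x \<in> bd"
      then have "cell x \<in> g ` {..<card (cell ` bd)}" using g by (auto simp: bij_betw_def)
      then show "x \<in> (\<Union>m<card (cell ` bd). {x \<in> Rn n. cell x = g m})" using x bd_Rn by blast
    qed
    show "euclid.ediam n {x \<in> Rn n. cell x = g m} \<le> ennreal (sqrt n * \<delta>)" for m
    proof (rule euclid.ediam_le)
      fix x y assume "x \<in> {x \<in> Rn n. cell x = g m}" "y \<in> {x \<in> Rn n. cell x = g m}"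
      then have eq: "cell x = cell y" by simp
      have "\<bar>x i - y i\<bar> \<le> \<delta>" if i: "i < n" for i
      proof -
        have fl: "\<lfloor>x i / \<delta>\<rfloor> = \<lfloor>y i / \<delta>\<rfloor>" using fun_cong[OF eq, of i] i by (simp add: cell_def)
        have "\<bar>x i / \<delta> - y i / \<delta>\<bar> \<le> 1" using fl unfolding abs_le_iff by linarith
        then have "\<bar>x i - y i\<bar> / \<delta> \<le> 1" using \<delta>(1) by (simp add: diff_divide_distrib[symmetric])
        then show ?thesis using \<delta>(1) by (simp add: pos_divide_le_eq)
      qed
      then have "L2_set (\<lambda>i. \<bar>x i - y i\<bar>) {..<n} \<le> L2_set (\<lambda>i. \<delta>) {..<n}"
        by (intro L2_set_mono) auto
      also have "\<dots> = sqrt n * \<delta>" using \<delta>(1) by (simp add: L2_set_def real_sqrt_mult)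
      finally show "euclid_dist n x y \<le> sqrt n * \<delta>" by (simp add: euclid_dist_def L2_set_def)
    qed
  qed (use \<delta> \<delta>\<delta>' sq in auto)
  also have "real (card (cell ` bd)) * (kappa (n - 1) * (sqrt n * \<delta>) ^ (n - 1))
      = kappa (n - 1) * sqrt n ^ (n - 1) * (real (card (cell ` bd)) * (\<delta> ^ (n - 1) * w)) / w"
    using w by (simp add: power_mult_distrib)
  also have "\<dots> \<le> kappa (n - 1) * sqrt n ^ (n - 1) * (16 * (real n)\<^sup>2 * 2 ^ n * vol) / w"
    using w sq kappa_pos[of "n - 1"] by (intro divide_right_mono mult_left_mono count) auto
  finally show "euclid.hausdorff_content n (n - 1) \<delta>' bd
      \<le> ennreal (kappa (n - 1) * sqrt n ^ (n - 1) * (16 * (real n)\<^sup>2 * 2 ^ n * vol) / w)"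
    by (simp add: ennreal_leI)
qed

end

section \<open>Convex functions on the closure of a convex domain\<close>

text \<open>Induction on the number of coordinates in which a nearby point may differ; it is the midpoint
  of one point with fewer differing coordinates and one that differs in a single coordinate.\<close>
lemma openin_convex_set:
  assumes S: "convex_set S" "S \<subseteq> Rn n"
    and axis: "\<And>x j. x \<in> S \<Longrightarrow> j < n \<Longrightarrow> \<exists>d>0. \<forall>t. \<bar>t\<bar> < d \<longrightarrow> x(j := x j + t) \<in> S"
  shows "openin (Euclidean_space n) S"
proof -
  have "\<exists>d>0. \<forall>y. (\<forall>i<m. \<bar>y i - x i\<bar> < d) \<longrightarrow> (\<forall>i\<ge>m. y i = x i) \<longrightarrow> y \<in> S"
    if x: "x \<in> S" and m: "m \<le> n" for x m
    using m
  proof (induction m)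
    case 0
    show ?case
    proof (intro exI[of _ 1] conjI allI impI)
      fix y assume "\<forall>i\<ge>0. y i = x i"
      then have "y = x" by auto
      then show "y \<in> S" using x by simp
    qed simp
  next
    case (Suc m)
    then obtain d where d: "d > 0"
      "\<And>y. (\<forall>i<m. \<bar>y i - x i\<bar> < d) \<Longrightarrow> (\<forall>i\<ge>m. y i = x i) \<Longrightarrow> y \<in> S"
      by auto
    obtain e where e: "e > 0" "\<And>t. \<bar>t\<bar> < e \<Longrightarrow> x(m := x m + t) \<in> S"
      using axis[OF x, of m] Suc.prems by auto
    show ?case
    proof (intro exI[of _ "min d e / 2"] conjI allI impI)
      show "min d e / 2 > 0" using d(1) e(1) by simp
      fix y assume y: "\<forall>i<Suc m. \<bar>y i - x i\<bar> < min d e / 2" "\<forall>i\<ge>Suc m. y i = x i"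
      have near: "\<bar>2 * (y i - x i)\<bar> < min d e" if "i < Suc m" for i
        using y(1)[rule_format, OF that] unfolding abs_mult abs_numeral by simp
      define y' where "y' i = (if i < m then x i + 2 * (y i - x i) else x i)" for i
      have 1: "y' \<in> S" using near by (intro d(2)) (auto simp: y'_def)
      have 2: "x(m := x m + 2 * (y m - x m)) \<in> S" using near[of m] by (intro e(2)) simp
      have "convex_comb (1/2) y' (x(m := x m + 2 * (y m - x m))) \<in> S"
        by (rule convex_setD[OF S(1) 1 2]) simp_all
      moreover have "convex_comb (1/2) y' (x(m := x m + 2 * (y m - x m))) = y"
      proof
        fix i
        show "convex_comb (1/2) y' (x(m := x m + 2 * (y m - x m))) i = y i"
          using y(2)[rule_format, of i]
          by (cases "i < m"; cases "i = m") (auto simp: convex_comb_def y'_def field_simps)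
      qed
      ultimately show "y \<in> S" by simp
    qed
  qed
  note steps = this
  show ?thesis
    unfolding openin_Rn_iff
  proof (intro conjI ballI S(2))
    fix x assume x: "x \<in> S"
    obtain d where d: "d > 0" "\<And>y. (\<forall>i<n. \<bar>y i - x i\<bar> < d) \<Longrightarrow> (\<forall>i\<ge>n. y i = x i) \<Longrightarrow> y \<in> S"
      using steps[OF x le_refl] by auto
    have "y \<in> S" if "y \<in> Rn n" "\<forall>i<n. \<bar>y i - x i\<bar> < d" for y
      using that x S(2) by (intro d(2)) (auto simp: mem_Rn subset_iff)
    then show "\<exists>r>0. \<forall>y\<in>Rn n. (\<forall>i<n. \<bar>y i - x i\<bar> < r) \<longrightarrow> y \<in> S" using d(1) by blast
  qed
qed

locale convex_domain_fun = convex_domain +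
  fixes f :: "(nat \<Rightarrow> real) \<Rightarrow> real"
  assumes convex_f: "convex_fun_on (Euclidean_space n closure_of \<Omega>) f"
begin

lemma f_convex_comb:
  assumes "x \<in> cl" "y \<in> cl" "0 \<le> t" "t \<le> 1"
  shows "f (convex_comb t x y) \<le> (1 - t) * f x + t * f y"
  using convex_f assms by (auto simp: convex_fun_on_def)

text \<open>Upper semicontinuity on the open domain: on a coordinate line through \<open>x\<close>, convexity bounds \<open>f\<close> near \<open>x\<close>
  by interpolation between \<open>f x\<close> and the values at two fixed points.\<close>
lemma openin_sublevel: "openin (Euclidean_space n) {x \<in> \<Omega>. f x < s}"
proof (rule openin_convex_set)
  show "convex_set {x \<in> \<Omega>. f x < s}"
    unfolding convex_set_def
  proof (intro ballI CollectI conjI)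
    fix x y t assume xy: "x \<in> {x \<in> \<Omega>. f x < s}" "y \<in> {x \<in> \<Omega>. f x < s}" and t: "t \<in> {0..1::real}"
    show "convex_comb t x y \<in> \<Omega>" using xy t by (intro convex_setD[OF domain_convex]) auto
    have "f (convex_comb t x y) \<le> (1 - t) * f x + t * f y"
      using xy t domain_cl by (intro f_convex_comb) auto
    also have "\<dots> < s" using xy t by (intro convex_bound_lt) auto
    finally show "f (convex_comb t x y) < s" .
  qed
  show "{x \<in> \<Omega>. f x < s} \<subseteq> Rn n" using domain_Rn by auto
  fix x j assume "x \<in> {x \<in> \<Omega>. f x < s}" and j: "j < n"
  then have x: "x \<in> \<Omega>" "f x < s" by auto
  have xR: "x \<in> Rn n" using x domain_Rn by auto
  obtain r where r: "r > 0" "\<forall>y\<in>Rn n. (\<forall>i<n. \<bar>y i - x i\<bar> < r) \<longrightarrow> y \<in> \<Omega>"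
    using open_domain x(1) unfolding openin_Rn_iff by blast
  have near: "x(j := x j + t) \<in> \<Omega>" if "\<bar>t\<bar> < r" for t
    using that r(1) by (intro r(2)[rule_format] fun_upd_Rn xR j) simp
  define h where "h = r / 2"
  have h: "h > 0" "h < r" using r(1) by (auto simp: h_def)
  define B where "B = max (f x) (max (f (x(j := x j + h))) (f (x(j := x j + - h)))) + 1"
  have B: "f x < B" "f (x(j := x j + h)) \<le> B" "f (x(j := x j + - h)) \<le> B" by (auto simp: B_def)
  define d where "d = min h (h * ((s - f x) / (B - f x)))"
  have d: "d > 0" "d \<le> h" "d \<le> h * ((s - f x) / (B - f x))"
    using h B(1) x(2) by (auto simp: d_def)
  have "f (x(j := x j + t)) < s" if t: "\<bar>t\<bar> < d" for t
  proof -
    define \<sigma> where "\<sigma> = (if t \<ge> 0 then 1 else -1 :: real)"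
    define l where "l = \<bar>t\<bar> / h"
    have l: "0 \<le> l" "l \<le> 1" "l < (s - f x) / (B - f x)" using t d h
      by (auto simp: l_def pos_divide_le_eq pos_divide_less_eq mult.commute)
    have "\<sigma> * h = h \<or> \<sigma> * h = - h" by (simp add: \<sigma>_def)
    then have \<sigma>h: "x(j := x j + \<sigma> * h) \<in> cl" "f (x(j := x j + \<sigma> * h)) \<le> B"
      using near[of h] near[of "- h"] h B domain_cl by auto
    have "(1 - l) * x j + l * (x j + \<sigma> * h) = x j + t"
      using h by (simp add: l_def \<sigma>_def algebra_simps)
    then have "x(j := x j + t) = convex_comb l (x(j := x j)) (x(j := x j + \<sigma> * h))"
      by (simp only: convex_comb_fun_upd)
    then have "f (x(j := x j + t)) \<le> (1 - l) * f x + l * f (x(j := x j + \<sigma> * h))"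
      using f_convex_comb[of x "x(j := x j + \<sigma> * h)" l] x(1) domain_cl \<sigma>h(1) l by auto
    also have "\<dots> \<le> (1 - l) * f x + l * B" using l \<sigma>h(2) by (intro add_left_mono mult_left_mono) auto
    also have "\<dots> = f x + l * (B - f x)" by (simp add: algebra_simps)
    also have "\<dots> < s" using l(3) B(1) by (simp add: pos_less_divide_eq)
    finally show ?thesis .
  qed
  then show "\<exists>d>0. \<forall>t. \<bar>t\<bar> < d \<longrightarrow> x(j := x j + t) \<in> {x \<in> \<Omega>. f x < s}"
    using near d h by (intro exI[of _ d]) auto
qed

lemma borel_superlevel: "{x \<in> \<Omega>. s < f x} \<in> sets borel"
proof -
  have "{x \<in> \<Omega>. s < f x} = \<Omega> - (\<Inter>m. {x \<in> \<Omega>. f x < s + 1 / real (Suc m)})"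
  proof (intro set_eqI iffI)
    fix x assume x: "x \<in> {x \<in> \<Omega>. s < f x}"
    then obtain m where "1 / real (Suc m) < f x - s" using nat_approx_posE[of "f x - s"] by auto
    then have "x \<notin> {x \<in> \<Omega>. f x < s + 1 / real (Suc m)}" by auto
    then show "x \<in> \<Omega> - (\<Inter>m. {x \<in> \<Omega>. f x < s + 1 / real (Suc m)})" using x by blast
  next
    fix x assume x: "x \<in> \<Omega> - (\<Inter>m. {x \<in> \<Omega>. f x < s + 1 / real (Suc m)})"
    then obtain m where "\<not> f x < s + 1 / real (Suc m)" by blast
    moreover have "1 / real (Suc m) > 0" by simp
    ultimately have "s < f x" by linarith
    then show "x \<in> {x \<in> \<Omega>. s < f x}" using x by blast
  qed
  moreover have "(\<Inter>m. {x \<in> \<Omega>. f x < s + 1 / real (Suc m)}) \<in> sets borel"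
    using borel_openin_Rn[OF openin_sublevel] by (intro sets.countable_INT) auto
  ultimately show ?thesis using borel_domain by (simp only: sets.Diff)
qed

text \<open>The boundary values of \<open>f\<close> may be non-measurable. The functions \<open>minorant z t\<close>, which see \<open>f\<close> only
  on a compact part of the domain, are convex minorants of \<open>f\<close> that approach \<open>f\<close> on the domain as
  \<open>t\<close> tends to \<open>1\<close>. Solving the convexity inequality between \<open>z\<close> and \<open>x\<close> for \<open>f x\<close> gives the
  correction by \<open>f z\<close>.\<close>
definition minorant :: "(nat \<Rightarrow> real) \<Rightarrow> real \<Rightarrow> (nat \<Rightarrow> real) \<Rightarrow> real" where
  "minorant z t x = (f (convex_comb t z x) - (1 - t) * f z) / t"

lemma minorant_le:
  assumes "z \<in> \<Omega>" "x \<in> cl" "0 < t" "t < 1"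
  shows "minorant z t x \<le> f x"
  using f_convex_comb[of z x t] assms domain_cl
  by (auto simp: minorant_def pos_divide_le_eq mult.commute)

lemma minorant_convex_comb:
  assumes z: "z \<in> \<Omega>" and x: "x \<in> cl" "y \<in> cl" and t: "0 < t" "t < 1" and l: "0 \<le> l" "l \<le> 1"
  shows "minorant z t (convex_comb l x y) \<le> (1 - l) * minorant z t x + l * minorant z t y"
proof -
  have "convex_comb t z (convex_comb l x y) = convex_comb l (convex_comb t z x) (convex_comb t z y)"
    by (simp add: convex_comb_def fun_eq_iff algebra_simps)
  moreover have "convex_comb t z x \<in> cl" "convex_comb t z y \<in> cl"
    using convex_comb_domain_cl[OF z] x t domain_cl by auto
  ultimately have "f (convex_comb t z (convex_comb l x y))
      \<le> (1 - l) * f (convex_comb t z x) + l * f (convex_comb t z y)"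
    using f_convex_comb[of "convex_comb t z x" "convex_comb t z y" l] l by simp
  then have "(f (convex_comb t z (convex_comb l x y)) - (1 - t) * f z) / t
      \<le> ((1 - l) * f (convex_comb t z x) + l * f (convex_comb t z y) - (1 - t) * f z) / t"
    using t by (intro divide_right_mono) auto
  also have "\<dots> = (1 - l) * minorant z t x + l * minorant z t y"
    unfolding minorant_def by (simp add: divide_inverse algebra_simps)
  finally show ?thesis by (simp only: minorant_def)
qed

lemma borel_minorant:
  assumes z: "z \<in> \<Omega>" and t: "0 < t" "t < 1"
  shows "{x \<in> cl. s \<le> minorant z t x} \<in> sets borel"
proof -
  define c where "c = s * t + (1 - t) * f z"
  have "(\<lambda>x :: nat \<Rightarrow> real. convex_comb t z x) \<in> borel_measurable borel"
  proof (rule measurable_coordinatewise_then_product)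
    fix i
    have "(\<lambda>x :: nat \<Rightarrow> real. x i) \<in> borel_measurable borel"
      by (intro borel_measurable_continuous_onI continuous_on_product_coordinates)
    then show "(\<lambda>x :: nat \<Rightarrow> real. convex_comb t z x i) \<in> borel_measurable borel"
      
      unfolding convex_comb_def
      by (intro borel_measurable_add borel_measurable_times borel_measurable_const)
  qed
  from measurable_sets[OF this borel_openin_Rn[OF openin_sublevel[of c]]]
  have "convex_comb t z -` {x \<in> \<Omega>. f x < c} \<in> sets borel" by simp
  then have "cl - convex_comb t z -` {x \<in> \<Omega>. f x < c} \<in> sets borel"
    by (rule sets.Diff[OF borel_cl])
  also have "cl - convex_comb t z -` {x \<in> \<Omega>. f x < c} = {x \<in> cl. s \<le> minorant z t x}"
  proof (intro set_eqI)
    fix x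
    have "s \<le> minorant z t x \<longleftrightarrow> \<not> f (convex_comb t z x) < c"
      unfolding minorant_def c_def pos_le_divide_eq[OF t(1)] by linarith
    moreover have "x \<in> cl \<Longrightarrow> convex_comb t z x \<in> \<Omega>"
      using t by (intro convex_comb_domain_cl[OF z]) simp_all
    ultimately show "x \<in> cl - convex_comb t z -` {x \<in> \<Omega>. f x < c} \<longleftrightarrow>
        x \<in> {x \<in> cl. s \<le> minorant z t x}" by blast
  qed
  finally show ?thesis .
qed

text \<open>A sequence in the open unit interval with limit \<open>1\<close>; countably many parameters keep the
  superlevel sets below Borel.\<close>
definition scale :: "nat \<Rightarrow> real" where
  "scale m = 1 - inverse (real (Suc (Suc m)))"

lemma scale: "0 < scale m" "scale m < 1"
  by (simp_all add: scale_def inverse_less_1_iff)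

lemma scale_tendsto: "scale \<longlonglongrightarrow> 1"
proof -
  have "(\<lambda>m. inverse (real (Suc (Suc m)))) \<longlonglongrightarrow> 0"
    by (rule LIMSEQ_Suc[OF LIMSEQ_inverse_real_of_nat])
  from tendsto_diff[OF tendsto_const[of 1] this] show ?thesis by (simp add: scale_def[abs_def])
qed

text \<open>Lower semicontinuity of \<open>f\<close> along the ray from \<open>z\<close> through \<open>x\<close>: the point \<open>x\<close> lies between
  \<open>convex_comb t z x\<close> and a fixed point beyond \<open>x\<close>, with weights that tend to 1 and 0.\<close>
lemma minorant_approx:
  assumes z: "z \<in> \<Omega>" and x: "x \<in> \<Omega>" and s: "s < f x"
  shows "\<exists>m. s < minorant z (scale m) x"
proof (rule ccontr)
  assume "\<not> ?thesis"
  then have small: "minorant z (scale m) x \<le> s" for m by (meson not_le)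
  obtain r where r: "r > 0" "\<forall>y\<in>Rn n. (\<forall>i<n. \<bar>y i - x i\<bar> < r) \<longrightarrow> y \<in> \<Omega>"
    using open_domain x unfolding openin_Rn_iff by blast
  define N where "N = (\<Sum>i<n. \<bar>x i - z i\<bar>)"
  have N: "N \<ge> 0" by (auto simp: N_def intro: sum_nonneg)
  define \<eta> where "\<eta> = r / (N + 1)"
  have \<eta>: "\<eta> > 0" using r N by (simp add: \<eta>_def)
  define y where "y = convex_comb (1 + \<eta>) z x"
  have "y \<in> \<Omega>"
  proof (intro r(2)[rule_format])
    show "y \<in> Rn n" unfolding y_def using x z domain_Rn by (intro convex_comb_Rn) auto
    fix i assume "i < n"
    then have "\<bar>x i - z i\<bar> \<le> N" unfolding N_def by (intro member_le_sum) auto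
    then have "\<eta> * \<bar>x i - z i\<bar> \<le> \<eta> * N" using \<eta> by (intro mult_left_mono) auto
    also have "\<dots> < r" using r N by (simp add: \<eta>_def field_simps)
    also have "\<eta> * \<bar>x i - z i\<bar> = \<bar>y i - x i\<bar>"
    proof -
      have "y i - x i = \<eta> * (x i - z i)" by (simp add: y_def convex_comb_def algebra_simps)
      then show ?thesis using \<eta> by (simp add: abs_mult)
    qed
    finally show "\<bar>y i - x i\<bar> < r" .
  qed
  define \<mu> where "\<mu> m = (1 - scale m) / (1 + \<eta> - scale m)" for m
  have le: "f x \<le> (1 - \<mu> m) * (scale m * s + (1 - scale m) * f z) + \<mu> m * f y" for m
  proof -
    have \<mu>: "0 \<le> \<mu> m" "\<mu> m \<le> 1" "\<mu> m * (1 + \<eta> - scale m) = 1 - scale m"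
      using scale[of m] \<eta> by (auto simp: \<mu>_def)
    have "convex_comb (\<mu> m) (convex_comb (scale m) z x) y = x"
    proof
      fix i
      have "convex_comb (\<mu> m) (convex_comb (scale m) z x) y i
          = z i + (scale m + \<mu> m * (1 + \<eta> - scale m)) * (x i - z i)"
        by (simp add: convex_comb_def y_def algebra_simps)
      then show "convex_comb (\<mu> m) (convex_comb (scale m) z x) y i = x i" unfolding \<mu>(3) by simp
    qed
    moreover have "convex_comb (scale m) z x \<in> cl" "y \<in> cl"
      using convex_comb_domain_cl[OF z, of x "scale m"] x scale[of m] domain_cl \<open>y \<in> \<Omega>\<close> by auto
    ultimately have "f x \<le> (1 - \<mu> m) * f (convex_comb (scale m) z x) + \<mu> m * f y"
      using f_convex_comb[of "convex_comb (scale m) z x" y "\<mu> m"] \<mu> by simp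
    also have "f (convex_comb (scale m) z x) \<le> scale m * s + (1 - scale m) * f z"
      using small[of m] scale[of m] by (simp add: minorant_def pos_divide_le_eq algebra_simps)
    finally show ?thesis using \<mu> by (simp add: mult_left_mono)
  qed
  have "\<mu> \<longlonglongrightarrow> (1 - 1) / (1 + \<eta> - 1)"
    unfolding \<mu>_def[abs_def] using \<eta> by (intro tendsto_intros scale_tendsto) auto
  then have \<mu>0: "\<mu> \<longlonglongrightarrow> 0" by simp
  have "(\<lambda>m. (1 - \<mu> m) * (scale m * s + (1 - scale m) * f z) + \<mu> m * f y)
      \<longlonglongrightarrow> (1 - 0) * (1 * s + (1 - 1) * f z) + 0 * f y"
    by (intro tendsto_intros scale_tendsto \<mu>0)
  then have "f x \<le> (1 - 0) * (1 * s + (1 - 1) * f z) + 0 * f y"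
    by (rule LIMSEQ_le_const) (use le in blast)
  then show False using s by simp
qed

end

section \<open>The inequality on one domain\<close>

context convex_domain
begin

lemma chord_endpoints:
  assumes x: "x \<in> \<Omega>" and i: "i < n"
    and w: "\<forall>x\<in>\<Omega>. \<forall>s. x(i := x i + s) \<in> \<Omega> \<longrightarrow> s \<le> w"
  shows "\<exists>s>0. s \<le> w \<and> x(i := x i + s) \<in> bd"
    and "\<exists>t>0. t \<le> w \<and> x(i := x i - t) \<in> bd"
proof -
  obtain s where s: "s > 0" "x(i := x i + 1 * s) \<in> bd"
    "\<And>u. 0 \<le> u \<Longrightarrow> u < s \<Longrightarrow> x(i := x i + 1 * u) \<in> \<Omega>"
    by (rule exit_point[OF x i, of 1]) auto
  obtain t where t: "t > 0" "x(i := x i + -1 * t) \<in> bd"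
    "\<And>u. 0 \<le> u \<Longrightarrow> u < t \<Longrightarrow> x(i := x i + -1 * u) \<in> \<Omega>"
    by (rule exit_point[OF x i, of "-1"]) auto
  have "s \<le> w"
  proof (rule dense_le)
    fix u assume "u < s"
    show "u \<le> w"
    proof (cases "0 \<le> u")
      case True
      then have "x(i := x i + u) \<in> \<Omega>" using s(3)[of u] \<open>u < s\<close> by simp
      then show ?thesis using w x by blast
    next
      case False
      have "x(i := x i + 0) \<in> \<Omega>" using x by simp
      then have "0 \<le> w" using w x by blast
      then show ?thesis using False by linarith
    qed
  qed
  moreover have "t \<le> w"
  proof (rule dense_le)
    fix u assume "u < t"
    show "u \<le> w"
    proof (cases "0 \<le> u")
      case True
      define y where "y = x(i := x i - u)"
      have "y \<in> \<Omega>" using t(3)[of u] True \<open>u < t\<close> by (simp add: y_def)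
      moreover have "y(i := y i + u) \<in> \<Omega>" using x by (simp add: y_def)
      ultimately show ?thesis using w by blast
    next
      case False
      have "x(i := x i + 0) \<in> \<Omega>" using x by simp
      then have "0 \<le> w" using w x by blast
      then show ?thesis using False by linarith
    qed
  qed
  ultimately show "\<exists>s>0. s \<le> w \<and> x(i := x i + s) \<in> bd" "\<exists>t>0. t \<le> w \<and> x(i := x i - t) \<in> bd"
    using s(1,2) t(1,2) by auto
qed

abbreviation "Hn \<equiv> euclid.hausdorff_measure n n"
abbreviation "Hb \<equiv> euclid.hausdorff_measure n (n - 1)"

lemma emeasure_Hn: "A \<in> sets borel \<Longrightarrow> A \<subseteq> Rn n \<Longrightarrow> emeasure Hn A = euclid.hausdorff_outer n n A"
  by (rule euclid.emeasure_hausdorff_measure[OF borel_sets_hausdorff_measure])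

lemma emeasure_Hb: "A \<in> sets borel \<Longrightarrow> A \<subseteq> Rn n \<Longrightarrow> emeasure Hb A = euclid.hausdorff_outer n (n - 1) A"
  by (rule euclid.emeasure_hausdorff_measure[OF borel_sets_hausdorff_measure])

definition prism_factor :: real where "prism_factor = 2 ^ n * kappa n / kappa (n - 1)"

lemma prism_factor_pos: "prism_factor > 0"
  using kappa_pos[of n] kappa_pos[of "n - 1"] by (simp add: prism_factor_def)

lemma outer_prism:
  assumes "i < n" "A \<subseteq> Rn n" "w > 0"
  shows "euclid.hausdorff_outer n n (prism i a w A)
    \<le> ennreal (prism_factor * w) * euclid.hausdorff_outer n (n - 1) A"
proof -
  have "Suc (n - 1) = n" using assms(1) by simp
  then show ?thesis using hausdorff_outer_prism[OF assms, of "n - 1" a] by (simp add: prism_factor_def)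
qed

lemma vol_le_Hn: "ennreal (kappa n * vol) \<le> 2 ^ n * emeasure Hn \<Omega>"
proof -
  have "ennreal (kappa n * vol) = ennreal (kappa n) * emeasure (leb n) \<Omega>"
    unfolding emeasure_leb_domain
    by (rule ennreal_mult) (use kappa_pos[of n] vol_pos in \<open>simp_all add: less_imp_le\<close>)
  also have "\<dots> \<le> 2 ^ n * euclid.hausdorff_outer n n \<Omega>"
    by (rule leb_le_hausdorff_outer[OF borel_domain domain_Rn])
  finally show ?thesis by (simp only: emeasure_Hn[OF borel_domain domain_Rn])
qed

lemma Hn_pos: "emeasure Hn \<Omega> > 0"
proof (rule ccontr)
  assume "\<not> ?thesis"
  then have "emeasure Hn \<Omega> = 0" by (simp only: not_less le_zero_eq)
  then have "ennreal (kappa n * vol) \<le> 0" using vol_le_Hn by (simp only: mult_zero_right)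
  moreover have "kappa n * vol > 0" using kappa_pos vol_pos by (rule mult_pos_pos)
  ultimately show False by auto
qed

lemma Hn_le_Hb:
  assumes "i < n" "w > 0" "\<forall>x\<in>\<Omega>. \<forall>s. x(i := x i + s) \<in> \<Omega> \<longrightarrow> s \<le> w"
  shows "emeasure Hn \<Omega> \<le> ennreal (prism_factor * w) * emeasure Hb bd"
proof -
  have "\<Omega> \<subseteq> prism i 0 w bd"
  proof
    fix x assume "x \<in> \<Omega>"
    from chord_endpoints(2)[OF this assms(1,3)]
    obtain t where t: "0 < t" "t \<le> w" "x(i := x i - t) \<in> bd" by blast
    have "x = (x(i := x i - t))(i := (x(i := x i - t)) i + t)" by simp
    then show "x \<in> prism i 0 w bd"
      unfolding prism_def using t
      by (intro CollectI exI[of _ "x(i := x i - t)"] exI[of _ t] conjI) simp_all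
  qed
  then have "euclid.hausdorff_outer n n \<Omega> \<le> euclid.hausdorff_outer n n (prism i 0 w bd)"
    by (rule euclid.hausdorff_outer_mono)
  also have "\<dots> \<le> ennreal (prism_factor * w) * euclid.hausdorff_outer n (n - 1) bd"
    by (rule outer_prism[OF assms(1) bd_Rn assms(2)])
  finally show ?thesis
    unfolding emeasure_Hn[OF borel_domain domain_Rn] emeasure_Hb[OF borel_bd bd_Rn] .
qed

lemma Hb_le:
  assumes "n > 0" "w > 0" "\<forall>j<n. \<exists>x\<in>\<Omega>. x(j := x j + w / 2) \<in> \<Omega>"
  shows "emeasure Hb bd
    \<le> ennreal (kappa (n - 1) * sqrt n ^ (n - 1) * (16 * (real n)\<^sup>2 * 2 ^ n * vol) / w)"
  unfolding emeasure_Hb[OF borel_bd bd_Rn] by (rule hausdorff_outer_bd_le[OF assms])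

lemma Hb_finite:
  assumes n: "n > 0"
  shows "emeasure Hb bd < top"
proof -
  obtain i w where w: "w > 0" "\<forall>j<n. \<exists>x\<in>\<Omega>. x(j := x j + w / 2) \<in> \<Omega>"
    by (rule minimal_direction[OF n])
  show ?thesis by (rule le_less_trans[OF Hb_le[OF n w]]) simp
qed

lemma Hn_finite:
  assumes n: "n > 0"
  shows "emeasure Hn \<Omega> < top"
proof -
  obtain i w where "i < n" "w > 0" "\<forall>x\<in>\<Omega>. \<forall>s. x(i := x i + s) \<in> \<Omega> \<longrightarrow> s \<le> w"
    by (rule minimal_direction[OF n])
  from Hn_le_Hb[OF this] show ?thesis
    by (rule le_less_trans) (simp add: ennreal_mult_less_top Hb_finite[OF n, simplified])
qed

lemma Hb_pos: "n > 0 \<Longrightarrow> emeasure Hb bd > 0"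
proof -
  assume n: "n > 0"
  obtain i w where "i < n" "w > 0" "\<forall>x\<in>\<Omega>. \<forall>s. x(i := x i + s) \<in> \<Omega> \<longrightarrow> s \<le> w"
    by (rule minimal_direction[OF n])
  from less_le_trans[OF Hn_pos Hn_le_Hb[OF this]] show ?thesis
    by (auto simp: zero_less_iff_neq_zero)
qed

end

context convex_domain_fun
begin

text \<open>The Borel substitute for the superlevel set of \<open>f\<close> on the boundary.\<close>
definition level :: "(nat \<Rightarrow> real) \<Rightarrow> real \<Rightarrow> (nat \<Rightarrow> real) set" where
  "level z s = {p \<in> bd. \<exists>m. s \<le> minorant z (scale m) p}"

lemma level_bd: "level z s \<subseteq> bd"
  by (auto simp: level_def)

lemma level_le:
  assumes "z \<in> \<Omega>" "p \<in> level z s"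
  shows "s \<le> f p"
proof -
  obtain m where m: "p \<in> cl" "s \<le> minorant z (scale m) p" using assms(2) by (auto simp: level_def bd_eq)
  then show ?thesis using minorant_le[OF assms(1) m(1) scale[of m]] by linarith
qed

lemma borel_level:
  assumes "z \<in> \<Omega>"
  shows "level z s \<in> sets borel"
proof -
  have "level z s = bd \<inter> (\<Union>m. {x \<in> cl. s \<le> minorant z (scale m) x})"
    by (auto simp: level_def bd_eq)
  moreover have "(\<Union>m. {x \<in> cl. s \<le> minorant z (scale m) x}) \<in> sets borel"
    using borel_minorant[OF assms scale] by (intro sets.countable_UN) auto
  ultimately show ?thesis using borel_bd by (simp only: sets.Int)
qed

text \<open>On a chord a convex function is at most the larger of its values at the two endpoints.\<close>
lemma superlevel_subset_prisms:
  assumes z: "z \<in> \<Omega>" and i: "i < n"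
    and w: "\<forall>x\<in>\<Omega>. \<forall>s. x(i := x i + s) \<in> \<Omega> \<longrightarrow> s \<le> w"
  shows "{x \<in> \<Omega>. s < f x} \<subseteq> prism i (- w) w (level z s) \<union> prism i 0 w (level z s)"
proof
  fix x assume "x \<in> {x \<in> \<Omega>. s < f x}"
  then have x: "x \<in> \<Omega>" "s < f x" by auto
  obtain m where m: "s < minorant z (scale m) x" using minorant_approx[OF z x] by blast
  obtain a where "0 < a" "a \<le> w" "x(i := x i + a) \<in> bd"
    using chord_endpoints(1)[OF x(1) i w] by blast
  moreover obtain b where "0 < b" "b \<le> w" "x(i := x i - b) \<in> bd"
    using chord_endpoints(2)[OF x(1) i w] by blast
  ultimately have ab: "0 < a" "a \<le> w" "x(i := x i + a) \<in> bd"
    "0 < b" "b \<le> w" "x(i := x i - b) \<in> bd" by simp_all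
  define p where "p = x(i := x i + a)"
  define q where "q = x(i := x i - b)"
  define l where "l = a / (a + b)"
  have l: "0 \<le> l" "l \<le> 1" using ab by (auto simp: l_def)
  have "(1 - l) * (x i + a) + l * (x i - b) = x i"
  proof -
    have "l * (a + b) = a" using ab by (simp add: l_def)
    then show ?thesis by (simp add: algebra_simps)
  qed
  then have "convex_comb l p q = x" unfolding p_def q_def convex_comb_fun_upd by simp
  then have le: "minorant z (scale m) x \<le> (1 - l) * minorant z (scale m) p + l * minorant z (scale m) q"
    using minorant_convex_comb[OF z, of p q "scale m" l] ab l scale by (simp add: p_def q_def bd_eq)
  have "s \<le> minorant z (scale m) p \<or> s \<le> minorant z (scale m) q"
  proof (rule ccontr)
    assume "\<not> ?thesis"
    then have "(1 - l) * minorant z (scale m) p + l * minorant z (scale m) q < s"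
      using l by (intro convex_bound_lt) auto
    then show False using le m by simp
  qed
  then show "x \<in> prism i (- w) w (level z s) \<union> prism i 0 w (level z s)"
  proof
    assume "s \<le> minorant z (scale m) p"
    then have "p \<in> level z s" using ab by (auto simp: level_def p_def)
    moreover have "x = p(i := p i + - a)" by (simp add: p_def)
    ultimately show ?thesis
      unfolding prism_def using ab by (intro UnI1 CollectI exI[of _ p] exI[of _ "- a"]) auto
  next
    assume "s \<le> minorant z (scale m) q"
    then have "q \<in> level z s" using ab by (auto simp: level_def q_def)
    moreover have "x = q(i := q i + b)" by (simp add: q_def)
    ultimately show ?thesis
      unfolding prism_def using ab by (intro UnI2 CollectI exI[of _ q] exI[of _ b]) auto
  qed
qed

lemma emeasure_superlevel_le:
  assumes z: "z \<in> \<Omega>" and i: "i < n" and w0: "w > 0"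
    and w: "\<forall>x\<in>\<Omega>. \<forall>s. x(i := x i + s) \<in> \<Omega> \<longrightarrow> s \<le> w"
  shows "emeasure Hn {x \<in> \<Omega>. s < f x} \<le> ennreal (2 * prism_factor * w) * emeasure Hb (level z s)"
proof -
  have lR: "level z s \<subseteq> Rn n" using level_bd bd_Rn by (rule order_trans)
  have "euclid.hausdorff_outer n n {x \<in> \<Omega>. s < f x}
      \<le> euclid.hausdorff_outer n n (prism i (- w) w (level z s) \<union> prism i 0 w (level z s))"
    by (rule euclid.hausdorff_outer_mono[OF superlevel_subset_prisms[OF z i w]])
  also have "\<dots> \<le> euclid.hausdorff_outer n n (prism i (- w) w (level z s))
      + euclid.hausdorff_outer n n (prism i 0 w (level z s))"
    by (rule euclid.hausdorff_outer_Un)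
  also have "\<dots> \<le> ennreal (prism_factor * w) * euclid.hausdorff_outer n (n - 1) (level z s)
      + ennreal (prism_factor * w) * euclid.hausdorff_outer n (n - 1) (level z s)"
    by (intro add_mono outer_prism i lR w0)
  also have "\<dots> = ennreal (2 * prism_factor * w) * euclid.hausdorff_outer n (n - 1) (level z s)"
    using prism_factor_pos w0 by (simp add: distrib_right[symmetric] ennreal_plus[symmetric] del: ennreal_plus)
  finally have "euclid.hausdorff_outer n n {x \<in> \<Omega>. s < f x}
      \<le> ennreal (2 * prism_factor * w) * euclid.hausdorff_outer n (n - 1) (level z s)" .
  moreover have "{x \<in> \<Omega>. s < f x} \<subseteq> Rn n" using domain_Rn by blast
  ultimately show ?thesis
    by (simp only: emeasure_Hn[OF borel_superlevel] emeasure_Hb[OF borel_level[OF z] lR])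
qed

text \<open>Layer-cake summation in steps of height \<open>e\<close>. On the boundary the Borel sets
  \<open>level z s\<close> form a measurable step function below \<open>f\<close>; the error \<open>e |\<Omega>|\<close> on the domain
  vanishes in the limit.\<close>
lemma nn_integral_domain_le:
  assumes n: "n > 0" and i: "i < n" and w0: "w > 0"
    and w: "\<forall>x\<in>\<Omega>. \<forall>s. x(i := x i + s) \<in> \<Omega> \<longrightarrow> s \<le> w"
  shows "(\<integral>\<^sup>+x\<in>\<Omega>. ennreal (f x) \<partial>Hn) \<le> ennreal (2 * prism_factor * w) * (\<integral>\<^sup>+x\<in>bd. ennreal (f x) \<partial>Hb)"
proof -
  obtain z where z: "z \<in> \<Omega>" using nonempty by blast
  let ?I = "\<integral>\<^sup>+x\<in>\<Omega>. ennreal (f x) \<partial>Hn"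
  let ?J = "\<integral>\<^sup>+x\<in>bd. ennreal (f x) \<partial>Hb"
  have layer: "?I \<le> ennreal e * emeasure Hn \<Omega> + ennreal (2 * prism_factor * w) * ?J" if e: "e > 0" for e
  proof -
    define E where "E k = {x \<in> \<Omega>. real (Suc k) * e < f x}" for k
    define L where "L k = level z (real (Suc k) * e)" for k
    have E[measurable]: "E k \<in> sets Hn" for k
      unfolding E_def using domain_Rn by (intro borel_sets_hausdorff_measure borel_superlevel) auto
    have L[measurable]: "L k \<in> sets Hb" for k
      unfolding L_def using level_bd bd_Rn by (intro borel_sets_hausdorff_measure borel_level z) blast
    have dom[measurable]: "\<Omega> \<in> sets Hn" by (rule borel_sets_hausdorff_measure[OF borel_domain domain_Rn])
    have "ennreal (f x) * indicator \<Omega> x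
        \<le> ennreal e * indicator \<Omega> x + (\<Sum>k. ennreal e * indicator (E k) x)" for x
    proof (cases "x \<in> \<Omega> \<and> 0 < f x")
      case True
      define M where "M = nat (\<lceil>f x / e\<rceil> - 1)"
      have fe: "f x / e > 0" using True e by simp
      have M: "real M < f x / e" "f x / e \<le> real M + 1"
        using fe unfolding M_def by linarith+
      have "x \<in> E k" if "k < M" for k
      proof -
        have "real (Suc k) \<le> real M" using that by simp
        then have "real (Suc k) < f x / e" using M(1) by linarith
        then show ?thesis using True e by (simp add: E_def pos_less_divide_eq)
      qed
      then have "(\<Sum>k<M. ennreal e) = (\<Sum>k<M. ennreal e * indicator (E k) x)"
        by (intro sum.cong) auto
      also have "\<dots> \<le> (\<Sum>k. ennreal e * indicator (E k) x)"
        by (intro sum_le_suminf) auto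
      finally have "ennreal e + (\<Sum>k<M. ennreal e)
          \<le> ennreal e * indicator \<Omega> x + (\<Sum>k. ennreal e * indicator (E k) x)"
        using True by (simp add: add_left_mono)
      moreover have "ennreal (f x) \<le> ennreal e + (\<Sum>k<M. ennreal e)"
      proof -
        have "f x \<le> (real M + 1) * e" using M(2) e by (simp add: pos_divide_le_eq)
        then have "f x \<le> e + real M * e" by (simp add: algebra_simps)
        then have "ennreal (f x) \<le> ennreal (e + real M * e)" by (rule ennreal_leI)
        also have "\<dots> = ennreal e + (\<Sum>k<M. ennreal e)"
          using e by (simp add: ennreal_plus ennreal_mult ennreal_of_nat_eq_real_of_nat)
        finally show ?thesis .
      qed
      ultimately have "ennreal (f x) \<le> ennreal e * indicator \<Omega> x + (\<Sum>k. ennreal e * indicator (E k) x)"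
        by (rule order_trans[rotated])
      moreover have "ennreal (f x) * indicator \<Omega> x = ennreal (f x)" using True by simp
      ultimately show ?thesis by (simp only:)
    next
      case False
      then have "ennreal (f x) * indicator \<Omega> x = 0" by (auto simp: ennreal_neg indicator_def)
      then show ?thesis by (simp only: zero_le)
    qed
    then have "?I \<le> (\<integral>\<^sup>+x. ennreal e * indicator \<Omega> x + (\<Sum>k. ennreal e * indicator (E k) x) \<partial>Hn)"
      by (intro nn_integral_mono)
    also have "\<dots> = ennreal e * emeasure Hn \<Omega> + (\<Sum>k. ennreal e * emeasure Hn (E k))"
    proof -
      have "(\<integral>\<^sup>+x. ennreal e * indicator \<Omega> x + (\<Sum>k. ennreal e * indicator (E k) x) \<partial>Hn)
          = (\<integral>\<^sup>+x. ennreal e * indicator \<Omega> x \<partial>Hn)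
            + (\<integral>\<^sup>+x. (\<Sum>k. ennreal e * indicator (E k) x) \<partial>Hn)"
        by (rule nn_integral_add) measurable
      also have "(\<integral>\<^sup>+x. (\<Sum>k. ennreal e * indicator (E k) x) \<partial>Hn)
          = (\<Sum>k. \<integral>\<^sup>+x. ennreal e * indicator (E k) x \<partial>Hn)"
        by (rule nn_integral_suminf) measurable
      finally show ?thesis by (simp only: nn_integral_cmult_indicator E dom)
    qed
    also have "\<dots> \<le> ennreal e * emeasure Hn \<Omega>
        + (\<Sum>k. ennreal e * (ennreal (2 * prism_factor * w) * emeasure Hb (L k)))"
      unfolding E_def L_def
      by (intro add_left_mono suminf_le mult_left_mono emeasure_superlevel_le[OF z i w0 w]) auto
    also have "(\<Sum>k. ennreal e * (ennreal (2 * prism_factor * w) * emeasure Hb (L k)))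
        = ennreal (2 * prism_factor * w) * (\<Sum>k. ennreal e * emeasure Hb (L k))"
      by (simp only: ennreal_suminf_cmult mult.left_commute[of "ennreal e"])
    also have "(\<Sum>k. ennreal e * emeasure Hb (L k)) = (\<integral>\<^sup>+x. (\<Sum>k. ennreal e * indicator (L k) x) \<partial>Hb)"
    proof -
      have "(\<integral>\<^sup>+x. (\<Sum>k. ennreal e * indicator (L k) x) \<partial>Hb)
          = (\<Sum>k. \<integral>\<^sup>+x. ennreal e * indicator (L k) x \<partial>Hb)"
        by (rule nn_integral_suminf) measurable
      then show ?thesis by (simp only: nn_integral_cmult_indicator L)
    qed
    also have "\<dots> \<le> ?J"
    proof (intro nn_integral_mono suminf_le_const)
      fix x m
      show "(\<Sum>k<m. ennreal e * indicator (L k) x) \<le> ennreal (f x) * indicator bd x"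
      proof (cases "x \<in> bd")
        case True
        define S where "S = {k \<in> {..<m}. x \<in> L k}"
        have "(\<Sum>k<m. ennreal e * indicator (L k) x) = (\<Sum>k\<in>S. ennreal e)"
          unfolding S_def by (rule sum.mono_neutral_cong_right) auto
        also have "\<dots> = ennreal (real (card S) * e)"
          using e by (simp add: ennreal_mult ennreal_of_nat_eq_real_of_nat)
        also have "\<dots> \<le> ennreal (f x)"
        proof (cases "S = {}")
          case False
          have fin: "finite S" by (simp add: S_def)
          have "Max S \<in> S" using fin False by (rule Max_in)
          then have "real (Suc (Max S)) * e \<le> f x"
            using level_le[OF z] by (auto simp: S_def L_def)
          moreover have "S \<subseteq> {..Max S}" using fin by auto
          then have "card S \<le> Suc (Max S)" using card_mono[of "{..Max S}" S] by simp
          then have "real (card S) * e \<le> real (Suc (Max S)) * e"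
            using e by (intro mult_right_mono) auto
          ultimately show ?thesis by (intro ennreal_leI) linarith
        qed simp
        finally show ?thesis using True by simp
      next
        case False
        then have "x \<notin> L k" for k using level_bd by (auto simp: L_def)
        then show ?thesis by simp
      qed
    qed auto
    finally show ?thesis by (simp add: mult_left_mono add_left_mono)
  qed
  show ?thesis
  proof (rule ennreal_le_epsilon)
    fix e' :: real assume e': "e' > 0"
    define h where "h = enn2real (emeasure Hn \<Omega>)"
    have h: "emeasure Hn \<Omega> = ennreal h" "h \<ge> 0" using Hn_finite[OF n] by (simp_all add: h_def)
    have "ennreal (e' / (h + 1)) * emeasure Hn \<Omega> \<le> ennreal e'"
      unfolding h(1) using h(2) e'
      by (subst ennreal_mult[symmetric]) (auto intro!: ennreal_leI simp: pos_divide_le_eq mult_left_mono)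
    moreover have "?I \<le> ennreal (e' / (h + 1)) * emeasure Hn \<Omega> + ennreal (2 * prism_factor * w) * ?J"
      using h(2) e' by (intro layer) simp
    ultimately have "?I \<le> ennreal e' + ennreal (2 * prism_factor * w) * ?J"
      by (rule order_trans[OF _ add_right_mono, rotated])
    then show "?I \<le> ennreal (2 * prism_factor * w) * ?J + ennreal e'" by (simp only: add.commute)
  qed
qed

end

section \<open>The constant\<close>

text \<open>The factor \<open>8 ^ n\<close> collects the losses \<open>2 ^ n\<close> of the prism estimate, of the column count and
  of the comparison between volume and Hausdorff measure.\<close>
definition hh_upper :: "nat \<Rightarrow> real" where
  "hh_upper n = 32 * (real n)\<^sup>2 * 8 ^ n * sqrt n ^ (n - 1)"

lemma hh_upper_le_power:
  assumes n: "n \<ge> 1024"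
  shows "hh_upper n \<le> real n ^ (n + 1)"
proof -
  define k where "k = n - 2"
  have k: "n = Suc (Suc k)" "k \<ge> 3" using n by (simp_all add: k_def)
  have s32: "sqrt n \<ge> 32" using n by (intro real_le_rsqrt) simp
  have "32 * 8 ^ n = (32 :: real) * (64 * 8 ^ k)" by (simp add: k(1))
  also have "(64 :: real) * 8 ^ k \<le> 32 ^ k"
  proof -
    have "(64 :: real) = 4 ^ 3" by simp
    also have "\<dots> \<le> 4 ^ k" using k(2) by (intro power_increasing) auto
    finally have "(64 :: real) * 8 ^ k \<le> 4 ^ k * 8 ^ k" by (intro mult_right_mono) auto
    then show ?thesis by (simp add: power_mult_distrib[symmetric])
  qed
  finally have "32 * 8 ^ n \<le> (32 :: real) ^ (n - 1)" by (simp add: k(1))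
  also have "\<dots> \<le> sqrt n ^ (n - 1)" using s32 by (intro power_mono) auto
  finally have *: "32 * 8 ^ n \<le> sqrt n ^ (n - 1)" .
  have "hh_upper n = (real n)\<^sup>2 * ((32 * 8 ^ n) * sqrt n ^ (n - 1))" by (simp add: hh_upper_def)
  also have "\<dots> \<le> (real n)\<^sup>2 * (sqrt n ^ (n - 1) * sqrt n ^ (n - 1))"
    by (intro mult_left_mono mult_right_mono *) auto
  also have "sqrt n ^ (n - 1) * sqrt n ^ (n - 1) = real n ^ (n - 1)"
    by (simp add: power_mult_distrib[symmetric])
  also have "(real n)\<^sup>2 * real n ^ (n - 1) = real n ^ (n + 1)"
    by (simp add: k(1) power2_eq_square)
  finally show ?thesis .
qed

text \<open>The constants of the two comparisons of boundary and volume combine; in the product the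
  normalizing factors \<open>kappa\<close> and the length \<open>w\<close> cancel.\<close>
lemma (in convex_domain_fun) nn_integral_domain_le_hh_upper:
  assumes n: "n > 0"
  shows "(\<integral>\<^sup>+x\<in>\<Omega>. ennreal (f x) \<partial>Hn) * emeasure Hb bd
    \<le> ennreal (hh_upper n) * emeasure Hn \<Omega> * (\<integral>\<^sup>+x\<in>bd. ennreal (f x) \<partial>Hb)"
proof -
  let ?J = "\<integral>\<^sup>+x\<in>bd. ennreal (f x) \<partial>Hb"
  obtain i w where i: "i < n" and w: "w > 0"
    and chord_le: "\<forall>x\<in>\<Omega>. \<forall>s. x(i := x i + s) \<in> \<Omega> \<longrightarrow> s \<le> w"
    and chord_ge: "\<forall>j<n. \<exists>x\<in>\<Omega>. x(j := x j + w / 2) \<in> \<Omega>"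
    by (rule minimal_direction[OF n])
  define h where "h = enn2real (emeasure Hn \<Omega>)"
  have h: "emeasure Hn \<Omega> = ennreal h" "h \<ge> 0" using Hn_finite[OF n] by (simp_all add: h_def)
  define b where "b = kappa (n - 1) * sqrt n ^ (n - 1) * (16 * (real n)\<^sup>2 * 2 ^ n)"
  have b: "b \<ge> 0" using kappa_pos[of "n - 1"] by (simp add: b_def)
  have two: "(2::ennreal) ^ n = ennreal (2 ^ n)" by (simp add: ennreal_power[symmetric])
  have "ennreal (kappa n * vol) \<le> ennreal (2 ^ n * h)"
    using vol_le_Hn h(2) unfolding h(1) two by (simp only: ennreal_mult zero_le_power zero_le_numeral)
  then have vol: "vol \<le> 2 ^ n * h / kappa n"
    using h(2) kappa_pos[of n] by (simp add: pos_le_divide_eq mult.commute)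
  have "2 * prism_factor * w * (b * vol / w) = 2 * prism_factor * b * vol" using w by simp
  also have "\<dots> \<le> 2 * prism_factor * b * (2 ^ n * h / kappa n)"
    using vol b prism_factor_pos by (intro mult_left_mono) auto
  also have "\<dots> = hh_upper n * h"
  proof -
    have "(8::real) ^ n = 2 ^ n * 2 ^ n * 2 ^ n" by (simp add: power_mult_distrib[symmetric])
    then show ?thesis using kappa_pos[of n] kappa_pos[of "n - 1"]
      by (simp add: prism_factor_def b_def hh_upper_def)
  qed
  finally have const: "2 * prism_factor * w * (b * vol / w) \<le> hh_upper n * h" .
  have "(\<integral>\<^sup>+x\<in>\<Omega>. ennreal (f x) \<partial>Hn) * emeasure Hb bd
      \<le> (ennreal (2 * prism_factor * w) * ?J) * ennreal (b * vol / w)"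
  proof (rule mult_mono)
    show "(\<integral>\<^sup>+x\<in>\<Omega>. ennreal (f x) \<partial>Hn) \<le> ennreal (2 * prism_factor * w) * ?J"
      by (rule nn_integral_domain_le[OF n i w chord_le])
    show "emeasure Hb bd \<le> ennreal (b * vol / w)"
      using Hb_le[OF n w chord_ge] by (simp only: b_def mult.assoc)
  qed simp_all
  also have "\<dots> = ennreal (2 * prism_factor * w * (b * vol / w)) * ?J"
  proof -
    have "ennreal (2 * prism_factor * w * (b * vol / w)) = ennreal (2 * prism_factor * w) * ennreal (b * vol / w)"
      using prism_factor_pos w b vol_pos by (intro ennreal_mult) auto
    then show ?thesis by (simp only: mult_ac)
  qed
  also have "\<dots> \<le> ennreal (hh_upper n * h) * ?J"
    by (intro mult_right_mono ennreal_leI const) simp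
  also have "ennreal (hh_upper n * h) = ennreal (hh_upper n) * emeasure Hn \<Omega>"
    unfolding h(1) using h(2) by (intro ennreal_mult) (auto simp: hh_upper_def)
  finally show ?thesis .
qed

lemma ext_integral_le: "ext_integral M A f \<le> enn2ereal (\<integral>\<^sup>+x\<in>A. ennreal (f x) \<partial>M)"
proof -
  have "enn2ereal (\<integral>\<^sup>+x\<in>A. ennreal (f x) \<partial>M) - enn2ereal (\<integral>\<^sup>+x\<in>A. ennreal (- f x) \<partial>M)
      \<le> enn2ereal (\<integral>\<^sup>+x\<in>A. ennreal (f x) \<partial>M) - 0"
    by (intro ereal_minus_mono order_refl enn2ereal_nonneg)
  then show ?thesis by (simp add: ext_integral_def)
qed

lemma ext_integral_nonneg:
  assumes "\<forall>x\<in>A. 0 \<le> f x"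
  shows "ext_integral M A f = enn2ereal (\<integral>\<^sup>+x\<in>A. ennreal (f x) \<partial>M)"
proof -
  have "(\<integral>\<^sup>+x\<in>A. ennreal (- f x) \<partial>M) = (\<integral>\<^sup>+x. 0 \<partial>M)"
    using assms by (intro nn_integral_cong) (auto simp: indicator_def ennreal_neg)
  then show ?thesis by (simp add: ext_integral_def zero_ennreal.rep_eq)
qed

lemma hermite_hadamard_bound_hh_upper:
  assumes n: "n > 0"
  shows "hermite_hadamard_bound n (hh_upper n)"
  unfolding hermite_hadamard_bound_def
proof (intro allI impI)
  fix \<Omega> f
  assume dom: "bounded_convex_domain n \<Omega>" and f: "convex_fun_on (Euclidean_space n closure_of \<Omega>) f"
    and f0: "\<forall>x\<in>Euclidean_space n frontier_of \<Omega>. 0 \<le> f x"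
  interpret convex_domain_fun n \<Omega> f by unfold_locales (rule dom, rule f)
  let ?J = "\<integral>\<^sup>+x\<in>bd. ennreal (f x) \<partial>Hb"
  let ?I = "\<integral>\<^sup>+x\<in>\<Omega>. ennreal (f x) \<partial>Hn"
  define C where "C = hh_upper n"
  have C: "C > 0" using n by (simp add: C_def hh_upper_def)
  obtain h where h: "emeasure Hn \<Omega> = ennreal h" "h > 0"
    using Hn_finite[OF n] Hn_pos by (cases "emeasure Hn \<Omega>") auto
  obtain p where p: "emeasure Hb bd = ennreal p" "p > 0"
    using Hb_finite[OF n] Hb_pos[OF n] by (cases "emeasure Hb bd") auto
  have main: "?I * ennreal p \<le> ennreal C * ennreal h * ?J"
    using nn_integral_domain_le_hh_upper[OF n] unfolding h p C_def .
  have "1 / enn2ereal (ennreal h) * ext_integral Hn \<Omega> f \<le> ereal C / enn2ereal (ennreal p) * enn2ereal ?J"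
  proof (cases "?J = top")
    case True
    then show ?thesis using C p(2) by (simp add: top_ereal_def)
  next
    case False
    then obtain j where j: "?J = ennreal j" "j \<ge> 0" by (cases ?J) auto
    have "?I \<noteq> top"
    proof
      assume "?I = top"
      then have "ennreal C * ennreal h * ?J = top" using main p(2) by (simp add: ennreal_top_mult top.extremum_unique)
      then show False unfolding j(1) by (simp add: ennreal_mult_eq_top_iff)
    qed
    then obtain i where i: "?I = ennreal i" "i \<ge> 0" by (cases ?I) auto
    have "ennreal (i * p) \<le> ennreal (C * h * j)"
      using main i j p C h by (simp add: ennreal_mult[symmetric])
    then have "i * p \<le> C * h * j" using C h j by simp
    then have "1 / h * i \<le> C / p * j" using h(2) p(2) by (simp add: field_simps)
    have "1 / enn2ereal (ennreal h) * ext_integral Hn \<Omega> f \<le> 1 / enn2ereal (ennreal h) * enn2ereal ?I"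
      using h(2) by (intro ereal_mult_left_mono ext_integral_le) simp
    also have "\<dots> = ereal (1 / h * i)" using h(2) i by (simp add: one_ereal_def)
    also have "\<dots> \<le> ereal (C / p * j)" using \<open>1 / h * i \<le> C / p * j\<close> by simp
    also have "\<dots> = ereal C / enn2ereal (ennreal p) * enn2ereal ?J" using p(2) j by simp
    finally show ?thesis .
  qed
  then show "1 / enn2ereal (emeasure Hn \<Omega>) * ext_integral Hn \<Omega> f
      \<le> ereal (hh_upper n) / enn2ereal (emeasure Hb bd) * ext_integral Hb bd f"
    unfolding ext_integral_nonneg[OF f0] h p C_def .
qed

lemma bounded_convex_domain_cube:
  "bounded_convex_domain n {x \<in> Rn n. \<forall>i<n. \<bar>x i - 0\<bar> < 1}" (is "bounded_convex_domain n ?Q")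
  unfolding bounded_convex_domain_def
proof (intro conjI)
  have 0: "(\<lambda>_. 0) \<in> Rn n" by (simp add: mem_Rn)
  show "?Q \<noteq> {}" using 0 by (auto intro!: exI[of _ "\<lambda>_. 0"])
  show "openin (Euclidean_space n) ?Q"
    using openin_Rn_cubes[OF _ 0, of 1] by simp
  have Q: "?Q = Pi\<^sub>E UNIV (\<lambda>i. if i < n then {-1<..<1} else {0})"
  proof (intro set_eqI iffI)
    fix x assume "x \<in> ?Q"
    then show "x \<in> Pi\<^sub>E UNIV (\<lambda>i. if i < n then {-1<..<1} else {0})"
      by (auto simp: PiE_UNIV_domain mem_Rn abs_less_iff)
  next
    fix x :: "nat \<Rightarrow> real" assume x: "x \<in> Pi\<^sub>E UNIV (\<lambda>i. if i < n then {-1<..<1} else {0})"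
    have "x i \<in> (if i < n then {-1<..<1} else {0})" for i using PiE_mem[OF x, of i] by simp
    note coord = this
    have "\<bar>x i - 0\<bar> < 1" if "i < n" for i using coord[of i] that by (auto simp: abs_less_iff)
    moreover have "x i = 0" if "i \<ge> n" for i using coord[of i] that by simp
    ultimately show "x \<in> ?Q" by (simp add: mem_Rn)
  qed
  have "connectedin (powertop_real UNIV) ?Q"
    unfolding Q connectedin_PiE by (auto simp: connectedin_iff_connected)
  then show "connectedin (Euclidean_space n) ?Q"
    by (auto simp: Euclidean_space_def connectedin_subtopology mem_Rn)
  show "euclid.mbounded n ?Q"
    unfolding euclid.mbounded_def
  proof (intro exI subsetI)
    fix x assume x: "x \<in> ?Q"
    have "euclid_dist n (\<lambda>_. 0) x \<le> (\<Sum>i<n. \<bar>0 - x i\<bar>)"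
      unfolding euclid_dist_def by (rule L2_set_le_sum_abs)
    also have "\<dots> \<le> (\<Sum>i<n. 1)" using x by (intro sum_mono) auto
    finally show "x \<in> euclid.mcball n (\<lambda>_. 0) (real n)" using x 0 by simp
  qed
  show "convex_set ?Q"
    unfolding convex_set_def
  proof (intro ballI CollectI conjI allI impI)
    fix x y t assume xy: "x \<in> ?Q" "y \<in> ?Q" and t: "t \<in> {0..1::real}"
    show "convex_comb t x y \<in> Rn n" using xy by (intro convex_comb_Rn) auto
    fix i assume i: "i < n"
    have "\<bar>convex_comb t x y i - 0\<bar> \<le> (1 - t) * \<bar>x i\<bar> + t * \<bar>y i\<bar>"
      using t unfolding convex_comb_def diff_0_right
      by (intro order_trans[OF abs_triangle_ineq]) (simp add: abs_mult)
    also have "\<dots> < 1" using xy t i by (intro convex_bound_lt) auto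
    finally show "\<bar>convex_comb t x y i - 0\<bar> < 1" .
  qed
qed

text \<open>Constant functions show that the admissible constants are at least 1.\<close>
lemma hermite_hadamard_bound_ge_1:
  assumes n: "n > 0" and c: "hermite_hadamard_bound n c"
  shows "1 \<le> c"
proof -
  define \<Omega> where "\<Omega> = {x \<in> Rn n. \<forall>i<n. \<bar>x i - 0\<bar> < 1}"
  interpret convex_domain n \<Omega>
    by unfold_locales (simp only: \<Omega>_def bounded_convex_domain_cube)
  obtain h where h: "emeasure Hn \<Omega> = ennreal h" "h > 0"
    using Hn_finite[OF n] Hn_pos by (cases "emeasure Hn \<Omega>") auto
  obtain p where p: "emeasure Hb bd = ennreal p" "p > 0"
    using Hb_finite[OF n] Hb_pos[OF n] by (cases "emeasure Hb bd") auto
  have "convex_fun_on cl (\<lambda>_. 1)"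
    using convex_cl by (simp add: convex_fun_on_def)
  then have le: "1 / enn2ereal (emeasure Hn \<Omega>) * ext_integral Hn \<Omega> (\<lambda>_. 1)
      \<le> ereal c / enn2ereal (emeasure Hb bd) * ext_integral Hb bd (\<lambda>_. 1)"
    using c domain unfolding hermite_hadamard_bound_def by simp
  have "ext_integral Hn \<Omega> (\<lambda>_. 1) = ereal h" "ext_integral Hb bd (\<lambda>_. 1) = ereal p"
    using h p borel_sets_hausdorff_measure[OF borel_domain domain_Rn]
      borel_sets_hausdorff_measure[OF borel_bd bd_Rn]
    by (simp_all add: ext_integral_nonneg)
  then show ?thesis using le h p by (simp add: one_ereal_def)
qed

text \<open>The admissible constants form a closed set, hence the least one exists.\<close>
lemma hermite_hadamard_const_le:
  assumes n: "n > 0" and c: "hermite_hadamard_bound n c"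
  shows "hermite_hadamard_const n \<le> c"
proof -
  define S where "S = {c. hermite_hadamard_bound n c}"
  have S: "c \<in> S" "\<And>x. x \<in> S \<Longrightarrow> 1 \<le> x"
    using c hermite_hadamard_bound_ge_1[OF n] by (auto simp: S_def)
  have bdd: "bdd_below S" by (rule bdd_belowI[of _ 1]) (rule S(2))
  have Inf1: "1 \<le> Inf S" using S by (intro cInf_greatest) auto
  have "hermite_hadamard_bound n (Inf S)"
    unfolding hermite_hadamard_bound_def
  proof (intro allI impI)
    fix \<Omega> f
    assume as: "bounded_convex_domain n \<Omega>" "convex_fun_on (Euclidean_space n closure_of \<Omega>) f"
      "\<forall>x\<in>Euclidean_space n frontier_of \<Omega>. 0 \<le> f x"
    let ?Hb = "euclid.hausdorff_measure n (n - 1)"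
    let ?bd = "Euclidean_space n frontier_of \<Omega>"
    define A where "A = 1 / enn2ereal (emeasure (euclid.hausdorff_measure n n) \<Omega>) *
      ext_integral (euclid.hausdorff_measure n n) \<Omega> f"
    define P where "P = enn2ereal (emeasure ?Hb ?bd)"
    define J where "J = ext_integral ?Hb ?bd f"
    define Y where "Y = inverse P * J"
    have "P \<ge> 0" "J \<ge> 0" by (simp_all add: P_def J_def ext_integral_nonneg[OF as(3)])
    then have Y: "Y \<ge> 0" unfolding Y_def by (cases P) (auto simp: ereal_inverse_nonneg_iff)
    have eq: "ereal x / P * J = ereal x * Y" for x
      by (simp add: Y_def divide_ereal_def mult.assoc)
    have le: "A \<le> ereal x * Y" if "x \<in> S" for x
    proof -
      have "hermite_hadamard_bound n x" using that by (simp add: S_def)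
      then show ?thesis
        unfolding eq[symmetric] A_def P_def J_def hermite_hadamard_bound_def using as by blast
    qed
    have "A \<le> ereal (Inf S) * Y"
    proof (cases Y)
      case PInf
      then show ?thesis using Inf1 by simp
    next
      case MInf
      then show ?thesis using Y by simp
    next
      case (real y)
      then have y: "y \<ge> 0" using Y by simp
      show ?thesis
      proof (cases A)
        case (real a)
        have "a \<le> x * y" if "x \<in> S" for x using le[OF that] \<open>Y = ereal y\<close> real by simp
        then have "a \<le> Inf S * y"
        proof (cases "y = 0")
          case False
          then have y0: "y > 0" using y by simp
          assume *: "\<And>x. x \<in> S \<Longrightarrow> a \<le> x * y"
          have "a / y \<le> Inf S"
            using S(1) * y0 by (intro cInf_greatest) (auto simp: pos_divide_le_eq)
          then show ?thesis using y0 by (simp add: pos_divide_le_eq)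
        next
          case True
          assume *: "\<And>x. x \<in> S \<Longrightarrow> a \<le> x * y"
          show ?thesis using *[OF S(1)] True by simp
        qed
        then show ?thesis using real \<open>Y = ereal y\<close> by simp
      next
        case PInf
        then show ?thesis using le[OF S(1)] \<open>Y = ereal y\<close> by simp
      next
        case MInf
        then show ?thesis by simp
      qed
    qed
    then show "1 / enn2ereal (emeasure (euclid.hausdorff_measure n n) \<Omega>) *
        ext_integral (euclid.hausdorff_measure n n) \<Omega> f
      \<le> ereal (Inf S) / enn2ereal (emeasure ?Hb ?bd) * ext_integral ?Hb ?bd f"
      unfolding A_def[symmetric] P_def[symmetric] J_def[symmetric] eq .
  qed
  then have "hermite_hadamard_const n = Inf S"
    unfolding hermite_hadamard_const_def
    by (intro Least_equality) (auto simp: S_def intro!: cInf_lower bdd[unfolded S_def])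
  also have "\<dots> \<le> c" using S(1) bdd by (rule cInf_lower)
  finally show ?thesis .
qed

theorem mainTheorem2:
  shows "\<exists>\<epsilon> :: nat \<Rightarrow> real. (\<lambda>n. real n * \<epsilon> n) \<longlonglongrightarrow> 0 \<and>
    (\<forall>n\<ge>1. hermite_hadamard_const n \<le> (1 + 1 / (4 * real n) + \<epsilon> n) * real n ^ (n + 1))"
proof -
  \<comment> \<open>A finite number of terms does not affect the limit.\<close>
  define \<epsilon> where "\<epsilon> n = (if n < 1024 then \<bar>hermite_hadamard_const n\<bar> else 0)" for n
  have "(\<lambda>n. real n * \<epsilon> n) \<longlonglongrightarrow> 0"
    by (rule tendsto_eventually) (auto simp: \<epsilon>_def eventually_at_top_linorder intro!: exI[of _ 1024])
  moreover have "hermite_hadamard_const n \<le> (1 + 1 / (4 * real n) + \<epsilon> n) * real n ^ (n + 1)"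
    if n: "n \<ge> 1" for n
  proof (cases "n < 1024")
    case True
    have 1: "1 \<le> real n ^ (n + 1)" using n by (intro one_le_power) simp
    have "hermite_hadamard_const n \<le> 1 + 1 / (4 * real n) + \<epsilon> n"
      using True n by (auto simp: \<epsilon>_def intro: order_trans[OF abs_ge_self])
    also have "\<dots> \<le> (1 + 1 / (4 * real n) + \<epsilon> n) * real n ^ (n + 1)"
      using mult_left_mono[OF 1, of "1 + 1 / (4 * real n) + \<epsilon> n"] n by (simp add: \<epsilon>_def)
    finally show ?thesis .
  next
    case False
    have "hermite_hadamard_const n \<le> hh_upper n"
      using n by (intro hermite_hadamard_const_le hermite_hadamard_bound_hh_upper) auto
    also have "\<dots> \<le> 1 * real n ^ (n + 1)" using hh_upper_le_power[of n] False by simp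
    also have "\<dots> \<le> (1 + 1 / (4 * real n) + \<epsilon> n) * real n ^ (n + 1)"
      by (intro mult_right_mono) (auto simp: \<epsilon>_def)
    finally show ?thesis .
  qed
  ultimately show ?thesis by blast
qed

end
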